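(* Let $a\neq 0$ be a complex number with $\Re a\ge 0$, and let $\nu$ and $\mu$ be two complex numbers such that $0<\Re\mu<2$. Define $\hat{\Psi}(z)$ to be the integral transform $$\hat{\Psi}(z)=\int_0^{+\infty}x^{\mu-1}e^{-zx-\frac12 ax^2}\,\Psi\left(\nu,\mu;ax^2\right)dx .$$ Then, for every complex number $z$, we have $$\frac{\sqrt{2}\,a^{\frac{\mu}{2}}\sin\pi\mu}{\sqrt{\pi}}\,\hat{\Psi}(z)=e^{\frac{\pi i}{2}\mu}D_{-\nu}\left(\frac{iz}{\sqrt a}\right)D_{\mu-\nu-1}\left(-\frac{iz}{\sqrt a}\right)+e^{-\frac{\pi i}{2}\mu}D_{-\nu}\left(-\frac{iz}{\sqrt a}\right)D_{\mu-\nu-1}\left(\frac{iz}{\sqrt a}\right),$$ and consequently $$D_{-\nu}\left(\frac{z}{\sqrt a}\right)D_{\mu-\nu-1}\left(-\frac{z}{\sqrt a}\right)=\frac{2a^{\frac{\mu}{2}}}{\sqrt{2\pi}}\int_0^{+\infty}\sin\left(zx+\frac{\pi\mu}{2}\right)x^{\mu-1}e^{-\frac12 ax^2}\,\Psi\left(\nu,\mu;ax^2\right)dx .$$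
   Context: $\Phi$ is Kummer's confluent hypergeometric function of the first kind, $\Phi(\nu,\mu;z)=\sum_{n=0}^{\infty}\frac{(\nu)_n}{(\mu)_n}\frac{z^n}{n!}$, where $(\nu)_n=\Gamma(\nu+n)/\Gamma(\nu)=\nu(\nu+1)\cdots(\nu+n-1)$. $\Psi$ is the confluent hypergeometric function of the second kind, $$\Psi(\nu,\mu;z)=\frac{\Gamma(1-\mu)}{\Gamma(\nu+1-\mu)}\Phi(\nu,\mu;z)+\frac{\Gamma(\mu-1)}{\Gamma(\nu)}z^{1-\mu}\Phi(\nu+1-\mu,2-\mu;z),$$ understood as the limit in $\mu$ when $\mu$ is an integer. $D_\nu$ is the parabolic cylinder function, the entire function of $z\in\mathbb{C}$ (and of $\nu\in\mathbb{C}$) defined by $$D_\nu(z)=2^{\nu/2}e^{-z^2/4}\left(\frac{\sqrt{\pi}}{\Gamma(\frac12-\frac{\nu}{2})}\Phi\left(-\tfrac{\nu}{2},\tfrac12;\tfrac{z^2}{2}\right)-\frac{\sqrt{2\pi}\,z}{\Gamma(-\frac{\nu}{2})}\Phi\left(\tfrac12-\tfrac{\nu}{2},\tfrac32;\tfrac{z^2}{2}\right)\right),$$ with $1/\Gamma$ taken to be $0$ at the poles of $\Gamma$. Complex powers and square roots are principal branches.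
   Formalization: Each identity is stated for every z whose integral converges (possibly conditionally); convergence is proved for all z if Re a > 0, and for the first integral if Re z > 0. For Re a = 0 the integrals can diverge, e.g. a = i, ν = 0, μ = 1, z = −1 in the first, so "every z" fails. *)

theory Defs
  imports "HOL-Analysis.Analysis"
begin

(* Only meaningful when mu is not a nonpositive integer. *)
definition Kummer_Phi :: "complex \<Rightarrow> complex \<Rightarrow> complex \<Rightarrow> complex" where
  "Kummer_Phi \<nu> \<mu> z = (\<Sum>n. pochhammer \<nu> n / pochhammer \<mu> n * (z ^ n / fact n))"

(* rGamma is the entire function 1/Gamma, so the denominators Gamma(nu + 1 - mu) and Gamma(nu)
   contribute 0 at the poles of Gamma. *)
definition Kummer_Psi_nonint :: "complex \<Rightarrow> complex \<Rightarrow> complex \<Rightarrow> complex" where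
  "Kummer_Psi_nonint \<nu> \<mu> z =
     Gamma (1 - \<mu>) * rGamma (\<nu> + 1 - \<mu>) * Kummer_Phi \<nu> \<mu> z +
     Gamma (\<mu> - 1) * rGamma \<nu> * z powr (1 - \<mu>) * Kummer_Phi (\<nu> + 1 - \<mu>) (2 - \<mu>) z"

(* Lim (at mu) is a limit over a punctured neighbourhood of mu; close to mu this contains no
   integers, so the non-integer formula applies there. *)
definition Kummer_Psi :: "complex \<Rightarrow> complex \<Rightarrow> complex \<Rightarrow> complex" where
  "Kummer_Psi \<nu> \<mu> z =
     (if \<mu> \<in> \<int> then Lim (at \<mu>) (\<lambda>m. Kummer_Psi_nonint \<nu> m z)
      else Kummer_Psi_nonint \<nu> \<mu> z)"

definition parabolic_D :: "complex \<Rightarrow> complex \<Rightarrow> complex" where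
  "parabolic_D \<nu> z =
     2 powr (\<nu> / 2) * exp (- (z\<^sup>2 / 4)) *
       (of_real (sqrt pi) * rGamma (1 / 2 - \<nu> / 2) * Kummer_Phi (- \<nu> / 2) (1 / 2) (z\<^sup>2 / 2) -
        of_real (sqrt (2 * pi)) * z * rGamma (- \<nu> / 2)
          * Kummer_Phi (1 / 2 - \<nu> / 2) (3 / 2) (z\<^sup>2 / 2))"

definition Psi_kernel :: "complex \<Rightarrow> complex \<Rightarrow> complex \<Rightarrow> real \<Rightarrow> complex" where
  "Psi_kernel a \<nu> \<mu> x =
     of_real x powr (\<mu> - 1) * exp (- (a * (of_real x)\<^sup>2 / 2)) * Kummer_Psi \<nu> \<mu> (a * (of_real x)\<^sup>2)"

definition laplace_integrand :: "complex \<Rightarrow> complex \<Rightarrow> complex \<Rightarrow> complex \<Rightarrow> real \<Rightarrow> complex" where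
  "laplace_integrand a \<nu> \<mu> z x = exp (- (z * of_real x)) * Psi_kernel a \<nu> \<mu> x"

definition sine_integrand :: "complex \<Rightarrow> complex \<Rightarrow> complex \<Rightarrow> complex \<Rightarrow> real \<Rightarrow> complex" where
  "sine_integrand a \<nu> \<mu> z x = sin (z * of_real x + of_real pi * \<mu> / 2) * Psi_kernel a \<nu> \<mu> x"

(* The Henstock-Kurzweil integral over the unbounded set {0..} also covers conditionally
   convergent improper integrals, which occur when a is purely imaginary. *)
definition Psi_hat :: "complex \<Rightarrow> complex \<Rightarrow> complex \<Rightarrow> complex \<Rightarrow> complex" where
  "Psi_hat a \<nu> \<mu> z = integral {0..} (laplace_integrand a \<nu> \<mu> z)"

end

theory Submission
  imports Defs "HOL-Complex_Analysis.Complex_Analysis" "HOL-Real_Asymp.Real_Asymp"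
begin

text \<open>Let \<open>F w\<close> be the Laplace transform of the kernel for \<open>a = 1\<close>, let \<open>S z\<close> be its sine transform, a
  combination of \<open>F (- \<i> z)\<close> and \<open>F (\<i> z)\<close>, and let \<open>Y z = D\<^sub>p z * D\<^sub>q (- z)\<close> with \<open>p = - \<nu>\<close>,
  \<open>q = \<mu> - \<nu> - 1\<close>. The ladder relations of the parabolic cylinder functions express \<open>Y'\<close> through the
  products with parameters \<open>(p - 1, q)\<close>, \<open>(p, q + 1)\<close>, and likewise through \<open>(p + 1, q)\<close>, \<open>(p, q - 1)\<close>;
  the contiguous relations of \<open>\<Psi>\<close> express \<open>S'\<close> through the same shifts, which change \<open>\<mu>\<close> by \<open>1\<close> and so
  can be chosen to stay in the strip \<open>0 < Re \<mu> < 2\<close>. Hence all derivatives of \<open>S\<close> and \<open>Y\<close> at \<open>0\<close> are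
  proportional as soon as their values at \<open>0\<close> are, and these are gamma quotients: for \<open>Re \<nu> > 0\<close> by
  the integral representation of \<open>\<Psi>\<close> and a beta integral, for other \<open>\<nu>\<close> because the integral of
  \<open>d/dx (x * kernel)\<close> vanishes. The lines \<open>Re \<mu> = 1\<close>, the case \<open>\<mu> = 1\<close> included, follow by analytic
  continuation in \<open>\<mu>\<close>. General \<open>a\<close> with \<open>Re a > 0\<close> is reached from \<open>a > 0\<close> by analytic continuation,
  \<open>Re a = 0\<close> by a limit for \<open>Re z > 0\<close>, and conditionally convergent integrals by Abel's theorem.\<close>

section \<open>Kummer's function\<close>

text \<open>No ladder relation closes up on fixed parameters, so the comparison is not a uniqueness
  theorem for a differential equation: it is an induction on the order of the derivative at
  \<open>0\<close>, run for all \<open>\<nu>\<close> and \<open>m\<close> at once. A shift of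
  \<open>m\<close> by \<open>1\<close> stays in the strip from either open half but not from the
  line \<open>Re m = 1\<close>, which is why that line comes last. The sine transform is compared
  rather than the Laplace transform: its phase advances by a quarter period under
  \<open>m + 1\<close>, as differentiation in \<open>z\<close> demands, and its identity keeps its
  content where \<open>sin (\<pi> * \<mu>)\<close> vanishes. The Laplace identity is then a
  combination of two sine identities. A second obstacle is \<open>\<mu> = 1\<close>, where
  \<open>\<Psi>\<close> is only a limit. Holomorphy in \<open>m\<close> comes from a removable
  singularity; bounds are proved on circles of non-integer parameters and carried inside by the
  maximum modulus principle. A third is \<open>Re a = 0\<close>: the kernel loses its Gaussian
  decay, so the integrals are compared with an entire function of \<open>z\<close> built from the
  case \<open>a = 1\<close>.\<close>

lemma norm_pochhammer_quotient_le:
  fixes \<nu> \<mu> :: complex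
  assumes "\<delta> > 0" and "\<And>k. \<delta> \<le> norm (\<mu> + of_nat k)"
  shows "norm (pochhammer \<nu> n / pochhammer \<mu> n) \<le> (1 + norm (\<nu> - \<mu>) / \<delta>) ^ n"
proof (induction n)
  case (Suc n)
  have pos: "norm (\<mu> + of_nat n) > 0"
    using assms(1) assms(2)[of n] by linarith
  \<comment> \<open>Each factor of the quotient is \<open>1 + (\<nu> - \<mu>) / (\<mu> + n)\<close>,
    and \<open>\<delta>\<close> bounds the denominator from below. A geometric bound is enough
    because the Kummer series carries \<open>1 / n!\<close>.\<close>
  have "norm (\<nu> + of_nat n) \<le> norm (\<mu> + of_nat n) + norm (\<nu> - \<mu>)"
    using norm_triangle_ineq[of "\<mu> + of_nat n" "\<nu> - \<mu>"] by (simp add: algebra_simps)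
  also have "norm (\<nu> - \<mu>) \<le> norm (\<nu> - \<mu>) / \<delta> * norm (\<mu> + of_nat n)"
    using assms(1) mult_left_mono[OF assms(2)[of n], of "norm (\<nu> - \<mu>)"]
    by (simp add: field_simps)
  finally have "norm ((\<nu> + of_nat n) / (\<mu> + of_nat n)) \<le> 1 + norm (\<nu> - \<mu>) / \<delta>"
    using pos by (simp add: norm_divide field_simps)
  then have "norm (pochhammer \<nu> n / pochhammer \<mu> n) * norm ((\<nu> + of_nat n) / (\<mu> + of_nat n))
      \<le> (1 + norm (\<nu> - \<mu>) / \<delta>) ^ n * (1 + norm (\<nu> - \<mu>) / \<delta>)"
    using Suc assms(1) by (intro mult_mono) auto
  then show ?case
    by (simp add: pochhammer_Suc norm_mult norm_divide mult_ac)
qed auto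

text \<open>A compact set has positive distance from a disjoint closed set. This supplies one
  \<open>\<delta>\<close> for a whole compact set of parameters and so makes the series bounds
  uniform.\<close>

lemma compact_avoids_nonpos_Ints:
  fixes K :: "complex set"
  assumes "compact K" and "K \<inter> \<int>\<^sub>\<le>\<^sub>0 = {}"
  obtains \<delta> where "\<delta> > 0" and "\<And>z k. z \<in> K \<Longrightarrow> \<delta> \<le> norm (z + of_nat k)"
proof -
  obtain d where d: "d > 0" "\<And>x y. x \<in> K \<Longrightarrow> y \<in> \<int>\<^sub>\<le>\<^sub>0 \<Longrightarrow> d \<le> dist x y"
    using separate_compact_closed[OF assms(1) closed_nonpos_Ints assms(2)] by metis
  have "d \<le> norm (z + of_nat k)" if "z \<in> K" for z k
    using d(2)[OF that, of "- of_nat k"] by (simp add: dist_norm)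
  with d(1) show ?thesis by (rule that)
qed

text \<open>An exponential series majorises the Kummer series, with constants depending only on
  \<open>\<delta>\<close>, \<open>B\<close> and \<open>R\<close>. The same bound serves summability,
  the size of \<open>Kummer_Phi\<close> and uniform convergence.\<close>

lemma Kummer_term_bound:
  fixes \<nu> \<mu> z :: complex
  assumes "\<delta> > 0" and "\<And>k. \<delta> \<le> norm (\<mu> + of_nat k)"
    and "norm (\<nu> - \<mu>) / \<delta> \<le> B" and "norm z \<le> R"
  shows "norm (pochhammer \<nu> n / pochhammer \<mu> n * (z ^ n / fact n)) \<le> inverse (fact n) * ((1 + B) * R) ^ n"
proof -
  have "norm (pochhammer \<nu> n / pochhammer \<mu> n) \<le> (1 + norm (\<nu> - \<mu>) / \<delta>) ^ n"
    by (rule norm_pochhammer_quotient_le) (use assms in auto)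
  also have "\<dots> \<le> (1 + B) ^ n"
    using assms by (intro power_mono) auto
  finally have 1: "norm (pochhammer \<nu> n / pochhammer \<mu> n) \<le> (1 + B) ^ n" .
  have "norm (z ^ n / fact n) \<le> inverse (fact n) * R ^ n"
    using assms power_mono[OF assms(4), of n]
    by (simp add: norm_divide norm_power field_simps)
  with 1 have "norm (pochhammer \<nu> n / pochhammer \<mu> n) * norm (z ^ n / fact n)
      \<le> (1 + B) ^ n * (inverse (fact n) * R ^ n)"
    by (intro mult_mono) (auto intro: order_trans[OF norm_ge_zero])
  then show ?thesis
    by (simp only: norm_mult power_mult_distrib mult_ac)
qed

lemma Kummer_summable:
  assumes "\<mu> \<notin> \<int>\<^sub>\<le>\<^sub>0"
  shows "summable (\<lambda>n. pochhammer \<nu> n / pochhammer \<mu> n * (z ^ n / fact n :: complex))"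
proof -
  obtain \<delta> where d: "\<delta> > 0" "\<And>k. \<delta> \<le> norm (\<mu> + of_nat k)"
    using compact_avoids_nonpos_Ints[of "{\<mu>}"] assms by (metis Int_insert_left_if0 compact_sing inf_bot_left insertI1)
  show ?thesis
    by (rule summable_comparison_test'[OF summable_exp[of "(1 + norm (\<nu> - \<mu>) / \<delta>) * norm z"]])
       (use Kummer_term_bound[OF d order.refl order.refl] in auto)
qed

lemma Kummer_sums:
  assumes "\<mu> \<notin> \<int>\<^sub>\<le>\<^sub>0"
  shows "(\<lambda>n. pochhammer \<nu> n / pochhammer \<mu> n * (z ^ n / fact n)) sums Kummer_Phi \<nu> \<mu> z"
  unfolding Kummer_Phi_def using Kummer_summable[OF assms] by (rule summable_sums)

lemma norm_Kummer_Phi_le: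
  assumes "\<delta> > 0" and "\<And>k. \<delta> \<le> norm (\<mu> + of_nat k)"
    and "norm (\<nu> - \<mu>) / \<delta> \<le> B" and "norm z \<le> R"
  shows "norm (Kummer_Phi \<nu> \<mu> z) \<le> exp ((1 + B) * R)"
proof -
  have "norm (Kummer_Phi \<nu> \<mu> z) \<le> (\<Sum>n. inverse (fact n) * ((1 + B) * R) ^ n)"
    unfolding Kummer_Phi_def
    by (rule norm_suminf_le[OF Kummer_term_bound[OF assms] summable_exp])
  then show ?thesis
    by (simp add: exp_def scaleR_conv_of_real)
qed

text \<open>The partial sums are holomorphic and converge locally uniformly by the M-test. Inserting
  three functions covers holomorphy in the argument and in both parameters at once.\<close>

lemma Kummer_Phi_holomorphic:
  assumes "open A" and f: "f holomorphic_on A" and g: "g holomorphic_on A" and h: "h holomorphic_on A"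
    and "\<And>x. x \<in> A \<Longrightarrow> g x \<notin> \<int>\<^sub>\<le>\<^sub>0"
  shows "(\<lambda>x. Kummer_Phi (f x) (g x) (h x)) holomorphic_on A"
proof (rule holomorphic_uniform_sequence[OF \<open>open A\<close>])
  fix n
  have poch: "(\<lambda>x. pochhammer (u x) k) holomorphic_on A" if "u holomorphic_on A" for u :: "complex \<Rightarrow> complex" and k
    unfolding pochhammer_prod by (intro holomorphic_intros that)
  have "pochhammer (g x) k \<noteq> 0" if "x \<in> A" for x k
    using assms(5)[OF that] by (auto simp: pochhammer_eq_0_iff)
  then show "(\<lambda>x. \<Sum>k<n. pochhammer (f x) k / pochhammer (g x) k * (h x ^ k / fact k)) holomorphic_on A"
    by (intro holomorphic_intros poch f g h) auto
next
  fix x assume "x \<in> A"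
  then obtain d where d: "d > 0" "cball x d \<subseteq> A"
    using \<open>open A\<close> open_contains_cball by blast
  have cont: "continuous_on (cball x d) u" if "u holomorphic_on A" for u :: "complex \<Rightarrow> complex"
    using that d holomorphic_on_imp_continuous_on continuous_on_subset by blast
  have comp: "compact (u ` cball x d)" if "u holomorphic_on A" for u :: "complex \<Rightarrow> complex"
    by (intro compact_continuous_image cont that compact_cball)
  obtain \<delta> where delta: "\<delta> > 0" "\<And>z k. z \<in> g ` cball x d \<Longrightarrow> \<delta> \<le> norm (z + of_nat k)"
    using compact_avoids_nonpos_Ints[OF comp[OF g]] assms(5) d by blast
  obtain B where B: "\<And>y. y \<in> cball x d \<Longrightarrow> norm (f y - g y) \<le> B"
    using compact_imp_bounded[OF comp[OF holomorphic_on_diff[OF f g]]]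
    unfolding bounded_iff by blast
  obtain R where R: "\<And>y. y \<in> cball x d \<Longrightarrow> norm (h y) \<le> R"
    using compact_imp_bounded[OF comp[OF h]] unfolding bounded_iff by blast
  have "uniform_limit (cball x d) (\<lambda>n y. \<Sum>k<n. pochhammer (f y) k / pochhammer (g y) k * (h y ^ k / fact k))
          (\<lambda>y. \<Sum>k. pochhammer (f y) k / pochhammer (g y) k * (h y ^ k / fact k)) sequentially"
    by (rule Weierstrass_m_test[OF Kummer_term_bound[of \<delta> _ _ "B / \<delta>" _ R] summable_exp])
       (use delta B R in \<open>auto intro: divide_right_mono\<close>)
  then show "\<exists>d>0. cball x d \<subseteq> A \<and> uniform_limit (cball x d)
       (\<lambda>n y. \<Sum>k<n. pochhammer (f y) k / pochhammer (g y) k * (h y ^ k / fact k))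
       (\<lambda>x. Kummer_Phi (f x) (g x) (h x)) sequentially"
    using d unfolding Kummer_Phi_def by blast
qed

lemma nonpos_Ints_add_1_complex:
  "\<mu> \<notin> \<int>\<^sub>\<le>\<^sub>0 \<Longrightarrow> \<mu> + 1 \<notin> (\<int>\<^sub>\<le>\<^sub>0 :: complex set)"
  using plus_one_in_nonpos_Ints_imp by blast

lemma Kummer_Phi_0 [simp]: "Kummer_Phi \<nu> \<mu> 0 = 1"
proof -
  have "Kummer_Phi \<nu> \<mu> 0 = (\<Sum>n. (if n = 0 then 1 else 0))"
    unfolding Kummer_Phi_def by (intro suminf_cong) (auto simp: power_0_left)
  also have "\<dots> = 1"
    using sums_unique[OF sums_single[of 0 "\<lambda>_. 1 :: complex"]] by simp
  finally show ?thesis .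
qed

lemma Kummer_Phi_has_derivative:
  assumes "\<mu> \<notin> \<int>\<^sub>\<le>\<^sub>0"
  shows "(Kummer_Phi \<nu> \<mu> has_field_derivative \<nu> / \<mu> * Kummer_Phi (\<nu> + 1) (\<mu> + 1) z) (at z)"
proof -
  define c where "c n = pochhammer \<nu> n / pochhammer \<mu> n / fact n" for n
  have eq: "c n * y ^ n = pochhammer \<nu> n / pochhammer \<mu> n * (y ^ n / fact n)" for n y
    by (simp add: c_def)
  have D: "((\<lambda>x. \<Sum>n. c n * x ^ n) has_field_derivative (\<Sum>n. diffs c n * z ^ n)) (at z)"
    by (rule termdiffs_strong_converges_everywhere) (simp only: eq Kummer_summable[OF assms])
  have "diffs c n * z ^ n =
      \<nu> / \<mu> * (pochhammer (\<nu> + 1) n / pochhammer (\<mu> + 1) n * (z ^ n / fact n))" for n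
    by (simp add: diffs_def c_def pochhammer_rec field_simps del: of_nat_Suc)
  then have "(\<Sum>n. diffs c n * z ^ n) = \<nu> / \<mu> * Kummer_Phi (\<nu> + 1) (\<mu> + 1) z"
    using suminf_mult[OF Kummer_summable[OF nonpos_Ints_add_1_complex[OF assms]], of "\<nu> / \<mu>" "\<nu> + 1" z]
    by (simp add: Kummer_Phi_def)
  with D show ?thesis
    by (simp add: eq Kummer_Phi_def[abs_def])
qed

text \<open>True coefficient by coefficient, since
  \<open>\<mu> * (\<mu> + 1)_n = (\<mu>)_n * (\<mu> + n)\<close> and likewise for
  \<open>\<nu>\<close>.\<close>

lemma Kummer_Phi_contiguous_1:
  assumes "\<mu> \<notin> \<int>\<^sub>\<le>\<^sub>0"
  shows "\<mu> * Kummer_Phi \<nu> \<mu> z =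
    \<nu> * Kummer_Phi (\<nu> + 1) (\<mu> + 1) z + (\<mu> - \<nu>) * Kummer_Phi \<nu> (\<mu> + 1) z"
proof -
  have m1: "\<mu> + 1 \<notin> \<int>\<^sub>\<le>\<^sub>0" using nonpos_Ints_add_1_complex[OF assms] .
  have *: "\<mu> * (pochhammer \<nu> n / pochhammer \<mu> n * (z ^ n / fact n)) =
     \<nu> * (pochhammer (\<nu> + 1) n / pochhammer (\<mu> + 1) n * (z ^ n / fact n)) +
     (\<mu> - \<nu>) * (pochhammer \<nu> n / pochhammer (\<mu> + 1) n * (z ^ n / fact n))" for n
  proof -
    have nz: "pochhammer \<mu> n \<noteq> 0" "pochhammer (\<mu> + 1) n \<noteq> 0" "\<mu> + of_nat n \<noteq> 0" "\<mu> \<noteq> 0"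
      using assms m1 plus_of_nat_eq_0_imp[of \<mu> n] by (auto simp: pochhammer_eq_0_iff)
    have e1: "\<mu> * pochhammer (\<mu> + 1) n = pochhammer \<mu> n * (\<mu> + of_nat n)"
      using pochhammer_rec[of \<mu> n] pochhammer_Suc[of \<mu> n] by (simp add: mult_ac)
    have e2: "\<nu> * pochhammer (\<nu> + 1) n = pochhammer \<nu> n * (\<nu> + of_nat n)"
      using pochhammer_rec[of \<nu> n] pochhammer_Suc[of \<nu> n] by (simp add: mult_ac)
    have "\<mu> * (pochhammer \<nu> n / pochhammer \<mu> n) =
       \<nu> * pochhammer (\<nu> + 1) n / pochhammer (\<mu> + 1) n + (\<mu> - \<nu>) * (pochhammer \<nu> n / pochhammer (\<mu> + 1) n)"
      unfolding e2 using nz e1 by (simp add: divide_simps) algebra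
    from arg_cong[OF this, of "\<lambda>x. x * (z ^ n / fact n)"] show ?thesis
      by (simp only: distrib_right times_divide_eq_left times_divide_eq_right mult.assoc divide_divide_eq_left
          add_divide_distrib)
  qed
  have "(\<lambda>n. \<mu> * (pochhammer \<nu> n / pochhammer \<mu> n * (z ^ n / fact n))) sums
     (\<nu> * Kummer_Phi (\<nu> + 1) (\<mu> + 1) z + (\<mu> - \<nu>) * Kummer_Phi \<nu> (\<mu> + 1) z)"
    unfolding * by (intro sums_add sums_mult Kummer_sums m1)
  moreover have "(\<lambda>n. \<mu> * (pochhammer \<nu> n / pochhammer \<mu> n * (z ^ n / fact n))) sums (\<mu> * Kummer_Phi \<nu> \<mu> z)"
    by (intro sums_mult Kummer_sums assms)
  ultimately show ?thesis using sums_unique2 by blast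
qed

text \<open>The discrete power rule for rising factorials; the factor \<open>Suc n\<close> will
  cancel against the factorial in the Kummer series.\<close>

lemma pochhammer_add_1_diff:
  "pochhammer (b + 1) (Suc n) - pochhammer b (Suc n) = of_nat (Suc n) * pochhammer (b + 1 :: complex) n"
  using pochhammer_rec[of b n] pochhammer_Suc[of "b + 1" n] by (simp add: algebra_simps)

text \<open>The constant terms cancel, and what remains is a Kummer series with its index shifted by
  one.\<close>

lemma Kummer_Phi_contiguous_2:
  assumes "\<mu> \<notin> \<int>\<^sub>\<le>\<^sub>0"
  shows "Kummer_Phi (\<nu> + 1) \<mu> z - Kummer_Phi \<nu> \<mu> z = z / \<mu> * Kummer_Phi (\<nu> + 1) (\<mu> + 1) z"
proof -
  have m1: "\<mu> + 1 \<notin> \<int>\<^sub>\<le>\<^sub>0" using nonpos_Ints_add_1_complex[OF assms] .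
  define d where "d n = pochhammer (\<nu> + 1) n / pochhammer \<mu> n * (z ^ n / fact n) -
      pochhammer \<nu> n / pochhammer \<mu> n * (z ^ n / fact n)" for n
  have "d (Suc n) = z / \<mu> * (pochhammer (\<nu> + 1) n / pochhammer (\<mu> + 1) n * (z ^ n / fact n))" for n
  proof -
    have "d (Suc n) = (pochhammer (\<nu> + 1) (Suc n) - pochhammer \<nu> (Suc n)) / pochhammer \<mu> (Suc n) * (z ^ Suc n / fact (Suc n))"
      by (simp add: d_def diff_divide_distrib left_diff_distrib del: fact_Suc pochhammer_Suc)
    also have "\<dots> = z / \<mu> * (pochhammer (\<nu> + 1) n / pochhammer (\<mu> + 1) n * (z ^ n / fact n))"
      unfolding pochhammer_add_1_diff by (simp add: pochhammer_rec[of \<mu>] del: of_nat_Suc)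
    finally show ?thesis .
  qed
  then have "(\<lambda>n. d (Suc n)) sums (z / \<mu> * Kummer_Phi (\<nu> + 1) (\<mu> + 1) z)"
    by (simp only: sums_mult[OF Kummer_sums[OF m1]])
  moreover have "d 0 = 0" by (simp add: d_def)
  ultimately have "d sums (z / \<mu> * Kummer_Phi (\<nu> + 1) (\<mu> + 1) z)"
    using sums_Suc_iff[of d] by simp
  moreover have "d sums (Kummer_Phi (\<nu> + 1) \<mu> z - Kummer_Phi \<nu> \<mu> z)"
    unfolding d_def by (intro sums_diff Kummer_sums assms)
  ultimately show ?thesis using sums_unique2 by blast
qed

text \<open>Equivalent to \<open>d/dz (z powr \<mu> * \<Phi>(\<nu>, \<mu> + 1; z)) = \<mu> * z powr (\<mu> - 1) * \<Phi>(\<nu>, \<mu>; z)\<close>.\<close>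

lemma Kummer_Phi_lower_derivative:
  assumes "\<mu> \<notin> \<int>\<^sub>\<le>\<^sub>0"
  shows "\<mu> * Kummer_Phi \<nu> (\<mu> + 1) z + z * (\<nu> / (\<mu> + 1) * Kummer_Phi (\<nu> + 1) (\<mu> + 2) z)
           = \<mu> * Kummer_Phi \<nu> \<mu> z"
proof -
  have m1: "\<mu> + 1 \<notin> \<int>\<^sub>\<le>\<^sub>0" using nonpos_Ints_add_1_complex[OF assms] .
  have "z / (\<mu> + 1) * Kummer_Phi (\<nu> + 1) (\<mu> + 1 + 1) z = Kummer_Phi (\<nu> + 1) (\<mu> + 1) z - Kummer_Phi \<nu> (\<mu> + 1) z"
    using Kummer_Phi_contiguous_2[OF m1, of \<nu> z] by simp
  moreover have "z * (\<nu> / (\<mu> + 1) * Kummer_Phi (\<nu> + 1) (\<mu> + 2) z) =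
      \<nu> * (z / (\<mu> + 1) * Kummer_Phi (\<nu> + 1) (\<mu> + 1 + 1) z)"
    by (simp add: add.assoc)
  ultimately have "z * (\<nu> / (\<mu> + 1) * Kummer_Phi (\<nu> + 1) (\<mu> + 2) z) =
      \<nu> * (Kummer_Phi (\<nu> + 1) (\<mu> + 1) z - Kummer_Phi \<nu> (\<mu> + 1) z)"
    by simp
  then show ?thesis
    unfolding Kummer_Phi_contiguous_1[OF assms, of \<nu> z] by algebra
qed

section \<open>Parabolic cylinder functions\<close>

lemma rGamma_eq_mult_rGamma_plus1: "rGamma z = z * rGamma (z + 1 :: complex)"
  using rGamma_plus1[of z] by simp

lemma half_notin_nonpos_Ints: "1 / 2 \<notin> (\<int>\<^sub>\<le>\<^sub>0 :: complex set)" "3 / 2 \<notin> (\<int>\<^sub>\<le>\<^sub>0 :: complex set)"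
  by (auto elim!: nonpos_Ints_cases simp: complex_eq_iff)

text \<open>The lowering relation. Differentiation exchanges the even and the odd Kummer series of
  the definition, the Gamma recursion turns the coefficients into those of index
  \<open>p - 1\<close>, and the Gaussian factor contributes \<open>- z / 2\<close>.\<close>

lemma parabolic_D_has_derivative:
  "(parabolic_D p has_field_derivative p * parabolic_D (p - 1) z - z / 2 * parabolic_D p z) (at z)"
proof -
  \<comment> \<open>With \<open>b\<close> all Kummer and Gamma parameters are \<open>b\<close> plus
    a half-integer; with \<open>s\<close> and \<open>r\<close> for the square roots the closing
    identity is polynomial, up to \<open>r * r = 2\<close>.\<close>
  define b where "b = - p / 2"
  define s where "s = (of_real (sqrt pi) :: complex)"
  define r where "r = (of_real (sqrt 2) :: complex)"
  have rr: "r * r = 2" by (simp add: r_def flip: of_real_mult)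
  have rs: "of_real (sqrt (2 * pi)) = r * s" by (simp add: r_def s_def real_sqrt_mult)
  have r2: "2 powr (1/2) = r"
    unfolding r_def using csqrt_of_real_nonneg[of 2] by (simp add: csqrt_conv_powr)
  let ?y = "z\<^sup>2 / 2"
  let ?B = "Kummer_Phi (b + 1) (3/2) ?y"
  let ?C = "Kummer_Phi (b + 1/2) (3/2) ?y"
  let ?D = "Kummer_Phi (b + 1/2) (1/2) ?y"
  let ?E = "Kummer_Phi (b + 3/2) (5/2) ?y"
  define \<alpha> where "\<alpha> = rGamma (b + 1/2)"
  define \<beta> where "\<beta> = rGamma (b + 1)"
  have bb: "rGamma b = b * \<beta>" unfolding \<beta>_def by (rule rGamma_eq_mult_rGamma_plus1)
  \<comment> \<open>The left side is the derivative of
    \<open>z * Kummer_Phi (b + 1/2) (3/2) (z^2 / 2)\<close>; the right side is the even series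
    belonging to index \<open>p - 1\<close>.\<close>
  have low: "?C + z\<^sup>2 * ((b + 1/2) * 2/3) * ?E = ?D"
  proof -
    have e: "b + 1/2 + 1 = b + 3/2" "1/2 + 1 = (3/2 :: complex)" "1/2 + 2 = (5/2 :: complex)"
      by simp_all
    have "1/2 * ?C + ?y * ((b + 1/2) / (3/2) * ?E) = 1/2 * ?D"
      using Kummer_Phi_lower_derivative[OF half_notin_nonpos_Ints(1), of "b + 1/2" ?y] unfolding e .
    from arg_cong[OF this, of "\<lambda>x. 2 * x"] show ?thesis
      by (simp add: distrib_left distrib_right mult_ac)
  qed
  have D1: "((\<lambda>z. Kummer_Phi b (1/2) (z\<^sup>2 / 2)) has_field_derivative z * 2 * b * ?B) (at z)"
    by (rule DERIV_cong[OF DERIV_chain2[OF Kummer_Phi_has_derivative[OF half_notin_nonpos_Ints(1)]]])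
       (auto intro!: derivative_eq_intros simp: field_simps)
  have D2: "((\<lambda>z. Kummer_Phi (b + 1/2) (3/2) (z\<^sup>2 / 2)) has_field_derivative z * ((b + 1/2) * 2/3) * ?E) (at z)"
    by (rule DERIV_cong[OF DERIV_chain2[OF Kummer_Phi_has_derivative[OF half_notin_nonpos_Ints(2)]]])
       (auto intro!: derivative_eq_intros simp: field_simps)
  have e0: "1 / 2 - p / 2 = b + 1/2" "- p / 2 = b" by (simp_all add: b_def)
  have Dp: "parabolic_D p = (\<lambda>z. 2 powr (p / 2) * exp (- (z\<^sup>2 / 4)) *
      (s * \<alpha> * Kummer_Phi b (1/2) (z\<^sup>2 / 2) - r * s * z * (b * \<beta>) * Kummer_Phi (b + 1/2) (3/2) (z\<^sup>2 / 2)))"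
    unfolding parabolic_D_def[abs_def] rs s_def[symmetric] e0 bb \<alpha>_def by (simp add: mult.assoc)
  have p1: "2 powr (p / 2) = r * 2 powr ((p - 1) / 2)"
    unfolding r2[symmetric] by (simp add: powr_add[symmetric] field_simps)
  have e1: "1 / 2 - (p - 1) / 2 = b + 1" "- (p - 1) / 2 = b + 1/2" "1 / 2 - - (- (p - 1)) / 2 = b + 1"
    by (simp_all add: b_def field_simps)
  have Dp1: "parabolic_D (p - 1) z = 2 powr ((p - 1) / 2) * exp (- (z\<^sup>2 / 4)) *
      (s * \<beta> * ?D - r * s * z * \<alpha> * ?B)"
    unfolding parabolic_D_def[abs_def] rs s_def[symmetric] e1 \<alpha>_def \<beta>_def ..
  have "(parabolic_D p has_field_derivative
      2 powr (p / 2) * exp (- (z\<^sup>2 / 4)) * (s * \<alpha> * (z * 2 * b * ?B) - r * s * (b * \<beta>) * (?C + z * (z * ((b + 1/2) * 2/3) * ?E)))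
      - z / 2 * parabolic_D p z) (at z)"
    unfolding Dp by (rule derivative_eq_intros D1 D2 refl | simp)+ (simp add: field_simps power2_eq_square)
  also have "?C + z * (z * ((b + 1/2) * 2/3) * ?E) = ?D"
    unfolding low[symmetric] by (simp add: power2_eq_square)
  also have "2 powr (p / 2) * exp (- (z\<^sup>2 / 4)) * (s * \<alpha> * (z * 2 * b * ?B) - r * s * (b * \<beta>) * ?D) =
      p * parabolic_D (p - 1) z"
  proof -
    have "p = - 2 * b" by (simp add: b_def)
    have "r * (s * \<alpha> * (z * 2 * b * ?B) - r * s * (b * \<beta>) * ?D) = p * (s * \<beta> * ?D - r * s * z * \<alpha> * ?B)"
    proof -
      have "r * (s * \<alpha> * (z * 2 * b * B) - r * s * (b * \<beta>) * D) + 2 * b * (s * \<beta> * D - r * s * z * \<alpha> * B)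
          = (2 - r * r) * (s * b * \<beta> * D)" for B D
        by (simp add: algebra_simps)
      then show ?thesis unfolding \<open>p = - 2 * b\<close> using rr by (simp add: eq_neg_iff_add_eq_0)
    qed
    then show ?thesis unfolding p1 Dp1 by algebra
  qed
  finally show ?thesis .
qed

text \<open>Compared separately on even and odd parts: the even part reduces to \<open>c1\<close>,
  the odd part to \<open>c2\<close>, both contiguous relations of \<open>Kummer_Phi\<close>.\<close>

lemma parabolic_D_recurrence:
  "parabolic_D (p + 1) z = z * parabolic_D p z - p * parabolic_D (p - 1) z"
proof -
  define b where "b = - p / 2"
  define s where "s = (of_real (sqrt pi) :: complex)"
  define r where "r = (of_real (sqrt 2) :: complex)"
  have rr: "r * r = 2" by (simp add: r_def flip: of_real_mult)
  have rs: "of_real (sqrt (2 * pi)) = r * s" by (simp add: r_def s_def real_sqrt_mult)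
  have r2: "2 powr (1/2) = r"
    unfolding r_def using csqrt_of_real_nonneg[of 2] by (simp add: csqrt_conv_powr)
  let ?y = "z\<^sup>2 / 2"
  let ?A = "Kummer_Phi b (1/2) ?y"
  let ?B = "Kummer_Phi (b + 1) (3/2) ?y"
  let ?C = "Kummer_Phi (b + 1/2) (3/2) ?y"
  let ?D = "Kummer_Phi (b + 1/2) (1/2) ?y"
  let ?F = "Kummer_Phi (b - 1/2) (1/2) ?y"
  let ?G = "Kummer_Phi b (3/2) ?y"
  define \<alpha> where "\<alpha> = rGamma (b + 1/2)"
  define \<beta> where "\<beta> = rGamma (b + 1)"
  have bb: "rGamma b = b * \<beta>" unfolding \<beta>_def by (rule rGamma_eq_mult_rGamma_plus1)
  have aa: "rGamma (b - 1/2) = (b - 1/2) * \<alpha>"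
    unfolding \<alpha>_def using rGamma_eq_mult_rGamma_plus1[of "b - 1/2"] by (simp add: algebra_simps)
  have p1: "2 powr (p / 2) = r * 2 powr ((p - 1) / 2)"
    unfolding r2[symmetric] by (simp add: powr_add[symmetric] field_simps)
  have p2: "2 powr ((p + 1) / 2) = 2 * 2 powr ((p - 1) / 2)"
    using powr_add[of 2 1 "(p - 1) / 2"] by (simp add: field_simps)
  have e0: "1 / 2 - p / 2 = b + 1/2" "- p / 2 = b" by (simp_all add: b_def)
  have e1: "1 / 2 - (p - 1) / 2 = b + 1" "- (p - 1) / 2 = b + 1/2"
    by (simp_all add: b_def field_simps)
  have e2: "1 / 2 - (p + 1) / 2 = b" "- (p + 1) / 2 = b - 1/2"
    by (simp_all add: b_def field_simps)
  have c1: "?D - ?F = z\<^sup>2 * ?C"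
  proof -
    have e: "b - 1/2 + 1 = b + 1/2" "1/2 + 1 = (3/2 :: complex)" by simp_all
    show ?thesis
      using Kummer_Phi_contiguous_2[OF half_notin_nonpos_Ints(1), of "b - 1/2" ?y] unfolding e by simp
  qed
  have c2: "?A = 2 * b * ?B + (1 - 2 * b) * ?G"
    using Kummer_Phi_contiguous_1[OF half_notin_nonpos_Ints(1), of b ?y] by (simp add: field_simps)
  have pb: "p = - 2 * b" by (simp add: b_def)
  have "2 * (s * (b * \<beta>) * ?F - r * s * z * ((b - 1/2) * \<alpha>) * ?G) =
     z * r * (s * \<alpha> * ?A - r * s * z * (b * \<beta>) * ?C) - p * (s * \<beta> * ?D - r * s * z * \<alpha> * ?B)"
  proof -
    have F: "?F = ?D - z\<^sup>2 * ?C" using c1 by (simp add: algebra_simps)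
    \<comment> \<open>\<open>h\<close> stands for \<open>b - 1/2\<close>, which leaves an identity
      without fractions, modulo \<open>r * r = 2\<close>.\<close>
    have "2 * (s * (b * \<beta>) * (D - z\<^sup>2 * C) - r * s * z * (h * \<alpha>) * G) =
       z * r * (s * \<alpha> * (2 * b * B + (1 - 2 * b) * G) - r * s * z * (b * \<beta>) * C) + 2 * b * (s * \<beta> * D - r * s * z * \<alpha> * B)"
      if "2 * h = 2 * b - 1" for h B C D G
      using that rr by algebra
    from this[of "b - 1/2" ?D ?C ?G ?B] show ?thesis unfolding pb F c2 by simp
  qed
  then show ?thesis
    unfolding parabolic_D_def rs s_def[symmetric] e0 e1 e2 p1 p2 bb aa \<alpha>_def[symmetric] \<beta>_def[symmetric]
    by algebra
qed

text \<open>The raising relation, by elimination of \<open>parabolic_D (p - 1)\<close>. In a product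
  one factor will be lowered and the other raised, which can be done in two ways.\<close>

lemma parabolic_D_has_derivative':
  "(parabolic_D p has_field_derivative z / 2 * parabolic_D p z - parabolic_D (p + 1) z) (at z)"
  by (rule DERIV_cong[OF parabolic_D_has_derivative]) (simp add: parabolic_D_recurrence)

lemma parabolic_D_0:
  "parabolic_D p 0 = 2 powr (p / 2) * of_real (sqrt pi) * rGamma (1 / 2 - p / 2)"
  by (simp add: parabolic_D_def)

lemma parabolic_D_holomorphic [holomorphic_intros]:
  assumes "f holomorphic_on A"
  shows "(\<lambda>z. parabolic_D p (f z)) holomorphic_on A"
proof -
  have "parabolic_D p holomorphic_on UNIV"
    using parabolic_D_has_derivative by (auto simp: holomorphic_on_def field_differentiable_def)
  from holomorphic_on_compose_gen[OF assms this] show ?thesis by (simp add: o_def)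
qed

lemma parabolic_D_index_holomorphic: "(\<lambda>p. parabolic_D p z) holomorphic_on UNIV"
  unfolding parabolic_D_def
  by (intro holomorphic_intros Kummer_Phi_holomorphic)
     (auto simp: half_notin_nonpos_Ints[simplified])

definition D_product :: "complex \<Rightarrow> complex \<Rightarrow> complex \<Rightarrow> complex" where
  "D_product p q z = parabolic_D p z * parabolic_D q (- z)"

text \<open>The terms \<open>z / 2\<close> in the ladder relations of the two factors cancel.\<close>

lemma D_product_has_derivative_up:
  "(D_product p q has_field_derivative p * D_product (p - 1) q z + D_product p (q + 1) z) (at z)"
  unfolding D_product_def
  by (rule DERIV_cong[OF DERIV_mult[OF parabolic_D_has_derivative
        DERIV_chain2[OF parabolic_D_has_derivative' DERIV_minus[OF DERIV_ident]]]])
     (simp add: algebra_simps)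

lemma D_product_has_derivative_down:
  "(D_product p q has_field_derivative - D_product (p + 1) q z - q * D_product p (q - 1) z) (at z)"
  unfolding D_product_def
  by (rule DERIV_cong[OF DERIV_mult[OF parabolic_D_has_derivative'
        DERIV_chain2[OF parabolic_D_has_derivative DERIV_minus[OF DERIV_ident]]]])
     (simp add: algebra_simps)

lemma D_product_holomorphic: "D_product p q holomorphic_on A"
  unfolding D_product_def by (intro holomorphic_intros)

section \<open>Tricomi's function for non-integer parameter\<close>

lemma Ints_diff_left_iff: "n \<in> \<int> \<Longrightarrow> n - m \<in> \<int> \<longleftrightarrow> m \<in> (\<int> :: complex set)"
  by (metis Ints_diff diff_diff_eq2 add_diff_cancel_left')

lemma notin_Ints_imp_notin_nonpos_Ints: "m \<notin> \<int> \<Longrightarrow> m \<notin> (\<int>\<^sub>\<le>\<^sub>0 :: complex set)"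
  using nonpos_Ints_subset_Ints by blast

text \<open>Kummer's transformation: replacing \<open>\<nu>\<close>, \<open>m\<close> by
  \<open>\<nu> - m + 1\<close>, \<open>2 - m\<close> exchanges the two terms of the definition, up
  to the power of \<open>t\<close>.\<close>

lemma Kummer_Psi_nonint_reflect:
  assumes "t \<noteq> 0"
  shows "Kummer_Psi_nonint \<nu> m t = t powr (1 - m) * Kummer_Psi_nonint (\<nu> - m + 1) (2 - m) t"
proof -
  have e: "1 - (2 - m) = m - 1" "\<nu> - m + 1 + 1 - (2 - m) = \<nu>" "2 - m - 1 = 1 - m" "2 - (2 - m) = m"
      "\<nu> + 1 - m = \<nu> - m + 1"
    by simp_all
  have p: "t powr (1 - m) * t powr (m - 1) = 1"
    using assms by (simp add: powr_add[symmetric])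
  show ?thesis
    unfolding Kummer_Psi_nonint_def e using p by algebra
qed

text \<open>\<open>Kummer_Phi_contiguous_1\<close> settles the first term of the definition and
  \<open>Kummer_Phi_contiguous_2\<close> the second, once the Gamma recursions have aligned the
  coefficients.\<close>

lemma Kummer_Psi_nonint_up:
  assumes m: "m \<notin> \<int>" and t: "t \<noteq> 0"
  shows "Kummer_Psi_nonint \<nu> m t = Kummer_Psi_nonint \<nu> (m + 1) t - \<nu> * Kummer_Psi_nonint (\<nu> + 1) (m + 1) t"
proof -
  have n: "m \<notin> \<int>\<^sub>\<le>\<^sub>0" "- m \<notin> \<int>\<^sub>\<le>\<^sub>0" "1 - m \<notin> \<int>\<^sub>\<le>\<^sub>0" "m - 1 \<notin> \<int>\<^sub>\<le>\<^sub>0"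
    using m by (auto intro!: notin_Ints_imp_notin_nonpos_Ints simp: Ints_diff_left_iff minus_in_Ints_iff
        dest: Ints_add[of "m - 1" 1])
  have nz: "m \<noteq> 0" "1 - m \<noteq> 0" using n by auto
  have e: "1 - (m + 1) = - m" "m + 1 - 1 = m" "\<nu> + 1 - (m + 1) = \<nu> - m" "2 - (m + 1) = 1 - m"
    "\<nu> + 1 + 1 - (m + 1) = \<nu> - m + 1" "\<nu> + 1 - m = \<nu> - m + 1"
    by simp_all
  have G1: "Gamma (1 - m) = - m * Gamma (- m)"
    using Gamma_plus1[OF n(2)] by simp
  have G2: "Gamma m = (m - 1) * Gamma (m - 1)"
    using Gamma_plus1[OF n(4)] by simp
  have r1: "rGamma (\<nu> - m) = (\<nu> - m) * rGamma (\<nu> - m + 1)"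
    by (rule rGamma_eq_mult_rGamma_plus1)
  have r2: "rGamma \<nu> = \<nu> * rGamma (\<nu> + 1)"
    by (rule rGamma_eq_mult_rGamma_plus1)
  have p: "t powr (1 - m) = t * t powr (- m)"
    using t powr_add[of t 1 "- m"] by simp
  have c1: "m * Kummer_Phi \<nu> m t =
      \<nu> * Kummer_Phi (\<nu> + 1) (m + 1) t + (m - \<nu>) * Kummer_Phi \<nu> (m + 1) t"
    by (rule Kummer_Phi_contiguous_1[OF n(1)])
  have c2: "(1 - m) * (Kummer_Phi (\<nu> - m + 1) (1 - m) t - Kummer_Phi (\<nu> - m) (1 - m) t) =
      t * Kummer_Phi (\<nu> - m + 1) (2 - m) t"
    using Kummer_Phi_contiguous_2[OF n(3), of "\<nu> - m" t] nz by (simp add: field_simps)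
  show ?thesis
    unfolding Kummer_Psi_nonint_def e G1 G2 r1 p using c1 c2 r2 by algebra
qed

text \<open>The mirror image of \<open>Kummer_Psi_nonint_up\<close> under the reflection, so no
  further series computation is involved.\<close>

lemma Kummer_Psi_nonint_down:
  assumes m: "m \<notin> \<int>" and t: "t \<noteq> 0"
  shows "t * Kummer_Psi_nonint \<nu> m t =
    Kummer_Psi_nonint (\<nu> - 1) (m - 1) t - (\<nu> - m + 1) * Kummer_Psi_nonint \<nu> (m - 1) t"
proof -
  have 2: "2 - m \<notin> \<int>" using m by (simp add: Ints_diff_left_iff)
  have p: "t * t powr (1 - m) = t powr (2 - m)"
    using powr_add[of t 1 "1 - m"] t by simp
  have a: "Kummer_Psi_nonint (\<nu> - 1) (m - 1) t = t powr (2 - m) * Kummer_Psi_nonint (\<nu> - m + 1) (2 - m + 1) t"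
    using Kummer_Psi_nonint_reflect[OF t, of "\<nu> - 1" "m - 1"] by (simp add: algebra_simps)
  have b: "Kummer_Psi_nonint \<nu> (m - 1) t = t powr (2 - m) * Kummer_Psi_nonint (\<nu> - m + 1 + 1) (2 - m + 1) t"
    using Kummer_Psi_nonint_reflect[OF t, of \<nu> "m - 1"] by (simp add: algebra_simps)
  show ?thesis
    unfolding a b Kummer_Psi_nonint_reflect[OF t, of \<nu> m] Kummer_Psi_nonint_up[OF 2 t, of "\<nu> - m + 1"]
      p[symmetric] by (simp only: right_diff_distrib mult_ac)
qed

text \<open>Eliminates the functions with parameter \<open>m - 1\<close> from two up relations and
  one down relation. At fixed \<open>m\<close> it lowers \<open>\<nu>\<close>, which carries both
  growth bounds and moments from large \<open>Re \<nu>\<close> to all \<open>\<nu>\<close>.\<close>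

lemma Kummer_Psi_nonint_lower:
  assumes m: "m \<notin> \<int>" and t: "t \<noteq> 0"
  shows "Kummer_Psi_nonint (\<nu> - 1) m t =
    (t + 2 * \<nu> - m) * Kummer_Psi_nonint \<nu> m t - \<nu> * (\<nu> - m + 1) * Kummer_Psi_nonint (\<nu> + 1) m t"
proof -
  have 1: "m - 1 \<notin> \<int>" using m Ints_add[of "m - 1" 1] by auto
  show ?thesis
    using Kummer_Psi_nonint_up[OF 1 t, of \<nu>] Kummer_Psi_nonint_up[OF 1 t, of "\<nu> - 1"]
      Kummer_Psi_nonint_down[OF m t, of \<nu>] by simp algebra
qed

text \<open>\<open>Kummer_Phi_lower_derivative\<close> absorbs the derivative of
  \<open>t powr (1 - m)\<close>, so the result is again a member of the family. That power is also
  why \<open>t\<close> must avoid the cut.\<close>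

lemma Kummer_Psi_nonint_has_derivative:
  assumes m: "m \<notin> \<int>" and t: "t \<notin> \<real>\<^sub>\<le>\<^sub>0"
  shows "(Kummer_Psi_nonint \<nu> m has_field_derivative - \<nu> * Kummer_Psi_nonint (\<nu> + 1) (m + 1) t) (at t)"
proof -
  have t0: "t \<noteq> 0" using t by auto
  have n: "m \<notin> \<int>\<^sub>\<le>\<^sub>0" "- m \<notin> \<int>\<^sub>\<le>\<^sub>0" "1 - m \<notin> \<int>\<^sub>\<le>\<^sub>0" "m - 1 \<notin> \<int>\<^sub>\<le>\<^sub>0" "2 - m \<notin> \<int>\<^sub>\<le>\<^sub>0"
    using m by (auto intro!: notin_Ints_imp_notin_nonpos_Ints simp: Ints_diff_left_iff minus_in_Ints_iff
        dest: Ints_add[of "m - 1" 1])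
  have nz: "m \<noteq> 0" "1 - m \<noteq> 0" using n by auto
  have e: "1 - (m + 1) = - m" "m + 1 - 1 = m" "2 - (m + 1) = 1 - m"
    "\<nu> + 1 + 1 - (m + 1) = \<nu> - m + 1" "\<nu> + 1 - m = \<nu> - m + 1"
    by simp_all
  have G1: "Gamma (1 - m) = - m * Gamma (- m)"
    using Gamma_plus1[OF n(2)] by simp
  have G2: "Gamma m = (m - 1) * Gamma (m - 1)"
    using Gamma_plus1[OF n(4)] by simp
  have r2: "rGamma \<nu> = \<nu> * rGamma (\<nu> + 1)"
    by (rule rGamma_eq_mult_rGamma_plus1)
  have p: "t powr (1 - m) = t * t powr (- m)"
    using t0 powr_add[of t 1 "- m"] by simp
  have e3: "1 - m + 1 = 2 - m" "1 - m + 2 = 2 - m + 1" by simp_all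
  have low: "(1 - m) * Kummer_Phi (\<nu> - m + 1) (2 - m) t
      + t * ((\<nu> - m + 1) / (2 - m) * Kummer_Phi (\<nu> - m + 1 + 1) (2 - m + 1) t) =
      (1 - m) * Kummer_Phi (\<nu> - m + 1) (1 - m) t"
    using Kummer_Phi_lower_derivative[OF n(3), of "\<nu> - m + 1" t] unfolding e3 .
  have D: "((\<lambda>t. Gamma (1 - m) * rGamma (\<nu> - m + 1) * Kummer_Phi \<nu> m t
      + Gamma (m - 1) * rGamma \<nu> * t powr (1 - m) * Kummer_Phi (\<nu> - m + 1) (2 - m) t) has_field_derivative
      Gamma (1 - m) * rGamma (\<nu> - m + 1) * (\<nu> / m * Kummer_Phi (\<nu> + 1) (m + 1) t)
      + Gamma (m - 1) * rGamma \<nu> * (t powr (1 - m) * ((\<nu> - m + 1) / (2 - m) * Kummer_Phi (\<nu> - m + 1 + 1) (2 - m + 1) t)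
         + (1 - m) * t powr (- m) * Kummer_Phi (\<nu> - m + 1) (2 - m) t)) (at t)"
    by (rule derivative_eq_intros Kummer_Phi_has_derivative[OF n(1)] Kummer_Phi_has_derivative[OF n(5)]
         has_field_derivative_powr[OF t] refl)+ (simp add: algebra_simps)
  define X where "X = (\<nu> - m + 1) / (2 - m) * Kummer_Phi (\<nu> - m + 1 + 1) (2 - m + 1) t"
  define W where "W = \<nu> / m * Kummer_Phi (\<nu> + 1) (m + 1) t"
  have W: "m * W = \<nu> * Kummer_Phi (\<nu> + 1) (m + 1) t" using nz by (simp add: W_def)
  have "Gamma (1 - m) * rGamma (\<nu> - m + 1) * W
      + Gamma (m - 1) * rGamma \<nu> * (t powr (1 - m) * X + (1 - m) * t powr (- m) * Kummer_Phi (\<nu> - m + 1) (2 - m) t)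
      = - \<nu> * Kummer_Psi_nonint (\<nu> + 1) (m + 1) t"
    unfolding Kummer_Psi_nonint_def e G1 G2 r2 p using low[folded X_def] W by algebra
  then show ?thesis
    using D unfolding Kummer_Psi_nonint_def[abs_def] e X_def W_def by simp
qed

text \<open>Differentiation under the integral sign from a local majorant of \<open>g\<close> alone:
  Cauchy's inequality bounds the derivative in the parameter, hence the difference quotients, and
  dominated convergence applies.\<close>

lemma holomorphic_parametric_integral:
  fixes g :: "complex \<Rightarrow> real \<Rightarrow> complex"
  assumes "open A" and X: "X \<in> sets borel"
    and hol: "\<And>x. x \<in> X \<Longrightarrow> (\<lambda>z. g z x) holomorphic_on A"
    and meas: "\<And>z. z \<in> A \<Longrightarrow> set_borel_measurable borel X (g z)"
    and dom: "\<And>z. z \<in> A \<Longrightarrow> \<exists>r>0. \<exists>h. set_integrable lborel X h \<and>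
               (\<forall>w\<in>cball z r. w \<in> A \<and> (\<forall>x\<in>X. norm (g w x) \<le> h x))"
    and z: "z \<in> A"
  shows "((\<lambda>z. LINT x:X|lborel. g z x) has_field_derivative
           (LINT x:X|lborel. deriv (\<lambda>z. g z x) z)) (at z)"
proof -
  obtain r h where r: "r > 0" and h: "set_integrable lborel X h"
    and A: "\<And>w. w \<in> cball z r \<Longrightarrow> w \<in> A" and le: "\<And>w x. w \<in> cball z r \<Longrightarrow> x \<in> X \<Longrightarrow> norm (g w x) \<le> h x"
    using dom[OF z] by metis
  have int: "set_integrable lborel X (g w)" if "w \<in> cball z r" for w
  proof (rule set_integrable_bound[OF h])
    show "set_borel_measurable lborel X (g w)"
      using meas[OF A[OF that]] by (simp add: set_borel_measurable_def)
    show "AE x in lborel. x \<in> X \<longrightarrow> norm (g w x) \<le> norm (h x)"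
      using le[OF that] by (auto intro!: AE_I2 order_trans[OF _ abs_ge_self])
  qed
  \<comment> \<open>Discs of radius \<open>r / 2\<close> around points of the half-size ball stay
    inside \<open>cball z r\<close>, where \<open>h\<close> is a majorant; this gives the factor
    \<open>2 / r\<close>.\<close>
  have deriv_le: "norm (deriv (\<lambda>z. g z x) w) \<le> 2 / r * h x" if "x \<in> X" "w \<in> cball z (r / 2)" for x w
  proof -
    have sub: "cball w (r / 2) \<subseteq> cball z r"
    proof
      fix u assume "u \<in> cball w (r / 2)"
      then show "u \<in> cball z r" using that(2) dist_triangle[of z u w] by auto
    qed
    have subA: "cball w (r / 2) \<subseteq> A" using sub A by blast
    have "norm ((deriv ^^ 1) (\<lambda>z. g z x) w) \<le> fact 1 * h x / (r / 2) ^ 1"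
    proof (rule Cauchy_inequality)
      show "(\<lambda>z. g z x) holomorphic_on ball w (r / 2)"
        using holomorphic_on_subset[OF hol[OF that(1)]] subA ball_subset_cball by blast
      show "continuous_on (cball w (r / 2)) (\<lambda>z. g z x)"
        using continuous_on_subset[OF holomorphic_on_imp_continuous_on[OF hol[OF that(1)]]] subA by blast
      show "norm (g u x) \<le> h x" if "norm (w - u) = r / 2" for u
        using le sub that \<open>x \<in> X\<close> by (auto simp: dist_norm subset_iff)
    qed (use r in auto)
    then show ?thesis by (simp add: field_simps)
  qed
  have quot_le: "norm ((g (z + k) x - g z x) / k) \<le> 2 / r * h x" if "x \<in> X" "k \<noteq> 0" "norm k \<le> r / 2" for x k
  proof -
    have "norm (g (z + k) x - g z x) \<le> 2 / r * h x * norm (z + k - z)"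
    proof (rule field_differentiable_bound[OF convex_cball])
      fix w assume w: "w \<in> cball z (r / 2)"
      then have "w \<in> A" using A r by auto
      then have "((\<lambda>z. g z x) has_field_derivative deriv (\<lambda>z. g z x) w) (at w)"
        using hol[OF that(1)] \<open>open A\<close> holomorphic_derivI by blast
      then show "((\<lambda>z. g z x) has_field_derivative deriv (\<lambda>z. g z x) w) (at w within cball z (r / 2))"
        by (rule has_field_derivative_at_within)
      show "norm (deriv (\<lambda>z. g z x) w) \<le> 2 / r * h x" by (rule deriv_le[OF that(1) w])
    qed (use that r in \<open>auto simp: dist_norm\<close>)
    then show ?thesis using that r by (simp add: norm_divide divide_simps)
  qed
  show "((\<lambda>z. LINT x:X|lborel. g z x) has_field_derivative
           (LINT x:X|lborel. deriv (\<lambda>z. g z x) z)) (at z)"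
    unfolding DERIV_def tendsto_at_iff_sequentially
  proof (intro allI impI)
    fix k :: "nat \<Rightarrow> complex" assume k: "\<forall>i. k i \<in> UNIV - {0}" "k \<longlonglongrightarrow> 0"
    have "\<forall>\<^sub>F n in sequentially. norm (k n) < r / 2"
      using k(2) r by (metis half_gt_zero norm_zero order_tendstoD(2) tendsto_norm)
    then obtain N where N: "\<And>n. n \<ge> N \<Longrightarrow> norm (k n) \<le> r / 2"
      unfolding eventually_sequentially by (meson less_imp_le)
    \<comment> \<open>The index is shifted by \<open>N\<close> so that every difference quotient
      already lies within the range of the majorant.\<close>
    define s where "s n x = indicator X x *\<^sub>R ((g (z + k (n + N)) x - g z x) / k (n + N))" for n x
    have sA: "z + k (n + N) \<in> cball z r" for n using N[of "n + N"] r by (auto simp: dist_norm)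
    have smeas: "s n \<in> borel_measurable lborel" for n
    proof -
      have "s n = (\<lambda>x. (indicator X x *\<^sub>R g (z + k (n + N)) x - indicator X x *\<^sub>R g z x) / k (n + N))"
        by (auto simp: s_def indicator_def fun_eq_iff)
      then show ?thesis
        using meas[OF A[OF sA[of n]]] meas[OF z] by (simp add: set_borel_measurable_def)
    qed
    have slim: "(\<lambda>n. s n x) \<longlonglongrightarrow> indicator X x *\<^sub>R deriv (\<lambda>z. g z x) z" for x
    proof (cases "x \<in> X")
      case True
      have "((\<lambda>z. g z x) has_field_derivative deriv (\<lambda>z. g z x) z) (at z)"
        using hol[OF True] \<open>open A\<close> z holomorphic_derivI by blast
      then have "(\<lambda>n. (g (z + k n) x - g z x) / k n) \<longlonglongrightarrow> deriv (\<lambda>z. g z x) z"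
        using k unfolding DERIV_def tendsto_at_iff_sequentially by (auto simp: o_def)
      from LIMSEQ_ignore_initial_segment[OF this, of N] show ?thesis
        using True by (simp add: s_def)
    qed (simp add: s_def)
    \<comment> \<open>Measurability of the derivative is inherited from the difference quotients as
      their pointwise limit.\<close>
    have dmeas: "(\<lambda>x. indicator X x *\<^sub>R deriv (\<lambda>z. g z x) z) \<in> borel_measurable lborel"
      by (rule borel_measurable_LIMSEQ_metric[OF smeas slim])
    have hint: "integrable lborel (\<lambda>x. 2 / r * (indicator X x *\<^sub>R h x))"
      using h unfolding set_integrable_def by (rule integrable_mult_right)
    have "(\<lambda>n. integral\<^sup>L lborel (s n)) \<longlonglongrightarrow> integral\<^sup>L lborel (\<lambda>x. indicator X x *\<^sub>R deriv (\<lambda>z. g z x) z)"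
    proof (rule integral_dominated_convergence[OF dmeas smeas hint])
      show "AE x in lborel. (\<lambda>n. s n x) \<longlonglongrightarrow> indicator X x *\<^sub>R deriv (\<lambda>z. g z x) z"
        using slim by simp
      show "AE x in lborel. norm (s n x) \<le> 2 / r * (indicator X x *\<^sub>R h x)" for n
        using quot_le[of _ "k (n + N)"] k(1) N[of "n + N"] by (auto simp: s_def indicator_def intro!: AE_I2)
    qed
    moreover have "integral\<^sup>L lborel (s n) =
       ((LINT x:X|lborel. g (z + k (n + N)) x) - (LINT x:X|lborel. g z x)) / k (n + N)" for n
    proof -
      have "integral\<^sup>L lborel (s n) = (LINT x:X|lborel. (g (z + k (n + N)) x - g z x) / k (n + N))"
        unfolding s_def set_lebesgue_integral_def ..
      also have "\<dots> = (LINT x:X|lborel. g (z + k (n + N)) x - g z x) / k (n + N)"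
        by (rule set_integral_divide_zero)
      finally show ?thesis using int[OF sA[of n]] int[of z] r by simp
    qed
    ultimately have "(\<lambda>n. ((LINT x:X|lborel. g (z + k (n + N)) x) - (LINT x:X|lborel. g z x)) / k (n + N))
        \<longlonglongrightarrow> (LINT x:X|lborel. deriv (\<lambda>z. g z x) z)"
      by (simp add: set_lebesgue_integral_def)
    then show "((\<lambda>h. ((LINT x:X|lborel. g (z + h) x) - (LINT x:X|lborel. g z x)) / h) \<circ> k)
        \<longlonglongrightarrow> (LINT x:X|lborel. deriv (\<lambda>z. g z x) z)"
      unfolding o_def by (rule LIMSEQ_offset)
  qed
qed

lemma holomorphic_on_parametric_integral:
  fixes g :: "complex \<Rightarrow> real \<Rightarrow> complex"
  assumes "open A" and "X \<in> sets borel"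
    and "\<And>x. x \<in> X \<Longrightarrow> (\<lambda>z. g z x) holomorphic_on A"
    and "\<And>z. z \<in> A \<Longrightarrow> set_borel_measurable borel X (g z)"
    and "\<And>z. z \<in> A \<Longrightarrow> \<exists>r>0. \<exists>h. set_integrable lborel X h \<and>
               (\<forall>w\<in>cball z r. w \<in> A \<and> (\<forall>x\<in>X. norm (g w x) \<le> h x))"
  shows "(\<lambda>z. LINT x:X|lborel. g z x) holomorphic_on A"
  unfolding holomorphic_on_open[OF \<open>open A\<close>]
  using holomorphic_parametric_integral[OF assms] by blast

section \<open>Integrals over the half-line\<close>

lemma set_borel_measurable_Ioi:
  fixes f :: "real \<Rightarrow> 'a::{real_normed_vector, second_countable_topology}"
  assumes "continuous_on {0<..} f"
  shows "set_borel_measurable borel {0<..} f"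
  unfolding set_borel_measurable_def
  by (rule borel_measurable_continuous_on_indicator) (use assms in auto)

lemma set_integrable_Ioi_bound:
  fixes f :: "real \<Rightarrow> 'a::{banach, second_countable_topology}" and h :: "real \<Rightarrow> real"
  assumes "set_integrable lborel {0<..} h" and "set_borel_measurable borel {0<..} f"
    and "\<And>x. x > 0 \<Longrightarrow> norm (f x) \<le> h x"
  shows "set_integrable lborel {0<..} f"
  by (rule set_integrable_bound[OF assms(1)])
     (use assms(2,3) in \<open>auto simp: set_borel_measurable_def intro!: AE_I2 order_trans[OF _ abs_ge_self]\<close>)

lemma LINT_Ioi_FTC:
  fixes f :: "real \<Rightarrow> 'a::euclidean_space"
  assumes "\<And>x. x > 0 \<Longrightarrow> (F has_vector_derivative f x) (at x)"
    and "continuous_on {0<..} f" and "set_integrable lborel {0<..} f"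
    and "(F \<longlongrightarrow> A) (at_right 0)" and "(F \<longlongrightarrow> B) at_top"
  shows "(LINT x:{0<..}|lborel. f x) = B - A"
proof -
  have "(LBINT x=0..\<infinity>. f x) = B - A"
  proof (rule interval_integral_FTC_integrable)
    show "isCont f x" if "0 < ereal x" for x
      using that assms(2) by (auto simp: continuous_on_eq_continuous_at)
    show "set_integrable lborel (einterval 0 \<infinity>) f"
      using assms(3) by (simp add: zero_ereal_def)
    show "((F \<circ> real_of_ereal) \<longlongrightarrow> A) (at_right 0)"
      unfolding zero_ereal_def ereal_tendsto_simps by (rule assms(4))
    show "((F \<circ> real_of_ereal) \<longlongrightarrow> B) (at_left \<infinity>)"
      unfolding ereal_tendsto_simps by (rule assms(5))
  qed (use assms(1) in auto)
  then show ?thesis by (simp add: interval_lebesgue_integral_0_infty)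
qed

lemma LINT_Ioi_scale:
  fixes f :: "real \<Rightarrow> 'a::{banach, second_countable_topology}"
  assumes "c > 0"
  shows "set_integrable lborel {0<..} (\<lambda>x. f (c * x)) \<longleftrightarrow> set_integrable lborel {0<..} f"
    and "(LINT x:{0<..}|lborel. f x) = c *\<^sub>R (LINT x:{0<..}|lborel. f (c * x))"
proof -
  have i: "indicator {0<..} (c * x) = (indicator {0<..} x :: real)" for x
    using assms by (simp add: indicator_def zero_less_mult_iff)
  show "set_integrable lborel {0<..} (\<lambda>x. f (c * x)) \<longleftrightarrow> set_integrable lborel {0<..} f"
    using lborel_integrable_real_affine_iff[of c "\<lambda>x. indicator {0<..} x *\<^sub>R f x" 0] assms
    by (simp add: set_integrable_def i)
  show "(LINT x:{0<..}|lborel. f x) = c *\<^sub>R (LINT x:{0<..}|lborel. f (c * x))"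
    using lborel_integral_real_affine[of c "\<lambda>x. indicator {0<..} x *\<^sub>R f x" 0] assms
    by (simp add: set_lebesgue_integral_def i)
qed

lemma LINT_Ioi_dominated_convergence:
  fixes f :: "nat \<Rightarrow> real \<Rightarrow> 'a::{banach, second_countable_topology}" and h :: "real \<Rightarrow> real"
  assumes h: "set_integrable lborel {0<..} h"
    and meas: "\<And>n. set_borel_measurable borel {0<..} (f n)"
    and le: "\<And>n x. x > 0 \<Longrightarrow> norm (f n x) \<le> h x"
    and lim: "\<And>x. x > 0 \<Longrightarrow> (\<lambda>n. f n x) \<longlonglongrightarrow> g x"
  shows "set_integrable lborel {0<..} g"
    and "(\<lambda>n. LINT x:{0<..}|lborel. f n x) \<longlonglongrightarrow> (LINT x:{0<..}|lborel. g x)"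
proof -
  have m: "(\<lambda>x. indicator {0<..} x *\<^sub>R f n x) \<in> borel_measurable lborel" for n
    using meas[of n] by (simp add: set_borel_measurable_def)
  have l: "(\<lambda>n. indicator {0<..} x *\<^sub>R f n x) \<longlonglongrightarrow> indicator {0<..} x *\<^sub>R g x" for x :: real
    using lim[of x] by (cases "x > 0") (auto simp: indicator_def)
  have mg: "(\<lambda>x. indicator {0<..} x *\<^sub>R g x) \<in> borel_measurable lborel"
    by (rule borel_measurable_LIMSEQ_metric[OF m l])
  have "AE x in lborel. (\<lambda>n. indicator {0<..} x *\<^sub>R f n x) \<longlonglongrightarrow> indicator {0<..} x *\<^sub>R g x"
    using l by simp
  moreover have "AE x in lborel. norm (indicator {0<..} x *\<^sub>R f n x) \<le> indicator {0<..} x *\<^sub>R h x" for n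
    using le by (auto simp: indicator_def intro!: AE_I2)
  ultimately show "set_integrable lborel {0<..} g"
      and "(\<lambda>n. LINT x:{0<..}|lborel. f n x) \<longlonglongrightarrow> (LINT x:{0<..}|lborel. g x)"
    unfolding set_integrable_def set_lebesgue_integral_def
    by (rule integrable_dominated_convergence[OF mg m h[unfolded set_integrable_def]],
        rule integral_dominated_convergence[OF mg m h[unfolded set_integrable_def]])
qed

text \<open>Continuity on the open quadrant provides joint measurability. Absolute convergence has
  to be checked only with \<open>x\<close> as the inner variable.\<close>

lemma LINT_Ioi_Fubini:
  fixes f :: "real \<Rightarrow> real \<Rightarrow> complex"
  assumes cont: "continuous_on ({0<..} \<times> {0<..}) (\<lambda>(x, y). f x y)"
    and 1: "\<And>y. y > 0 \<Longrightarrow> set_integrable lborel {0<..} (\<lambda>x. f x y)"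
    and 2: "set_integrable lborel {0<..} (\<lambda>y. LINT x:{0<..}|lborel. norm (f x y))"
  shows "set_integrable lborel {0<..} (\<lambda>x. LINT y:{0<..}|lborel. f x y)"
    and "(LINT x:{0<..}|lborel. LINT y:{0<..}|lborel. f x y) = (LINT y:{0<..}|lborel. LINT x:{0<..}|lborel. f x y)"
proof -
  \<comment> \<open>The outer variable \<open>y\<close> comes first, to fit the order in which
    Fubini's criterion tests integrability.\<close>
  define F where "F y x = indicator {0<..} y *\<^sub>R (indicator {0<..} x *\<^sub>R f x y)" for x y :: real
  have "(\<lambda>z. indicator ({0<..} \<times> {0<..}) z *\<^sub>R (\<lambda>(x, y). f x y) z) \<in> borel_measurable borel"
    by (rule borel_measurable_continuous_on_indicator[OF _ cont])
       (simp add: borel_open open_Times)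
  moreover have "(\<lambda>z. indicator ({0<..} \<times> {0<..}) z *\<^sub>R (\<lambda>(x, y). f x y) z) = (\<lambda>(x, y). F y x)"
    by (auto simp: F_def fun_eq_iff indicator_def)
  ultimately have "(\<lambda>(x, y). F y x) \<in> borel_measurable (lborel \<Otimes>\<^sub>M lborel)"
    unfolding lborel_prod by simp
  from measurable_pair_swap[OF this]
  have meas: "(\<lambda>(y, x). F y x) \<in> borel_measurable (lborel \<Otimes>\<^sub>M lborel)"
    by (simp only: prod.case)
  have "integrable (lborel \<Otimes>\<^sub>M lborel) (\<lambda>(y, x). F y x)"
  proof (rule lborel_pair.Fubini_integrable[OF meas])
    show "AE y in lborel. integrable lborel (\<lambda>x. case (y, x) of (y, x) \<Rightarrow> F y x)"
      using 1 by (auto simp: F_def set_integrable_def indicator_def intro!: AE_I2)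
    have "(LINT x|lborel. norm (case (y, x) of (y, x) \<Rightarrow> F y x)) =
       indicator {0<..} y *\<^sub>R (LINT x:{0<..}|lborel. norm (f x y))" for y
      by (auto simp: F_def set_lebesgue_integral_def indicator_def intro!: Bochner_Integration.integral_cong)
    then show "integrable lborel (\<lambda>y. LINT x|lborel. norm (case (y, x) of (y, x) \<Rightarrow> F y x))"
      using 2 by (simp add: set_integrable_def)
  qed
  then have int: "integrable (lborel \<Otimes>\<^sub>M lborel) (case_prod F)" by simp
  have i1: "(LINT y|lborel. F y x) = indicator {0<..} x *\<^sub>R (LINT y:{0<..}|lborel. f x y)" for x
    unfolding set_lebesgue_integral_def integral_scaleR_right[symmetric]
    by (intro Bochner_Integration.integral_cong) (auto simp: F_def)
  have i2: "(LINT x|lborel. F y x) = indicator {0<..} y *\<^sub>R (LINT x:{0<..}|lborel. f x y)" for y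
    unfolding set_lebesgue_integral_def integral_scaleR_right[symmetric]
    by (intro Bochner_Integration.integral_cong) (auto simp: F_def)
  show "set_integrable lborel {0<..} (\<lambda>x. LINT y:{0<..}|lborel. f x y)"
    using lborel_pair.integrable_snd[OF int] unfolding i1 set_integrable_def .
  show "(LINT x:{0<..}|lborel. LINT y:{0<..}|lborel. f x y) = (LINT y:{0<..}|lborel. LINT x:{0<..}|lborel. f x y)"
    using lborel_pair.Fubini_integral[OF int]
    unfolding i1 i2 set_lebesgue_integral_def[where f="\<lambda>x. set_lebesgue_integral _ _ (_ x)"] .
qed

lemma has_vector_derivative_of_real_powr:
  assumes "s > 0"
  shows "((\<lambda>s. complex_of_real s powr z) has_vector_derivative z * of_real s powr (z - 1)) (at s within A)"
  by (rule has_vector_derivative_real_field[where f="\<lambda>s::complex. s powr z"] has_field_derivative_powr)+ (use assms in auto)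

lemma has_vector_derivative_one_plus_of_real_powr:
  assumes "s > 0"
  shows "((\<lambda>s. (1 + complex_of_real s) powr z) has_vector_derivative z * (1 + of_real s) powr (z - 1)) (at s within A)"
proof (rule has_vector_derivative_real_field[where f="\<lambda>s::complex. (1 + s) powr z"])
  have "1 + complex_of_real s \<notin> \<real>\<^sub>\<le>\<^sub>0" using assms by (auto simp: complex_nonpos_Reals_iff)
  from DERIV_chain2[OF has_field_derivative_powr[OF this] DERIV_add[OF DERIV_const DERIV_ident]]
  show "((\<lambda>s. (1 + s) powr z) has_field_derivative z * (1 + of_real s) powr (z - 1)) (at (of_real s))"
    by simp
qed

lemma continuous_on_of_real_powr:
  "continuous_on {0<..} (\<lambda>s. complex_of_real s powr z)"
  by (rule continuous_on_vector_derivative) (use has_vector_derivative_of_real_powr in auto)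

lemma continuous_on_one_plus_of_real_powr:
  "continuous_on {0<..} (\<lambda>s. (1 + complex_of_real s) powr z)"
  by (rule continuous_on_vector_derivative) (use has_vector_derivative_one_plus_of_real_powr in auto)

lemma norm_of_real_powr: "s > 0 \<Longrightarrow> norm (complex_of_real s powr z) = s powr Re z"
  by (simp add: norm_powr_real_powr)

lemma norm_one_plus_of_real_powr: "s > 0 \<Longrightarrow> norm ((1 + complex_of_real s) powr z) = (1 + s) powr Re z"
  using norm_of_real_powr[of "1 + s" z] by simp

lemma LINT_Gamma:
  assumes z: "Re z > 0" and b: "b > 0"
  shows "set_integrable lborel {0<..} (\<lambda>y. of_real y powr (z - 1) * of_real (exp (- (b * y))))"
    and "(LINT y:{0<..}|lborel. of_real y powr (z - 1) * of_real (exp (- (b * y)))) = Gamma z * of_real b powr (- z)"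
proof -
  have int: "set_integrable lborel {0<..} (\<lambda>y. of_real y powr (z - 1) * of_real (exp (- (b * y))))" if "b > 0" for b
  proof -
    have "continuous_on {0<..} (\<lambda>y. complex_of_real y powr (z - 1) * of_real (exp (- (b * y))))"
      by (intro continuous_intros continuous_on_of_real_powr)
    then have m: "(\<lambda>y. indicator {0<..} y *\<^sub>R (complex_of_real y powr (z - 1) * of_real (exp (- (b * y))))) \<in> borel_measurable lborel"
      using set_borel_measurable_Ioi by (simp add: set_borel_measurable_def)
    \<comment> \<open>The known Gamma integral lives on the completed measure; the Borel
      measurability \<open>m\<close> brings it back to \<open>lborel\<close>.\<close>
    have "set_integrable lebesgue {0<..} (\<lambda>y. of_real y powr (z - 1) * of_real (exp (- (b * y))))"
      using absolutely_integrable_Gamma_integral[OF z that]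
      by (simp add: exp_minus divide_inverse)
    then show ?thesis
      unfolding set_integrable_def using integrable_completion[OF m] by simp
  qed
  show "set_integrable lborel {0<..} (\<lambda>y. of_real y powr (z - 1) * of_real (exp (- (b * y))))"
    by (rule int[OF b])
  have "(LINT y:{0<..}|lborel. of_real y powr (z - 1) * of_real (exp (- (1 * y)))) = Gamma z"
  proof -
    have "((\<lambda>t. of_real t powr (z - 1) / of_real (exp t)) has_integral Gamma z) {0<..}"
      using Gamma_integral_complex[OF z]
      by (subst has_integral_spike_set_eq[of _ "{0..}"]) (auto intro: negligible_subset[OF negligible_sing[of 0]])
    then have "integral {0<..} (\<lambda>y. of_real y powr (z - 1) * of_real (exp (- (1 * y)))) = Gamma z"
      by (simp add: exp_minus divide_inverse integral_unique)
    then show ?thesis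
      using set_borel_integral_eq_integral(2)[OF int[of 1]] by simp
  qed
  moreover have "(LINT y:{0<..}|lborel. of_real y powr (z - 1) * of_real (exp (- (1 * y)))) =
      b *\<^sub>R (LINT y:{0<..}|lborel. of_real (b * y) powr (z - 1) * of_real (exp (- (1 * (b * y)))))"
    by (rule LINT_Ioi_scale(2)[OF b])
  moreover have "(LINT y:{0<..}|lborel. of_real (b * y) powr (z - 1) * of_real (exp (- (1 * (b * y))))) =
      of_real b powr (z - 1) * (LINT y:{0<..}|lborel. of_real y powr (z - 1) * of_real (exp (- (b * y))))"
    unfolding set_integral_mult_right[symmetric]
    using b by (intro set_lebesgue_integral_cong) (auto simp: powr_times_real)
  moreover have "of_real b * of_real b powr (z - 1) = of_real b powr z"
    using powr_add[of "of_real b" 1 "z - 1"] b by simp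
  ultimately have "of_real b powr z * (LINT y:{0<..}|lborel. of_real y powr (z - 1) * of_real (exp (- (b * y)))) = Gamma z"
    by (simp only: scaleR_conv_of_real mult.assoc[symmetric])
  then show "(LINT y:{0<..}|lborel. of_real y powr (z - 1) * of_real (exp (- (b * y)))) = Gamma z * of_real b powr (- z)"
    using b by (simp add: powr_minus field_simps)
qed

lemma LINT_Gamma_real:
  fixes \<alpha> b :: real
  assumes "\<alpha> > 0" and "b > 0"
  shows "set_integrable lborel {0<..} (\<lambda>y. y powr (\<alpha> - 1) * exp (- (b * y)))"
    and "(LINT y:{0<..}|lborel. y powr (\<alpha> - 1) * exp (- (b * y))) = Gamma \<alpha> * b powr (- \<alpha>)"
proof -
  have r: "\<And>y. y > 0 \<Longrightarrow> complex_of_real (y powr (\<alpha> - 1) * exp (- (b * y))) =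
      of_real y powr (of_real \<alpha> - 1) * of_real (exp (- (b * y)))"
    using powr_of_real[of _ "\<alpha> - 1"] by simp
  have r': "Gamma (complex_of_real \<alpha>) * of_real b powr (- of_real \<alpha>) = of_real (Gamma \<alpha> * b powr (- \<alpha>))"
    using assms powr_of_real[of b "- \<alpha>"] by (simp add: Gamma_complex_of_real)
  note G = LINT_Gamma[of "of_real \<alpha>" b]
  have "set_integrable lborel {0<..} (\<lambda>y. complex_of_real (y powr (\<alpha> - 1) * exp (- (b * y))))"
    using G(1) assms by (subst set_integrable_cong[OF refl refl r]) auto
  then show "set_integrable lborel {0<..} (\<lambda>y. y powr (\<alpha> - 1) * exp (- (b * y)))"
    by (simp add: set_integrable_def scaleR_conv_of_real complex_of_real_integrable_eq flip: of_real_mult)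
  have "(LINT y:{0<..}|lborel. complex_of_real (y powr (\<alpha> - 1) * exp (- (b * y)))) = of_real (Gamma \<alpha> * b powr (- \<alpha>))"
    using G(2) assms r' by (subst set_lebesgue_integral_cong[where g="\<lambda>y. of_real y powr (of_real \<alpha> - 1) * of_real (exp (- (b * y)))"]) (auto simp: r[simplified])
  then show "(LINT y:{0<..}|lborel. y powr (\<alpha> - 1) * exp (- (b * y))) = Gamma \<alpha> * b powr (- \<alpha>)"
    unfolding set_integral_complex_of_real of_real_eq_iff .
qed

section \<open>The integral representation of Tricomi's function\<close>

lemma Re_pos_imp_notin_nonpos_Ints: "Re z > 0 \<Longrightarrow> z \<notin> \<int>\<^sub>\<le>\<^sub>0"
  by (auto elim!: nonpos_Ints_cases)

text \<open>Write \<open>Gamma (p + q) * (1 + s) powr (- p - q)\<close> as a Gamma integral in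
  \<open>y\<close> with rate \<open>1 + s\<close> and exchange the integrals: the
  \<open>s\<close>-integral becomes \<open>Gamma p * y powr (- p)\<close> and the rest is
  \<open>Gamma q\<close>.\<close>

lemma LINT_Beta:
  assumes p: "Re p > 0" and q: "Re q > 0"
  shows "set_integrable lborel {0<..} (\<lambda>s. of_real s powr (p - 1) * (1 + of_real s) powr (- p - q))"
    and "(LINT s:{0<..}|lborel. of_real s powr (p - 1) * (1 + of_real s) powr (- p - q)) =
           Gamma p * Gamma q * rGamma (p + q)"
proof -
  define f where "f s y = complex_of_real s powr (p - 1) * (of_real y powr (p + q - 1) * of_real (exp (- (y * (1 + s)))))"
    for s y :: real
  have pq: "Re (p + q) > 0" using p q by simp
  have fs: "f s y = of_real y powr (p + q - 1) * of_real (exp (- y)) * (of_real s powr (p - 1) * of_real (exp (- (y * s))))" for s y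
  proof -
    have "exp (- (y * (1 + s))) = exp (- y) * exp (- (y * s))"
      by (simp add: distrib_left flip: exp_add)
    then show ?thesis by (simp add: f_def)
  qed
  have fy: "f s y = of_real s powr (p - 1) * (of_real y powr (p + q - 1) * of_real (exp (- ((1 + s) * y))))" for s y
    by (simp add: f_def mult.commute)
  have cont: "continuous_on ({0<..} \<times> {0<..}) (\<lambda>(s, y). f s y)"
    unfolding f_def case_prod_beta
    by (intro continuous_intros continuous_on_compose2[OF continuous_on_of_real_powr continuous_on_fst]
        continuous_on_compose2[OF continuous_on_of_real_powr continuous_on_snd]) (auto intro!: continuous_intros)
  have i1: "set_integrable lborel {0<..} (\<lambda>s. f s y)" if "y > 0" for y
    unfolding fs using LINT_Gamma(1)[OF p that] by (intro set_integrable_mult_right)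
  have pw: "of_real y powr (p + q - 1) * of_real (exp (- y)) * of_real y powr (- p) = of_real y powr (q - 1) * of_real (exp (- (1 * y)))"
    if "y > 0" for y
    using that powr_add[of "complex_of_real y" "p + q - 1" "- p"] by (simp add: mult_ac)
  have i2: "(LINT s:{0<..}|lborel. f s y) = Gamma p * (of_real y powr (q - 1) * of_real (exp (- (1 * y))))" if "y > 0" for y
    unfolding fs set_integral_mult_right LINT_Gamma(2)[OF p that] pw[OF that, symmetric] by (simp only: mult_ac)
  have nf: "norm (f s y) = y powr (Re p + Re q - 1) * exp (- y) * (s powr (Re p - 1) * exp (- (y * s)))" if "y > 0" "s > 0" for s y
    unfolding fs norm_mult using that by (simp add: norm_of_real_powr)
  have i3: "(LINT s:{0<..}|lborel. norm (f s y)) = Gamma (Re p) * (y powr (Re q - 1) * exp (- (1 * y)))" if "y > 0" for y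
  proof -
    have "(LINT s:{0<..}|lborel. norm (f s y)) =
        (LINT s:{0<..}|lborel. y powr (Re p + Re q - 1) * exp (- y) * (s powr (Re p - 1) * exp (- (y * s))))"
      using nf[OF that] by (intro set_lebesgue_integral_cong) auto
    also have "\<dots> = y powr (Re p + Re q - 1) * exp (- y) * (Gamma (Re p) * y powr (- Re p))"
      unfolding set_integral_mult_right LINT_Gamma_real(2)[OF p that] ..
    also have "\<dots> = Gamma (Re p) * (y powr (Re q - 1) * exp (- (1 * y)))"
      using powr_add[of y "Re p + Re q - 1" "- Re p"] by (simp add: mult_ac)
    finally show ?thesis .
  qed
  have i4: "set_integrable lborel {0<..} (\<lambda>y. LINT s:{0<..}|lborel. norm (f s y))"
    using LINT_Gamma_real(1)[OF q zero_less_one]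
    by (subst set_integrable_cong[OF refl refl i3]) (auto intro!: set_integrable_mult_right)
  have j: "(LINT y:{0<..}|lborel. f s y) = of_real s powr (p - 1) * (1 + of_real s) powr (- p - q) * Gamma (p + q)" if "s > 0" for s
  proof -
    have "(LINT y:{0<..}|lborel. f s y) = of_real s powr (p - 1) * (Gamma (p + q) * of_real (1 + s) powr (- (p + q)))"
      unfolding fy set_integral_mult_right using LINT_Gamma(2)[OF pq, of "1 + s"] that by simp
    then show ?thesis by (simp add: mult_ac)
  qed
  have gnz: "Gamma (p + q) \<noteq> 0"
    using Re_pos_imp_notin_nonpos_Ints[OF pq] by (simp add: Gamma_eq_zero_iff)
  have "set_integrable lborel {0<..} (\<lambda>s. of_real s powr (p - 1) * (1 + of_real s) powr (- p - q) * Gamma (p + q))"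
    using LINT_Ioi_Fubini(1)[OF cont i1 i4] by (subst set_integrable_cong[OF refl refl j[symmetric]]) auto
  then show "set_integrable lborel {0<..} (\<lambda>s. of_real s powr (p - 1) * (1 + of_real s) powr (- p - q))"
    using gnz by simp
  have "(LINT s:{0<..}|lborel. of_real s powr (p - 1) * (1 + of_real s) powr (- p - q)) * Gamma (p + q) =
      (LINT s:{0<..}|lborel. LINT y:{0<..}|lborel. f s y)"
    unfolding set_integral_mult_left[symmetric] using j by (intro set_lebesgue_integral_cong) auto
  also have "\<dots> = (LINT y:{0<..}|lborel. LINT s:{0<..}|lborel. f s y)"
    by (rule LINT_Ioi_Fubini(2)[OF cont i1 i4])
  also have "\<dots> = (LINT y:{0<..}|lborel. Gamma p * (of_real y powr (q - 1) * of_real (exp (- (1 * y)))))"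
    using i2 by (intro set_lebesgue_integral_cong) auto
  also have "\<dots> = Gamma p * Gamma q"
    unfolding set_integral_mult_right LINT_Gamma(2)[OF q zero_less_one] by simp
  finally show "(LINT s:{0<..}|lborel. of_real s powr (p - 1) * (1 + of_real s) powr (- p - q)) =
           Gamma p * Gamma q * rGamma (p + q)"
    using gnz by (simp add: rGamma_inverse_Gamma field_simps)
qed

lemma set_integrable_Beta_kernel:
  fixes \<alpha> \<beta> :: real
  assumes "\<alpha> > 0" and "\<beta> > 0"
  shows "set_integrable lborel {0<..} (\<lambda>s. s powr (\<alpha> - 1) * (1 + s) powr (- \<alpha> - \<beta>))"
proof -
  have "set_integrable lborel {0<..} (\<lambda>s. norm (complex_of_real s powr (of_real \<alpha> - 1) * (1 + of_real s) powr (- of_real \<alpha> - of_real \<beta>)))"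
    using LINT_Beta(1)[of "of_real \<alpha>" "of_real \<beta>"] assms by (intro set_integrable_norm) auto
  then show ?thesis
    by (rule iffD1[OF set_integrable_cong[OF refl refl], rotated])
       (simp add: norm_mult norm_of_real_powr norm_one_plus_of_real_powr)
qed

lemma one_plus_powr_le_exp:
  fixes M \<tau> :: real
  assumes "\<tau> > 0"
  obtains C where "C \<ge> 0" and "\<And>s. s > 0 \<Longrightarrow> (1 + s) powr M \<le> C * exp (\<tau> * s)"
proof
  \<comment> \<open>Chosen so that \<open>\<bar>M\<bar> * c <= \<tau>\<close> while
    \<open>c > 0\<close> also for \<open>M = 0\<close>; the estimate is \<open>ln u <= u - 1\<close>
    at \<open>u = c * (1 + s)\<close>.\<close>
  define c where "c = \<tau> / (\<bar>M\<bar> + 1)"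
  have c: "c > 0" using assms by (simp add: c_def)
  show "0 \<le> exp (\<bar>M\<bar> * (c - 1 - ln c))" by simp
  fix s :: real assume s: "s > 0"
  have "ln (c * (1 + s)) \<le> c * (1 + s) - 1"
    using c s by (intro ln_le_minus_one) auto
  then have l: "ln (1 + s) \<le> c - 1 - ln c + c * s"
    using c s ln_mult[of c "1 + s"] by (simp add: algebra_simps)
  have "M * ln (1 + s) \<le> \<bar>M\<bar> * ln (1 + s)"
    using s by (intro mult_right_mono) auto
  also have "\<dots> \<le> \<bar>M\<bar> * (c - 1 - ln c + c * s)"
    by (intro mult_left_mono l) auto
  also have "\<dots> = \<bar>M\<bar> * (c - 1 - ln c) + (\<bar>M\<bar> * c) * s" by (simp add: algebra_simps)
  also have "(\<bar>M\<bar> * c) * s \<le> \<tau> * s"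
    using assms s by (intro mult_right_mono) (auto simp: c_def field_simps)
  finally have "M * ln (1 + s) \<le> \<bar>M\<bar> * (c - 1 - ln c) + \<tau> * s" by simp
  then show "(1 + s) powr M \<le> exp (\<bar>M\<bar> * (c - 1 - ln c)) * exp (\<tau> * s)"
    using s by (simp add: powr_def flip: exp_add)
qed

lemma set_integrable_exp_powr_kernel:
  fixes \<alpha> \<tau> M :: real
  assumes "\<alpha> > 0" and "\<tau> > 0"
  shows "set_integrable lborel {0<..} (\<lambda>s. exp (- (\<tau> * s)) * s powr (\<alpha> - 1) * (1 + s) powr M)"
proof -
  obtain C where C: "C \<ge> 0" "\<And>s. s > 0 \<Longrightarrow> (1 + s) powr M \<le> C * exp (\<tau> / 2 * s)"
    using one_plus_powr_le_exp[of "\<tau> / 2" M] assms by auto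
  show ?thesis
  proof (rule set_integrable_Ioi_bound)
    show "set_integrable lborel {0<..} (\<lambda>s. C * (s powr (\<alpha> - 1) * exp (- (\<tau> / 2 * s))))"
      using LINT_Gamma_real(1)[of \<alpha> "\<tau> / 2"] assms by (intro set_integrable_mult_right) auto
    show "set_borel_measurable borel {0<..} (\<lambda>s. exp (- (\<tau> * s)) * s powr (\<alpha> - 1) * (1 + s) powr M)"
      by (rule set_borel_measurable_Ioi) (auto intro!: continuous_intros)
    fix s :: real assume s: "s > 0"
    have "exp (- (\<tau> * s)) * s powr (\<alpha> - 1) * (1 + s) powr M \<le> exp (- (\<tau> * s)) * s powr (\<alpha> - 1) * (C * exp (\<tau> / 2 * s))"
      by (intro mult_left_mono C(2) s) auto
    also have "\<dots> = C * (s powr (\<alpha> - 1) * exp (- (\<tau> / 2 * s)))"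
      by (simp add: field_simps flip: exp_add)
    finally show "norm (exp (- (\<tau> * s)) * s powr (\<alpha> - 1) * (1 + s) powr M) \<le> C * (s powr (\<alpha> - 1) * exp (- (\<tau> / 2 * s)))"
      by simp
  qed
qed

definition tricomi_integrand :: "complex \<Rightarrow> complex \<Rightarrow> complex \<Rightarrow> real \<Rightarrow> complex" where
  "tricomi_integrand \<nu> m t s = exp (- (t * of_real s)) * of_real s powr (\<nu> - 1) * (1 + of_real s) powr (m - \<nu> - 1)"

text \<open>The classical integral representation of Tricomi's function, convergent for
  \<open>Re \<nu> > 0\<close> and \<open>Re t > 0\<close>. It starts as an independent object;
  \<open>tricomi_U_eq_Kummer_Psi_nonint\<close> identifies it with the series form.\<close>

definition tricomi_U :: "complex \<Rightarrow> complex \<Rightarrow> complex \<Rightarrow> complex" where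
  "tricomi_U \<nu> m t = rGamma \<nu> * (LINT s:{0<..}|lborel. tricomi_integrand \<nu> m t s)"

lemma continuous_on_tricomi_integrand: "continuous_on {0<..} (tricomi_integrand \<nu> m t)"
  unfolding tricomi_integrand_def
  by (intro continuous_intros continuous_on_of_real_powr continuous_on_one_plus_of_real_powr)

lemma norm_tricomi_integrand:
  "s > 0 \<Longrightarrow> norm (tricomi_integrand \<nu> m t s) =
     exp (- (Re t * s)) * s powr (Re \<nu> - 1) * (1 + s) powr (Re m - Re \<nu> - 1)"
  by (simp add: tricomi_integrand_def norm_mult norm_of_real_powr norm_one_plus_of_real_powr)

lemma set_integrable_tricomi:
  assumes "Re \<nu> > 0" and "Re t > 0"
  shows "set_integrable lborel {0<..} (tricomi_integrand \<nu> m t)"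
  by (rule set_integrable_Ioi_bound[OF set_integrable_exp_powr_kernel[of "Re \<nu>" "Re t"]
        set_borel_measurable_Ioi[OF continuous_on_tricomi_integrand]])
     (use assms norm_tricomi_integrand in auto)

text \<open>The first equation is \<open>1 = (1 + s) - s\<close>, with the factors absorbed into the
  powers.\<close>

lemma tricomi_integrand_up:
  assumes "s > 0"
  shows "tricomi_integrand \<nu> m t s = tricomi_integrand \<nu> (m + 1) t s - tricomi_integrand (\<nu> + 1) (m + 1) t s"
    and "of_real s * tricomi_integrand \<nu> m t s = tricomi_integrand (\<nu> + 1) (m + 1) t s"
proof -
  have 1: "of_real s * of_real s powr (\<nu> - 1) = complex_of_real s powr \<nu>"
    using powr_add[of "of_real s" 1 "\<nu> - 1"] assms by simp
  have "1 + complex_of_real s \<noteq> 0" using assms by (simp add: complex_eq_iff)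
  then have 2: "(1 + of_real s) * (1 + of_real s) powr (m - \<nu> - 1) = (1 + complex_of_real s) powr (m - \<nu>)"
    using powr_add[of "1 + of_real s" 1 "m - \<nu> - 1"] by simp
  have e: "m + 1 - \<nu> - 1 = m - \<nu>" "m + 1 - (\<nu> + 1) - 1 = m - \<nu> - 1" "\<nu> + 1 - 1 = \<nu>" by simp_all
  show "tricomi_integrand \<nu> m t s = tricomi_integrand \<nu> (m + 1) t s - tricomi_integrand (\<nu> + 1) (m + 1) t s"
    unfolding tricomi_integrand_def e 1[symmetric] 2[symmetric] by (simp add: algebra_simps)
  show "of_real s * tricomi_integrand \<nu> m t s = tricomi_integrand (\<nu> + 1) (m + 1) t s"
    unfolding tricomi_integrand_def e 1[symmetric] by (simp add: mult_ac)
qed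

text \<open>This, the derivative formula and \<open>tricomi_U_down\<close> have exactly the shape of
  the relations for \<open>Kummer_Psi_nonint\<close>; hence the difference of the two functions
  satisfies them too.\<close>

lemma tricomi_U_up:
  assumes "Re \<nu> > 0" and "Re t > 0"
  shows "tricomi_U \<nu> m t = tricomi_U \<nu> (m + 1) t - \<nu> * tricomi_U (\<nu> + 1) (m + 1) t"
proof -
  have "(LINT s:{0<..}|lborel. tricomi_integrand \<nu> m t s) =
      (LINT s:{0<..}|lborel. tricomi_integrand \<nu> (m + 1) t s - tricomi_integrand (\<nu> + 1) (m + 1) t s)"
    by (intro set_lebesgue_integral_cong allI impI tricomi_integrand_up(1)) auto
  also have "\<dots> = (LINT s:{0<..}|lborel. tricomi_integrand \<nu> (m + 1) t s) - (LINT s:{0<..}|lborel. tricomi_integrand (\<nu> + 1) (m + 1) t s)"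
    by (intro set_integral_diff set_integrable_tricomi) (use assms in auto)
  finally show ?thesis
    unfolding tricomi_U_def
    by (simp only: right_diff_distrib mult.assoc[symmetric] rGamma_eq_mult_rGamma_plus1[of \<nu>, symmetric])
qed

lemma tricomi_U_has_derivative:
  assumes "Re \<nu> > 0" and "Re t > 0"
  shows "(tricomi_U \<nu> m has_field_derivative - \<nu> * tricomi_U (\<nu> + 1) (m + 1) t) (at t)"
proof -
  have d: "((\<lambda>t. tricomi_integrand \<nu> m t s) has_field_derivative - of_real s * tricomi_integrand \<nu> m t s) (at t)" for t s
    unfolding tricomi_integrand_def by (auto intro!: derivative_eq_intros)
  have *: "((\<lambda>t. LINT s:{0<..}|lborel. tricomi_integrand \<nu> m t s) has_field_derivative
      (LINT s:{0<..}|lborel. deriv (\<lambda>t. tricomi_integrand \<nu> m t s) t)) (at t)"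
  proof (rule holomorphic_parametric_integral)
    show "open {t. Re t > 0}" by (rule open_halfspace_Re_gt)
    show "(\<lambda>t. tricomi_integrand \<nu> m t s) holomorphic_on {t. Re t > 0}" for s
      using d by (auto simp: holomorphic_on_def field_differentiable_def intro: has_field_derivative_at_within)
    show "set_borel_measurable borel {0<..} (tricomi_integrand \<nu> m t)" for t
      by (rule set_borel_measurable_Ioi[OF continuous_on_tricomi_integrand])
    fix t assume t: "t \<in> {t. Re t > 0}"
    show "\<exists>r>0. \<exists>h. set_integrable lborel {0<..} h \<and> (\<forall>w\<in>cball t r. w \<in> {t. Re t > 0} \<and>
        (\<forall>x\<in>{0<..}. norm (tricomi_integrand \<nu> m w x) \<le> h x))"
    proof (intro exI[of _ "Re t / 2"] conjI exI)
      show "set_integrable lborel {0<..} (\<lambda>s. exp (- (Re t / 2 * s)) * s powr (Re \<nu> - 1) * (1 + s) powr (Re m - Re \<nu> - 1))"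
        using t assms by (intro set_integrable_exp_powr_kernel) auto
      show "\<forall>w\<in>cball t (Re t / 2). w \<in> {t. Re t > 0} \<and> (\<forall>x\<in>{0<..}. norm (tricomi_integrand \<nu> m w x)
           \<le> exp (- (Re t / 2 * x)) * x powr (Re \<nu> - 1) * (1 + x) powr (Re m - Re \<nu> - 1))"
      proof (intro ballI conjI)
        fix w assume "w \<in> cball t (Re t / 2)"
        then have "\<bar>Re (t - w)\<bar> \<le> Re t / 2"
          using abs_Re_le_cmod[of "t - w"] by (auto simp: dist_norm)
        then have w: "Re w \<ge> Re t / 2" by (simp only: minus_complex.sel abs_le_iff) linarith
        then show "w \<in> {t. Re t > 0}" using t by simp
        fix x :: real assume "x \<in> {0<..}"
        then show "norm (tricomi_integrand \<nu> m w x) \<le> exp (- (Re t / 2 * x)) * x powr (Re \<nu> - 1) * (1 + x) powr (Re m - Re \<nu> - 1)"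
          using w by (auto simp: norm_tricomi_integrand intro!: mult_right_mono)
      qed
    qed (use t in auto)
  qed (use assms in auto)
  have "(LINT s:{0<..}|lborel. deriv (\<lambda>t. tricomi_integrand \<nu> m t s) t) =
      (LINT s:{0<..}|lborel. (- 1) * tricomi_integrand (\<nu> + 1) (m + 1) t s)"
    by (intro set_lebesgue_integral_cong) (auto simp: DERIV_imp_deriv[OF d] tricomi_integrand_up(2))
  also have "\<dots> = - (LINT s:{0<..}|lborel. tricomi_integrand (\<nu> + 1) (m + 1) t s)"
    unfolding set_integral_mult_right by simp
  finally show ?thesis
    using DERIV_cmult[OF *, of "rGamma \<nu>"] rGamma_eq_mult_rGamma_plus1[of \<nu>]
    unfolding tricomi_U_def[abs_def] by (simp add: mult_ac)
qed

lemma tricomi_U_holomorphic: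
  assumes "Re \<nu> > 0"
  shows "tricomi_U \<nu> m holomorphic_on {t. Re t > 0}"
  using tricomi_U_has_derivative[OF assms]
  by (auto simp: holomorphic_on_def field_differentiable_def intro: has_field_derivative_at_within)

text \<open>Here \<open>m\<close> occurs only as an exponent of \<open>1 + s\<close>, and the
  exponential dominates every such power; so the integral is entire in \<open>m\<close> and can be
  continued from a small strip.\<close>

lemma tricomi_U_index_holomorphic:
  assumes "Re \<nu> > 0" and "Re t > 0"
  shows "(\<lambda>m. tricomi_U \<nu> m t) holomorphic_on UNIV"
proof -
  have "(\<lambda>m. LINT s:{0<..}|lborel. tricomi_integrand \<nu> m t s) holomorphic_on UNIV"
  proof (rule holomorphic_on_parametric_integral)
    show "(\<lambda>m. tricomi_integrand \<nu> m t s) holomorphic_on UNIV" if "s \<in> {0<..}" for s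
      unfolding tricomi_integrand_def by (intro holomorphic_intros)
    show "set_borel_measurable borel {0<..} (tricomi_integrand \<nu> m t)" for m
      by (rule set_borel_measurable_Ioi[OF continuous_on_tricomi_integrand])
    fix m :: complex
    show "\<exists>r>0. \<exists>h. set_integrable lborel {0<..} h \<and> (\<forall>w\<in>cball m r. w \<in> UNIV \<and>
        (\<forall>x\<in>{0<..}. norm (tricomi_integrand \<nu> w t x) \<le> h x))"
    proof (intro exI[of _ 1] conjI exI)
      show "set_integrable lborel {0<..} (\<lambda>s. exp (- (Re t * s)) * s powr (Re \<nu> - 1) * (1 + s) powr (Re m + 1 - Re \<nu> - 1))"
        using assms by (intro set_integrable_exp_powr_kernel) auto
      show "\<forall>w\<in>cball m 1. w \<in> UNIV \<and> (\<forall>x\<in>{0<..}. norm (tricomi_integrand \<nu> w t x)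
           \<le> exp (- (Re t * x)) * x powr (Re \<nu> - 1) * (1 + x) powr (Re m + 1 - Re \<nu> - 1))"
      proof (intro ballI conjI UNIV_I)
        fix w assume "w \<in> cball m 1"
        then have "\<bar>Re (m - w)\<bar> \<le> 1"
          using abs_Re_le_cmod[of "m - w"] by (auto simp: dist_norm)
        then have w: "Re w \<le> Re m + 1" by (simp only: minus_complex.sel abs_le_iff) linarith
        fix x :: real assume "x \<in> {0<..}"
        then show "norm (tricomi_integrand \<nu> w t x) \<le> exp (- (Re t * x)) * x powr (Re \<nu> - 1) * (1 + x) powr (Re m + 1 - Re \<nu> - 1)"
          using w by (auto simp: norm_tricomi_integrand intro!: mult_left_mono powr_mono)
      qed
    qed auto
  qed auto
  then show ?thesis unfolding tricomi_U_def by (intro holomorphic_intros)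
qed

text \<open>Integrates the derivative of \<open>F\<close> over the half-line.
  \<open>Re \<nu> > 1\<close> makes \<open>F\<close> vanish at \<open>0\<close> and the integral
  with parameter \<open>\<nu> - 1\<close> converge.\<close>

lemma tricomi_U_down:
  assumes nu: "Re \<nu> > 1" and t: "Re t > 0"
  shows "t * tricomi_U \<nu> m t = tricomi_U (\<nu> - 1) (m - 1) t - (\<nu> - m + 1) * tricomi_U \<nu> (m - 1) t"
proof -
  define F where "F s = exp (- (t * of_real s)) * of_real s powr (\<nu> - 1) * (1 + of_real s) powr (m - \<nu> - 1)" for s
  define f where "f s = - t * tricomi_integrand \<nu> m t s + (\<nu> - 1) * tricomi_integrand (\<nu> - 1) (m - 1) t s
      + (m - \<nu> - 1) * tricomi_integrand \<nu> (m - 1) t s" for s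
  have e: "m - 1 - (\<nu> - 1) - 1 = m - \<nu> - 1" "m - 1 - \<nu> - 1 = m - \<nu> - 1 - 1" by simp_all
  have i: "set_integrable lborel {0<..} (\<lambda>s. c * tricomi_integrand a b t s)" if "Re a > 0" for a b c
    using set_integrable_tricomi[OF that t] by (intro set_integrable_mult_right)
  have nF: "norm (F s) = exp (- (Re t * s)) * s powr (Re \<nu> - 1) * (1 + s) powr (Re m - Re \<nu> - 1)" if "s > 0" for s
    using norm_tricomi_integrand[OF that] unfolding F_def tricomi_integrand_def .
  have "(LINT s:{0<..}|lborel. f s) = 0 - 0"
  proof (rule LINT_Ioi_FTC[where F=F])
    show "(F has_vector_derivative f x) (at x)" if "x > 0" for x
    proof -
      have E: "((\<lambda>s. exp (- (t * of_real s))) has_vector_derivative - t * exp (- (t * of_real x))) (at x)"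
        by (rule has_vector_derivative_real_field[where f="\<lambda>s. exp (- (t * s))"])
           (auto intro!: derivative_eq_intros)
      show ?thesis
        unfolding F_def[abs_def] f_def tricomi_integrand_def e
        by (rule has_vector_derivative_eq_rhs[OF has_vector_derivative_mult[OF has_vector_derivative_mult[OF E
              has_vector_derivative_of_real_powr[OF that]] has_vector_derivative_one_plus_of_real_powr[OF that]]])
           (simp add: algebra_simps)
    qed
    show "continuous_on {0<..} f"
      unfolding f_def by (intro continuous_intros continuous_on_tricomi_integrand)
    show "set_integrable lborel {0<..} f"
      unfolding f_def by (intro set_integral_add i) (use nu in auto)
    show "(F \<longlongrightarrow> 0) (at_right 0)"
    proof (rule tendsto_norm_zero_cancel, rule Lim_transform_eventually)
      show "((\<lambda>s. exp (- (Re t * s)) * s powr (Re \<nu> - 1) * (1 + s) powr (Re m - Re \<nu> - 1)) \<longlongrightarrow> 0) (at_right 0)"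
      proof -
        have "((\<lambda>s::real. exp (- (Re t * s)) * s powr (Re \<nu> - 1) * (1 + s) powr (Re m - Re \<nu> - 1)) \<longlongrightarrow>
            exp (- (Re t * 0)) * 0 * (1 + 0) powr (Re m - Re \<nu> - 1)) (at_right 0)"
          using nu by (intro tendsto_intros tendsto_powr'[THEN tendsto_eq_rhs]) (auto intro!: tendsto_eq_intros simp: eventually_at_filter)
        then show ?thesis by simp
      qed
      show "\<forall>\<^sub>F s in at_right 0. exp (- (Re t * s)) * s powr (Re \<nu> - 1) * (1 + s) powr (Re m - Re \<nu> - 1) = norm (F s)"
        using nF by (auto simp: eventually_at_filter)
    qed
    obtain C where C: "C \<ge> 0" "\<And>s. s > 0 \<Longrightarrow> (1 + s) powr (\<bar>Re \<nu> - 1\<bar> + \<bar>Re m - Re \<nu> - 1\<bar>) \<le> C * exp (Re t / 2 * s)"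
      using one_plus_powr_le_exp[of "Re t / 2"] t by auto
    show "(F \<longlongrightarrow> 0) at_top"
    proof (rule Lim_null_comparison)
      show "\<forall>\<^sub>F s in at_top. norm (F s) \<le> C * exp (- (Re t / 2 * s))"
        using eventually_gt_at_top[of 0]
      proof eventually_elim
        case (elim s)
        have "s powr (Re \<nu> - 1) \<le> (1 + s) powr \<bar>Re \<nu> - 1\<bar>"
          using elim nu by (auto intro!: powr_mono2)
        moreover have "(1 + s) powr (Re m - Re \<nu> - 1) \<le> (1 + s) powr \<bar>Re m - Re \<nu> - 1\<bar>"
          using elim by (intro powr_mono) auto
        ultimately have "s powr (Re \<nu> - 1) * (1 + s) powr (Re m - Re \<nu> - 1) \<le> (1 + s) powr (\<bar>Re \<nu> - 1\<bar> + \<bar>Re m - Re \<nu> - 1\<bar>)"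
          unfolding powr_add by (intro mult_mono) auto
        also have "\<dots> \<le> C * exp (Re t / 2 * s)" by (rule C(2)[OF elim])
        finally have "norm (F s) \<le> exp (- (Re t * s)) * (C * exp (Re t / 2 * s))"
          unfolding nF[OF elim] mult.assoc by (intro mult_left_mono) auto
        also have "\<dots> = C * exp (- (Re t / 2 * s))"
          by (simp add: field_simps flip: exp_add)
        finally show ?case .
      qed
      have "filterlim (\<lambda>s. - (Re t / 2 * s)) at_bot at_top"
        unfolding filterlim_uminus_at_top[symmetric]
        by (intro filterlim_tendsto_pos_mult_at_top[OF tendsto_const] filterlim_ident) (use t in auto)
      then have "((\<lambda>s. C * exp (- (Re t / 2 * s))) \<longlongrightarrow> C * 0) at_top"
        by (intro tendsto_intros filterlim_compose[OF exp_at_bot])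
      then show "((\<lambda>s. C * exp (- (Re t / 2 * s))) \<longlongrightarrow> 0) at_top" by simp
    qed
  qed
  moreover have "(LINT s:{0<..}|lborel. f s) = - t * (LINT s:{0<..}|lborel. tricomi_integrand \<nu> m t s)
      + (\<nu> - 1) * (LINT s:{0<..}|lborel. tricomi_integrand (\<nu> - 1) (m - 1) t s)
      + (m - \<nu> - 1) * (LINT s:{0<..}|lborel. tricomi_integrand \<nu> (m - 1) t s)"
    unfolding f_def using nu
    by (simp only: set_integral_add(1,2) i set_integral_mult_right minus_complex.sel one_complex.sel diff_gt_0_iff_gt)
  ultimately have *: "t * (LINT s:{0<..}|lborel. tricomi_integrand \<nu> m t s) =
      (\<nu> - 1) * (LINT s:{0<..}|lborel. tricomi_integrand (\<nu> - 1) (m - 1) t s)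
      + (m - \<nu> - 1) * (LINT s:{0<..}|lborel. tricomi_integrand \<nu> (m - 1) t s)"
    by (simp add: algebra_simps)
  have r: "rGamma (\<nu> - 1) = (\<nu> - 1) * rGamma \<nu>"
    using rGamma_eq_mult_rGamma_plus1[of "\<nu> - 1"] by simp
  have "t * tricomi_U \<nu> m t = rGamma \<nu> * (t * (LINT s:{0<..}|lborel. tricomi_integrand \<nu> m t s))"
    by (simp add: tricomi_U_def)
  also have "\<dots> = tricomi_U (\<nu> - 1) (m - 1) t - (\<nu> - m + 1) * tricomi_U \<nu> (m - 1) t"
    unfolding * tricomi_U_def r by (simp add: algebra_simps)
  finally show ?thesis .
qed

text \<open>For \<open>Re m <= 1 - d\<close> the integral converges absolutely even without the
  exponential, so a beta integral bounds it uniformly over the right half-plane and over such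
  \<open>m\<close>.\<close>

lemma tricomi_U_bound:
  assumes nu: "Re \<nu> > 0" and d: "d > 0"
  obtains C where "\<And>m t. Re m \<le> 1 - d \<Longrightarrow> Re t > 0 \<Longrightarrow> norm (tricomi_U \<nu> m t) \<le> C"
proof
  fix m t :: complex assume m: "Re m \<le> 1 - d" and t: "Re t > 0"
  have i: "set_integrable lborel {0<..} (\<lambda>s. s powr (Re \<nu> - 1) * (1 + s) powr (- Re \<nu> - d))"
    by (rule set_integrable_Beta_kernel[OF nu d])
  have "norm (LINT s:{0<..}|lborel. tricomi_integrand \<nu> m t s) \<le> (LINT s:{0<..}|lborel. norm (tricomi_integrand \<nu> m t s))"
    by (rule set_integral_norm_bound[OF set_integrable_tricomi[OF nu t]])
  also have "\<dots> \<le> (LINT s:{0<..}|lborel. s powr (Re \<nu> - 1) * (1 + s) powr (- Re \<nu> - d))"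
  proof (rule set_integral_mono[OF set_integrable_norm[OF set_integrable_tricomi[OF nu t]] i])
    fix s :: real assume "s \<in> {0<..}"
    then have s: "s > 0" by simp
    have "exp (- (Re t * s)) * s powr (Re \<nu> - 1) \<le> 1 * s powr (Re \<nu> - 1)"
      using s t by (intro mult_right_mono) auto
    moreover have "(1 + s) powr (Re m - Re \<nu> - 1) \<le> (1 + s) powr (- Re \<nu> - d)"
      using m s by (intro powr_mono) auto
    ultimately show "norm (tricomi_integrand \<nu> m t s) \<le> s powr (Re \<nu> - 1) * (1 + s) powr (- Re \<nu> - d)"
      unfolding norm_tricomi_integrand[OF s] by (intro mult_mono) auto
  qed
  finally show "norm (tricomi_U \<nu> m t) \<le>
      norm (rGamma \<nu>) * (LINT s:{0<..}|lborel. s powr (Re \<nu> - 1) * (1 + s) powr (- Re \<nu> - d))"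
    unfolding tricomi_U_def norm_mult by (rule mult_left_mono) auto
qed

section \<open>Limits at the origin, and agreement of the integral with the series form\<close>

lemma tendsto_of_real_powr_0:
  assumes "Re z > 0"
  shows "((\<lambda>t. complex_of_real t powr z) \<longlongrightarrow> 0) (at_right 0)"
proof (rule tendsto_norm_zero_cancel, rule Lim_transform_eventually)
  show "((\<lambda>t::real. t powr Re z) \<longlongrightarrow> 0) (at_right 0)"
    using assms by (intro tendsto_eq_intros) (auto simp: eventually_at_filter)
  show "\<forall>\<^sub>F t in at_right 0. t powr Re z = norm (complex_of_real t powr z)"
    by (auto simp: eventually_at_filter norm_of_real_powr)
qed

lemma Kummer_Phi_tendsto_1:
  assumes "m \<notin> \<int>\<^sub>\<le>\<^sub>0"
  shows "((\<lambda>t. Kummer_Phi \<nu> m (of_real t)) \<longlongrightarrow> 1) (at_right 0)"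
proof -
  have "isCont (Kummer_Phi \<nu> m) (of_real 0)"
    using DERIV_isCont[OF Kummer_Phi_has_derivative[OF assms]] .
  then have "((\<lambda>t. Kummer_Phi \<nu> m (of_real t)) \<longlongrightarrow> Kummer_Phi \<nu> m (of_real 0)) (at_right 0)"
    by (rule isCont_tendsto_compose) (auto intro!: tendsto_eq_intros)
  then show ?thesis by simp
qed

lemma Kummer_Psi_nonint_tendsto:
  assumes m: "m \<notin> \<int>" and "Re m < 1"
  shows "((\<lambda>t. Kummer_Psi_nonint \<nu> m (of_real t)) \<longlongrightarrow> Gamma (1 - m) * rGamma (\<nu> + 1 - m)) (at_right 0)"
proof -
  have "2 - m \<notin> \<int>" using m by (simp add: Ints_diff_left_iff)
  then have "((\<lambda>t. Kummer_Psi_nonint \<nu> m (of_real t)) \<longlongrightarrow>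
     Gamma (1 - m) * rGamma (\<nu> + 1 - m) * 1 + Gamma (m - 1) * rGamma \<nu> * 0 * 1) (at_right 0)"
    unfolding Kummer_Psi_nonint_def using assms
    by (intro tendsto_intros Kummer_Phi_tendsto_1 tendsto_of_real_powr_0 notin_Ints_imp_notin_nonpos_Ints) auto
  then show ?thesis by simp
qed

text \<open>Up to the factor \<open>- \<nu>\<close> this is the derivative weighted with
  \<open>t powr m\<close>: the second initial condition at the singular point
  \<open>0\<close>.\<close>

lemma powr_times_Kummer_Psi_nonint_tendsto:
  assumes m: "m \<notin> \<int>" and "0 < Re m"
  shows "((\<lambda>t. of_real t powr m * Kummer_Psi_nonint (\<nu> + 1) (m + 1) (of_real t)) \<longlongrightarrow> Gamma m * rGamma (\<nu> + 1)) (at_right 0)"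
proof -
  have n: "1 - m \<notin> \<int>" "m + 1 \<notin> \<int>" using m Ints_diff[of "m + 1" 1] by (auto simp: Ints_diff_left_iff)
  have lim: "((\<lambda>t. Gamma (- m) * rGamma (\<nu> - m + 1) * (of_real t powr m * Kummer_Phi (\<nu> + 1) (m + 1) (of_real t))
      + Gamma m * rGamma (\<nu> + 1) * Kummer_Phi (\<nu> - m + 1) (1 - m) (of_real t)) \<longlongrightarrow>
     Gamma (- m) * rGamma (\<nu> - m + 1) * (0 * 1) + Gamma m * rGamma (\<nu> + 1) * 1) (at_right 0)"
    using assms n by (intro tendsto_intros Kummer_Phi_tendsto_1 tendsto_of_real_powr_0 notin_Ints_imp_notin_nonpos_Ints) auto
  have e: "1 - (m + 1) = - m" "m + 1 - 1 = m" "\<nu> + 1 + 1 - (m + 1) = \<nu> - m + 1" "2 - (m + 1) = 1 - m"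
    by simp_all
  have "Gamma (- m) * rGamma (\<nu> - m + 1) * (of_real t powr m * Kummer_Phi (\<nu> + 1) (m + 1) (of_real t))
      + Gamma m * rGamma (\<nu> + 1) * Kummer_Phi (\<nu> - m + 1) (1 - m) (of_real t) =
      of_real t powr m * Kummer_Psi_nonint (\<nu> + 1) (m + 1) (of_real t)" if "t > 0" for t :: real
  proof -
    have "of_real t powr m * of_real t powr (- m) = (1 :: complex)"
      using that by (simp flip: powr_add)
    then show ?thesis unfolding Kummer_Psi_nonint_def e by algebra
  qed
  with lim show ?thesis
    by (auto elim!: Lim_transform_eventually simp: eventually_at_filter)
qed

text \<open>Dominated convergence lets \<open>t\<close> tend to \<open>0\<close> inside the
  integral, and the limit is a beta integral because \<open>Re m < 1\<close>.\<close>

lemma tricomi_U_tendsto: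
  assumes nu: "Re \<nu> > 0" and m: "Re m < 1"
  shows "((\<lambda>t. tricomi_U \<nu> m (of_real t)) \<longlongrightarrow> Gamma (1 - m) * rGamma (\<nu> + 1 - m)) (at_right 0)"
  unfolding tendsto_at_iff_sequentially
proof (intro allI impI)
  fix X :: "nat \<Rightarrow> real" assume X: "\<forall>i. X i \<in> {0<..} - {0}" "X \<longlonglongrightarrow> 0"
  have "(\<lambda>n. LINT s:{0<..}|lborel. tricomi_integrand \<nu> m (of_real (X n)) s) \<longlonglongrightarrow>
      (LINT s:{0<..}|lborel. tricomi_integrand \<nu> m 0 s)"
  proof (rule LINT_Ioi_dominated_convergence(2))
    show "set_integrable lborel {0<..} (\<lambda>s. s powr (Re \<nu> - 1) * (1 + s) powr (- Re \<nu> - (1 - Re m)))"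
      using assms by (intro set_integrable_Beta_kernel) auto
    show "norm (tricomi_integrand \<nu> m (of_real (X n)) x) \<le> x powr (Re \<nu> - 1) * (1 + x) powr (- Re \<nu> - (1 - Re m))"
      if "x > 0" for n x
    proof -
      have "exp (- (X n * x)) * x powr (Re \<nu> - 1) \<le> 1 * x powr (Re \<nu> - 1)"
        using that X(1) by (intro mult_right_mono) (auto simp: less_imp_le)
      from mult_right_mono[OF this, of "(1 + x) powr (Re m - Re \<nu> - 1)"] show ?thesis
        unfolding norm_tricomi_integrand[OF that] by (simp add: diff_diff_eq2 add.commute)
    qed
    show "(\<lambda>n. tricomi_integrand \<nu> m (of_real (X n)) x) \<longlonglongrightarrow> tricomi_integrand \<nu> m 0 x" for x
      unfolding tricomi_integrand_def using X(2) by (auto intro!: tendsto_eq_intros)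
  qed (rule set_borel_measurable_Ioi[OF continuous_on_tricomi_integrand])
  moreover have "(LINT s:{0<..}|lborel. tricomi_integrand \<nu> m 0 s) = Gamma \<nu> * Gamma (1 - m) * rGamma (\<nu> + 1 - m)"
    using LINT_Beta(2)[of \<nu> "1 - m"] assms by (simp add: tricomi_integrand_def algebra_simps)
  ultimately have "(\<lambda>n. tricomi_U \<nu> m (of_real (X n))) \<longlonglongrightarrow> rGamma \<nu> * (Gamma \<nu> * Gamma (1 - m) * rGamma (\<nu> + 1 - m))"
    unfolding tricomi_U_def by (auto intro!: tendsto_intros)
  moreover have "rGamma \<nu> * Gamma \<nu> = 1"
    using Re_pos_imp_notin_nonpos_Ints[OF nu] by (simp add: rGamma_inverse_Gamma Gamma_eq_zero_iff)
  ultimately show "((\<lambda>t. tricomi_U \<nu> m (of_real t)) \<circ> X) \<longlonglongrightarrow> Gamma (1 - m) * rGamma (\<nu> + 1 - m)"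
    by (simp add: o_def mult.assoc[symmetric])
qed

text \<open>The integral alone can blow up at \<open>t = 0\<close>. Rescaling \<open>s\<close> by
  \<open>1 / t\<close> absorbs \<open>t powr m\<close> and gives the integrand \<open>g t\<close>,
  which converges to that of \<open>Gamma m\<close>.\<close>

lemma powr_times_tricomi_U_tendsto:
  assumes nu: "Re \<nu> > 0" and m: "0 < Re m" "Re m < 1"
  shows "((\<lambda>t. of_real t powr m * tricomi_U (\<nu> + 1) (m + 1) (of_real t)) \<longlongrightarrow> Gamma m * rGamma (\<nu> + 1)) (at_right 0)"
  unfolding tendsto_at_iff_sequentially
proof (intro allI impI)
  fix X :: "nat \<Rightarrow> real" assume X: "\<forall>i. X i \<in> {0<..} - {0}" "X \<longlonglongrightarrow> 0"
  define g where "g t s = of_real (exp (- s)) * of_real s powr \<nu> * of_real (t + s) powr (m - \<nu> - 1)" for t s :: real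
  have scale: "of_real t powr m * (LINT s:{0<..}|lborel. tricomi_integrand (\<nu> + 1) (m + 1) (of_real t) s) =
      (LINT s:{0<..}|lborel. g t s)" if t: "t > 0" for t
  proof -
    have "of_real t powr (m - 1) * tricomi_integrand (\<nu> + 1) (m + 1) (of_real t) (1 / t * s) = g t s" if s: "s > 0" for s
    proof -
      have 1: "complex_of_real s powr \<nu> = of_real t powr \<nu> * of_real (1 / t * s) powr \<nu>"
        using powr_times_real[of "of_real t" "of_real (1 / t * s)" \<nu>] s t by simp
      have 2: "complex_of_real (t + s) powr (m - \<nu> - 1) = of_real t powr (m - \<nu> - 1) * (1 + of_real (1 / t * s)) powr (m - \<nu> - 1)"
        using powr_times_real[of "of_real t" "1 + of_real (1 / t * s)" "m - \<nu> - 1"] s t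
        by (simp add: distrib_left)
      have 3: "of_real t powr \<nu> * of_real t powr (m - \<nu> - 1) = complex_of_real t powr (m - 1)"
        by (simp flip: powr_add)
      have 4: "exp (- (complex_of_real t * of_real (1 / t * s))) = of_real (exp (- s))"
        using t by (simp add: exp_of_real[symmetric])
      have e: "\<nu> + 1 - 1 = \<nu>" "m + 1 - (\<nu> + 1) - 1 = m - \<nu> - 1" by simp_all
      show ?thesis
        unfolding g_def tricomi_integrand_def e 1 2 3[symmetric] 4 by (simp only: mult_ac)
    qed
    then have "(LINT s:{0<..}|lborel. g t s) = of_real t powr (m - 1) *
        (LINT s:{0<..}|lborel. tricomi_integrand (\<nu> + 1) (m + 1) (of_real t) (1 / t * s))"
      unfolding set_integral_mult_right[symmetric] by (intro set_lebesgue_integral_cong) auto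
    moreover have "(LINT s:{0<..}|lborel. tricomi_integrand (\<nu> + 1) (m + 1) (of_real t) s) = (1 / t) *\<^sub>R
        (LINT s:{0<..}|lborel. tricomi_integrand (\<nu> + 1) (m + 1) (of_real t) (1 / t * s))"
      using t by (intro LINT_Ioi_scale(2)) auto
    moreover have "of_real t powr m * of_real (1 / t) = complex_of_real t powr (m - 1)"
      using t by (simp add: powr_diff)
    ultimately show ?thesis
      by (simp only: scaleR_conv_of_real mult.assoc[symmetric])
  qed
  have "(\<lambda>n. LINT s:{0<..}|lborel. g (X n) s) \<longlonglongrightarrow> (LINT s:{0<..}|lborel. g 0 s)"
  proof (rule LINT_Ioi_dominated_convergence(2))
    show "set_integrable lborel {0<..} (\<lambda>s. s powr (Re m - 1) * exp (- (1 * s)))"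
      by (rule LINT_Gamma_real(1)[OF m(1) zero_less_one])
    show "set_borel_measurable borel {0<..} (g (X n))" for n
    proof (rule set_borel_measurable_Ioi)
      show "continuous_on {0<..} (g (X n))"
        unfolding g_def using X(1)
        by (intro continuous_intros continuous_on_of_real_powr continuous_on_compose2[OF continuous_on_of_real_powr[of "m - \<nu> - 1"]])
           (auto simp: add_pos_pos)
    qed
    show "norm (g (X n) x) \<le> x powr (Re m - 1) * exp (- (1 * x))" if x: "x > 0" for n x
    proof -
      have X0: "X n > 0" using X(1) by auto
      \<comment> \<open>The exponent is negative since \<open>Re m < 1\<close> and
        \<open>Re \<nu> > 0\<close>, so dropping \<open>X n\<close> gives a majorant independent of
        \<open>n\<close>.\<close>
      have "(X n + x) powr (Re m - Re \<nu> - 1) \<le> x powr (Re m - Re \<nu> - 1)"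
        using x X0 nu m by (intro powr_mono2') auto
      then have "norm (g (X n) x) \<le> exp (- x) * (x powr Re \<nu> * x powr (Re m - Re \<nu> - 1))"
        unfolding g_def norm_mult using x X0 norm_of_real_powr[of "X n + x" "m - \<nu> - 1"]
        by (simp add: norm_of_real_powr mult_left_mono)
      also have "x powr Re \<nu> * x powr (Re m - Re \<nu> - 1) = x powr (Re m - 1)"
        by (simp flip: powr_add)
      finally show ?thesis by (simp add: mult.commute)
    qed
    show "(\<lambda>n. g (X n) x) \<longlonglongrightarrow> g 0 x" if "x > 0" for x
      unfolding g_def using X(2) that
      by (intro tendsto_intros tendsto_powr_complex) (auto intro!: tendsto_eq_intros)
  qed
  moreover have "(LINT s:{0<..}|lborel. g 0 s) = Gamma m"
  proof -
    have "g 0 s = of_real s powr (m - 1) * of_real (exp (- (1 * s)))" if "s > 0" for s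
      using that powr_add[of "of_real s" \<nu> "m - \<nu> - 1"] by (simp add: g_def mult_ac)
    then have "(LINT s:{0<..}|lborel. g 0 s) = (LINT s:{0<..}|lborel. of_real s powr (m - 1) * of_real (exp (- (1 * s))))"
      by (intro set_lebesgue_integral_cong) auto
    then show ?thesis using LINT_Gamma(2)[OF m(1) zero_less_one] by simp
  qed
  ultimately have "(\<lambda>n. rGamma (\<nu> + 1) * (LINT s:{0<..}|lborel. g (X n) s)) \<longlonglongrightarrow> rGamma (\<nu> + 1) * Gamma m"
    by (auto intro!: tendsto_intros)
  moreover have "rGamma (\<nu> + 1) * (LINT s:{0<..}|lborel. g (X n) s) =
      of_real (X n) powr m * tricomi_U (\<nu> + 1) (m + 1) (of_real (X n))" for n
    using scale[of "X n"] X(1) unfolding tricomi_U_def by (simp add: mult_ac)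
  ultimately show "((\<lambda>t. of_real t powr m * tricomi_U (\<nu> + 1) (m + 1) (of_real t)) \<circ> X) \<longlonglongrightarrow> Gamma m * rGamma (\<nu> + 1)"
    by (simp add: o_def mult.commute)
qed

text \<open>With \<open>y = U - \<Psi>\<close> and \<open>v = t powr m * exp (- t) * y(\<nu> + 1, m + 1)\<close> Kummer's equation becomes the
  system \<open>y' = - \<nu> * t powr (- m) * exp t * v\<close>, \<open>v' = - t powr (m - 1) * exp (- t) * y\<close>, whose coefficients
  are integrable at \<open>0\<close>. Since \<open>y\<close> and \<open>v\<close> vanish at \<open>0\<close>, a contraction estimate shows that they
  vanish near \<open>0\<close>.\<close>

lemma tricomi_U_eq_Kummer_Psi_nonint_near_0:
  assumes nu: "Re \<nu> > 0" and m: "0 < Re m" "Re m < 1"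
  obtains \<delta> where "\<delta> > 0" and "\<And>t. 0 < t \<Longrightarrow> t \<le> \<delta> \<Longrightarrow> tricomi_U \<nu> m (of_real t) = Kummer_Psi_nonint \<nu> m (of_real t)"
proof -
  define \<alpha> where "\<alpha> = Re m"
  have al: "0 < \<alpha>" "\<alpha> < 1" using m by (auto simp: \<alpha>_def)
  have mI: "m \<notin> \<int>"
  proof
    assume "m \<in> \<int>"
    then obtain k where "m = of_int k" by (rule Ints_cases)
    then show False using m by simp
  qed
  have mI1: "m + 1 \<notin> \<int>" "m + 2 \<notin> \<int>" using mI Ints_diff[of "m + 1" 1] Ints_diff[of "m + 2" 2] by auto
  define G where "G a b t = tricomi_U a b t - Kummer_Psi_nonint a b t" for a b t
  have Gder: "(G a b has_field_derivative - a * G (a + 1) (b + 1) t) (at t)" if "Re a > 0" "b \<notin> \<int>" "Re t > 0" for a b t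
  proof -
    have "t \<notin> \<real>\<^sub>\<le>\<^sub>0" using that by (auto simp: complex_nonpos_Reals_iff)
    then show ?thesis unfolding G_def[abs_def]
      by (rule DERIV_cong[OF DERIV_diff[OF tricomi_U_has_derivative[OF that(1,3)] Kummer_Psi_nonint_has_derivative[OF that(2)]]])
         (simp add: algebra_simps)
  qed
  \<comment> \<open>Kummer's equation for the difference, free of second derivatives. It rests only
    on the up and down relations shared by both functions.\<close>
  have key: "(m - t) * G (\<nu> + 1) (m + 1) t - (\<nu> + 1) * t * G (\<nu> + 2) (m + 2) t = - G \<nu> m t" if t: "Re t > 0" for t
  proof -
    have t0: "t \<noteq> 0" using t by auto
    have e: "\<nu> + 2 - 1 = \<nu> + 1" "m + 2 - 1 = m + 1" "\<nu> + 2 - (m + 2) + 1 = \<nu> - m + 1" "\<nu> + 1 - 1 = \<nu>" "m + 1 - 1 = m"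
        "\<nu> + 1 - (m + 1) + 1 = \<nu> - m + 1" "\<nu> + 1 + 1 = \<nu> + 2"
      by simp_all
    have Re2: "Re (\<nu> + 2) > 1" "Re (\<nu> + 1) > 1" "Re (\<nu> + 1) > 0" using nu by auto
    have d1: "t * G (\<nu> + 2) (m + 2) t = G (\<nu> + 1) (m + 1) t - (\<nu> - m + 1) * G (\<nu> + 2) (m + 1) t"
      using tricomi_U_down[OF Re2(1) t, of "m + 2"] Kummer_Psi_nonint_down[OF mI1(2) t0, of "\<nu> + 2"]
      unfolding e G_def by algebra
    have d2: "t * G (\<nu> + 1) (m + 1) t = G \<nu> m t - (\<nu> - m + 1) * G (\<nu> + 1) m t"
      using tricomi_U_down[OF Re2(2) t, of "m + 1"] Kummer_Psi_nonint_down[OF mI1(1) t0, of "\<nu> + 1"]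
      unfolding e G_def by algebra
    have u: "G (\<nu> + 1) m t = G (\<nu> + 1) (m + 1) t - (\<nu> + 1) * G (\<nu> + 2) (m + 1) t"
      using tricomi_U_up[OF Re2(3) t, of m] Kummer_Psi_nonint_up[OF mI t0, of "\<nu> + 1"]
      unfolding e G_def by algebra
    show ?thesis using d1 d2 u by algebra
  qed
  \<comment> \<open>Both \<open>y\<close> and \<open>v\<close> get their one-sided limit as value at
    \<open>0\<close>, so that they are continuous on the closed interval.\<close>
  define y where "y t = (if t = 0 then 0 else G \<nu> m (of_real t))" for t :: real
  define w where "w t = G (\<nu> + 1) (m + 1) (of_real t)" for t :: real
  define v where "v t = (if t = 0 then 0 else of_real t powr m * exp (- of_real t) * w t)" for t :: real
  have rho: "((\<lambda>x. f (of_real x)) has_vector_derivative f') (at t)"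
    if "(f has_field_derivative f') (at (of_real t))" for f :: "complex \<Rightarrow> complex" and f' t
    using that by (rule has_vector_derivative_real_field)
  have ydr: "(y has_vector_derivative - \<nu> * w t) (at t)" if t: "t > 0" for t
  proof (rule has_vector_derivative_transform_within_open[of _ _ _ "{0<..}"])
    show "((\<lambda>t. G \<nu> m (of_real t)) has_vector_derivative - \<nu> * w t) (at t)"
      unfolding w_def by (rule rho[OF Gder]) (use nu mI t in auto)
  qed (use t in \<open>auto simp: y_def\<close>)
  have vdr: "(v has_vector_derivative - (of_real t powr (m - 1) * exp (- of_real t) * y t)) (at t)" if t: "t > 0" for t
  proof (rule has_vector_derivative_transform_within_open[of _ _ _ "{0<..}"])
    let ?t = "complex_of_real t"
    have "((\<lambda>t. t powr m * exp (- t) * G (\<nu> + 1) (m + 1) t) has_field_derivative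
       (?t powr m * (- exp (- ?t)) + m * ?t powr (m - 1) * exp (- ?t)) * G (\<nu> + 1) (m + 1) ?t
       + (- (\<nu> + 1) * G (\<nu> + 2) (m + 2) ?t) * (?t powr m * exp (- ?t))) (at ?t)"
      using t Gder[of "\<nu> + 1" "m + 1" ?t] nu mI1
      by (intro DERIV_mult' DERIV_mult has_field_derivative_powr)
         (auto intro!: derivative_eq_intros has_field_derivative_powr simp: add.assoc algebra_simps)
    moreover have "(?t powr m * (- exp (- ?t)) + m * ?t powr (m - 1) * exp (- ?t)) * G (\<nu> + 1) (m + 1) ?t
       + (- (\<nu> + 1) * G (\<nu> + 2) (m + 2) ?t) * (?t powr m * exp (- ?t)) = - (?t powr (m - 1) * exp (- ?t) * y t)"
    proof -
      have p: "?t powr m = ?t * ?t powr (m - 1)"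
        using powr_add[of ?t 1 "m - 1"] t by simp
      have "y t = G \<nu> m ?t" using t by (simp add: y_def)
      moreover have "(t * P * (- E) + m * P * E) * G1 + (- (\<nu> + 1) * G2) * (t * P * E) = P * E * ((m - t) * G1 - (\<nu> + 1) * t * G2)"
        for t P E G1 G2 by (simp add: algebra_simps)
      ultimately show ?thesis unfolding p using key[of ?t] t by simp
    qed
    ultimately show "((\<lambda>t. of_real t powr m * exp (- of_real t) * w t) has_vector_derivative
         - (of_real t powr (m - 1) * exp (- of_real t) * y t)) (at t)"
      unfolding w_def using rho[of "\<lambda>t. t powr m * exp (- t) * G (\<nu> + 1) (m + 1) t"] by simp
  qed (use t in \<open>auto simp: v_def\<close>)
  have y0: "(y \<longlongrightarrow> 0) (at_right 0)"
  proof -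
    have "((\<lambda>t. G \<nu> m (of_real t)) \<longlongrightarrow> Gamma (1 - m) * rGamma (\<nu> + 1 - m) - Gamma (1 - m) * rGamma (\<nu> + 1 - m)) (at_right 0)"
      unfolding G_def using assms mI by (intro tendsto_diff tricomi_U_tendsto Kummer_Psi_nonint_tendsto)
    then show ?thesis
      by (auto elim!: Lim_transform_eventually simp: eventually_at_filter y_def)
  qed
  have v0: "(v \<longlongrightarrow> 0) (at_right 0)"
  proof -
    have "((\<lambda>t. exp (- of_real t) * (of_real t powr m * tricomi_U (\<nu> + 1) (m + 1) (of_real t) -
        of_real t powr m * Kummer_Psi_nonint (\<nu> + 1) (m + 1) (of_real t))) \<longlongrightarrow>
        exp (- of_real 0) * (Gamma m * rGamma (\<nu> + 1) - Gamma m * rGamma (\<nu> + 1))) (at_right 0)"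
      using assms mI
      by (intro tendsto_intros powr_times_tricomi_U_tendsto powr_times_Kummer_Psi_nonint_tendsto)
    then show ?thesis
      by (auto elim!: Lim_transform_eventually simp: eventually_at_filter v_def w_def G_def algebra_simps)
  qed
  \<comment> \<open>These expressions bound the integrals over \<open>{0..\<delta>}\<close> of the
    two coefficients of the system, with \<open>exp t <= exp 1\<close> because
    \<open>\<delta> <= 1\<close>; both are made smaller than \<open>1 / 2\<close>.\<close>
  have "\<forall>\<^sub>F \<delta> in at_right 0. norm \<nu> * exp 1 * (\<delta> powr (1 - \<alpha>) / (1 - \<alpha>)) < 1 / 2"
    by (rule order_tendstoD(2)[of _ 0]) (use al in \<open>auto intro!: tendsto_eq_intros simp: eventually_at_filter\<close>)
  moreover have "\<forall>\<^sub>F \<delta> in at_right 0. \<delta> powr \<alpha> / \<alpha> < 1 / 2"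
    by (rule order_tendstoD(2)[of _ 0]) (use al in \<open>auto intro!: tendsto_eq_intros simp: eventually_at_filter\<close>)
  moreover have "\<forall>\<^sub>F \<delta> in at_right 0. \<delta> \<le> (1::real)"
    by (rule eventually_at_rightI[of 0 1]) auto
  moreover have "\<forall>\<^sub>F \<delta> in at_right 0. \<delta> > (0::real)"
    by (rule eventually_at_rightI[of 0 1]) auto
  ultimately have "\<forall>\<^sub>F \<delta> in at_right 0. norm \<nu> * exp 1 * (\<delta> powr (1 - \<alpha>) / (1 - \<alpha>)) < 1 / 2 \<and> \<delta> powr \<alpha> / \<alpha> < 1 / 2 \<and> \<delta> \<le> (1::real) \<and> \<delta> > 0"
    by eventually_elim auto
  then obtain \<delta> where d: "norm \<nu> * exp 1 * (\<delta> powr (1 - \<alpha>) / (1 - \<alpha>)) < 1 / 2" "\<delta> powr \<alpha> / \<alpha> < 1 / 2" "\<delta> \<le> (1::real)" "\<delta> > 0"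
    using eventually_happens'[OF trivial_limit_at_right_real] by blast
  have cont0: "continuous_on {0..\<delta>} f" if "f 0 = 0" "(f \<longlongrightarrow> 0) (at_right 0)"
      "\<And>t. t > 0 \<Longrightarrow> (f has_vector_derivative f' t) (at t)" for f :: "real \<Rightarrow> complex" and f'
    unfolding continuous_on_eq_continuous_within
  proof
    fix t assume "t \<in> {0..\<delta>}"
    show "continuous (at t within {0..\<delta>}) f"
    proof (cases "t = 0")
      case True
      then show ?thesis using that(1,2) d(4) by (simp add: continuous_within at_within_Icc_at_right)
    next
      case False
      then show ?thesis
        using that(3)[of t] \<open>t \<in> {0..\<delta>}\<close> has_vector_derivative_continuous continuous_at_imp_continuous_at_within by fastforce
    qed
  qed
  have yc: "continuous_on {0..\<delta>} y" by (rule cont0[OF _ y0 ydr]) (simp add: y_def)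
  have vc: "continuous_on {0..\<delta>} v" by (rule cont0[OF _ v0 vdr]) (simp add: v_def)
  \<comment> \<open>At a maximum \<open>t0\<close> of both norms together, the integrated system
    gives half that maximum as a bound, so the maximum is \<open>0\<close>.\<close>
  have "\<exists>t0\<in>{0..\<delta>}. \<forall>t\<in>{0..\<delta>}. max (norm (y t)) (norm (v t)) \<le> max (norm (y t0)) (norm (v t0))"
    using d(4) by (intro continuous_attains_sup continuous_intros yc vc) auto
  then obtain t0 where t0: "t0 \<in> {0..\<delta>}" "\<And>t. t \<in> {0..\<delta>} \<Longrightarrow> max (norm (y t)) (norm (v t)) \<le> max (norm (y t0)) (norm (v t0))"
    by blast
  define B where "B = max (norm (y t0)) (norm (v t0))"
  have B: "norm (y t) \<le> B" "norm (v t) \<le> B" if "t \<in> {0..\<delta>}" for t using t0(2)[OF that] by (auto simp: B_def)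
  have B0: "B \<ge> 0" by (simp add: B_def le_max_iff_disj)
  have powd: "((\<lambda>x. c * (x powr b / b)) has_vector_derivative c * x powr (b - 1)) (at x)" if "x > 0" "b > 0" for c b x :: real
    using that by (auto intro!: derivative_eq_intros simp: has_real_derivative_iff_has_vector_derivative[symmetric])
  have powc: "continuous_on {0..t} (\<lambda>x. c * (x powr b / b))" if "b > 0" for c b t :: real
  proof -
    have "continuous_on {0..t} (\<lambda>x. x powr b)"
      by (rule continuous_on_powr') (use that in \<open>auto intro!: continuous_intros\<close>)
    then show ?thesis using that by (intro continuous_on_mult continuous_on_divide continuous_on_const) auto
  qed
  have yb: "norm (y t) \<le> B / 2" if t: "t \<in> {0<..\<delta>}" for t
  proof -
    have "norm (y t - y 0) \<le> norm \<nu> * exp 1 * B * (t powr (1 - \<alpha>) / (1 - \<alpha>)) - norm \<nu> * exp 1 * B * (0 powr (1 - \<alpha>) / (1 - \<alpha>))"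
    proof (rule differentiable_bound_general[where \<phi>'="\<lambda>x. norm \<nu> * exp 1 * B * x powr (1 - \<alpha> - 1)"])
      show "continuous_on {0..t} y" using t by (intro continuous_on_subset[OF yc]) auto
      fix x assume x: "0 < x" "x < t"
      show "(y has_vector_derivative - \<nu> * w x) (at x)" by (rule ydr[OF x(1)])
      show "((\<lambda>x. norm \<nu> * exp 1 * B * (x powr (1 - \<alpha>) / (1 - \<alpha>))) has_vector_derivative norm \<nu> * exp 1 * B * x powr (1 - \<alpha> - 1)) (at x)"
        using x al by (intro powd) auto
      have "norm (v x) = x powr \<alpha> * exp (- x) * norm (w x)"
        using x by (simp add: v_def norm_mult norm_of_real_powr \<alpha>_def)
      then have "norm (w x) = x powr (- \<alpha>) * exp x * norm (v x)"
        using x by (simp add: powr_minus exp_minus field_simps)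
      also have "\<dots> \<le> x powr (- \<alpha>) * exp 1 * B"
        using x t d B(2)[of x] by (intro mult_mono) auto
      finally have "norm \<nu> * norm (w x) \<le> norm \<nu> * (x powr (- \<alpha>) * exp 1 * B)"
        by (rule mult_left_mono) auto
      then show "norm (- \<nu> * w x) \<le> norm \<nu> * exp 1 * B * x powr (1 - \<alpha> - 1)"
        by (simp add: norm_mult mult_ac)
    qed (use t al powc in auto)
    also have "\<dots> = B * (norm \<nu> * exp 1 * (t powr (1 - \<alpha>) / (1 - \<alpha>)))"
      using al by simp
    also have "\<dots> \<le> B * (norm \<nu> * exp 1 * (\<delta> powr (1 - \<alpha>) / (1 - \<alpha>)))"
      using t al B0 by (intro mult_left_mono divide_right_mono powr_mono2) auto
    also have "\<dots> \<le> B * (1 / 2)" using d(1) B0 by (intro mult_left_mono) auto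
    finally show ?thesis by (simp add: y_def)
  qed
  have vb: "norm (v t) \<le> B / 2" if t: "t \<in> {0<..\<delta>}" for t
  proof -
    have "norm (v t - v 0) \<le> B * (t powr \<alpha> / \<alpha>) - B * (0 powr \<alpha> / \<alpha>)"
    proof (rule differentiable_bound_general[where \<phi>'="\<lambda>x. B * x powr (\<alpha> - 1)"])
      show "continuous_on {0..t} v" using t by (intro continuous_on_subset[OF vc]) auto
      fix x assume x: "0 < x" "x < t"
      show "(v has_vector_derivative - (of_real x powr (m - 1) * exp (- of_real x) * y x)) (at x)" by (rule vdr[OF x(1)])
      show "((\<lambda>x. B * (x powr \<alpha> / \<alpha>)) has_vector_derivative B * x powr (\<alpha> - 1)) (at x)"
        using x al by (intro powd) auto
      have "norm (- (of_real x powr (m - 1) * exp (- of_real x) * y x)) = x powr (\<alpha> - 1) * exp (- x) * norm (y x)"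
        using x by (simp add: norm_mult norm_of_real_powr \<alpha>_def)
      also have "\<dots> \<le> x powr (\<alpha> - 1) * 1 * B"
        using x t B(1)[of x] by (intro mult_mono) auto
      finally show "norm (- (of_real x powr (m - 1) * exp (- of_real x) * y x)) \<le> B * x powr (\<alpha> - 1)"
        by (simp add: mult.commute)
    qed (use t al powc in auto)
    also have "\<dots> = B * (t powr \<alpha> / \<alpha>)"
      using al by simp
    also have "\<dots> \<le> B * (\<delta> powr \<alpha> / \<alpha>)"
      using t al B0 by (intro mult_left_mono divide_right_mono powr_mono2) auto
    also have "\<dots> \<le> B * (1 / 2)" using d(2) B0 by (intro mult_left_mono) auto
    finally show ?thesis by (simp add: v_def)
  qed
  have "B \<le> B / 2"
  proof (cases "t0 = 0")
    case True
    then show ?thesis by (simp add: B_def y_def v_def)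
  next
    case False
    then have "norm (y t0) \<le> B / 2" "norm (v t0) \<le> B / 2"
      using yb[of t0] vb[of t0] t0(1) by auto
    moreover have "B = norm (y t0) \<or> B = norm (v t0)" by (auto simp: B_def max_def)
    ultimately show ?thesis by auto
  qed
  with B0 have "B = 0" by simp
  show ?thesis
  proof (rule that[OF d(4)])
    fix t :: real assume "0 < t" "t \<le> \<delta>"
    then show "tricomi_U \<nu> m (of_real t) = Kummer_Psi_nonint \<nu> m (of_real t)"
      using B(1)[of t] \<open>B = 0\<close> by (simp add: y_def G_def)
  qed
qed

lemma Kummer_Psi_nonint_holomorphic:
  assumes "m \<notin> \<int>"
  shows "Kummer_Psi_nonint \<nu> m holomorphic_on - \<real>\<^sub>\<le>\<^sub>0"
  using Kummer_Psi_nonint_has_derivative[OF assms]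
  by (auto simp: holomorphic_on_def field_differentiable_def intro: has_field_derivative_at_within)

lemma Kummer_Psi_nonint_index_holomorphic:
  assumes "t \<noteq> 0"
  shows "(\<lambda>m. Kummer_Psi_nonint \<nu> m t) holomorphic_on - \<int>"
proof -
  have n: "m \<notin> \<int>\<^sub>\<le>\<^sub>0" "1 - m \<notin> \<int>\<^sub>\<le>\<^sub>0" "m - 1 \<notin> \<int>\<^sub>\<le>\<^sub>0" "2 - m \<notin> \<int>\<^sub>\<le>\<^sub>0" if "m \<in> - \<int>" for m :: complex
    using that by (auto intro!: notin_Ints_imp_notin_nonpos_Ints simp: Ints_diff_left_iff
        dest: Ints_add[of "m - 1" 1])
  have o: "open (- \<int> :: complex set)" by (simp add: open_Compl)
  show ?thesis
    unfolding Kummer_Psi_nonint_def using n assms o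
    by (intro holomorphic_intros Kummer_Phi_holomorphic) auto
qed

text \<open>Two uses of the identity theorem: in \<open>t\<close>, from a short real interval to the
  half-plane; then in \<open>m\<close>, from \<open>0 < Re m < 1\<close> to all non-integers, a
  connected set because only countably many points are removed.\<close>

lemma tricomi_U_eq_Kummer_Psi_nonint:
  assumes nu: "Re \<nu> > 0" and t: "Re t > 0" and m: "m \<notin> \<int>"
  shows "tricomi_U \<nu> m t = Kummer_Psi_nonint \<nu> m t"
proof -
  have notI: "m \<in> - \<int>" if "0 < Re m" "Re m < 1" for m :: complex
    using that by (auto elim!: Ints_cases)
  have strip: "tricomi_U \<nu> m t = Kummer_Psi_nonint \<nu> m t" if m: "0 < Re m" "Re m < 1" for m
  proof -
    obtain \<delta> where d: "\<delta> > 0" "\<And>t. 0 < t \<Longrightarrow> t \<le> \<delta> \<Longrightarrow> tricomi_U \<nu> m (of_real t) = Kummer_Psi_nonint \<nu> m (of_real t)"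
      using tricomi_U_eq_Kummer_Psi_nonint_near_0[OF nu m] by blast
    have sub: "{t. Re t > 0} \<subseteq> - \<real>\<^sub>\<le>\<^sub>0" by (auto simp: complex_nonpos_Reals_iff)
    have "tricomi_U \<nu> m t - Kummer_Psi_nonint \<nu> m t = 0"
    proof (rule analytic_continuation[where f="\<lambda>t. tricomi_U \<nu> m t - Kummer_Psi_nonint \<nu> m t"])
      show "(\<lambda>t. tricomi_U \<nu> m t - Kummer_Psi_nonint \<nu> m t) holomorphic_on {t. Re t > 0}"
        using tricomi_U_holomorphic[OF nu] holomorphic_on_subset[OF Kummer_Psi_nonint_holomorphic sub] notI[OF m]
        by (intro holomorphic_intros) auto
      show "open {t. Re t > 0}" "connected {t. Re t > 0}"
        by (auto intro: open_halfspace_Re_gt convex_connected convex_halfspace_Re_gt)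
      show "of_real ` {0<..\<delta>} \<subseteq> {t. Re t > 0}" "of_real \<delta> \<in> {t. Re t > 0}" "t \<in> {t. Re t > 0}"
        using d t by auto
      show "complex_of_real \<delta> islimpt of_real ` {0<..\<delta>}"
        unfolding islimpt_approachable
      proof (intro allI impI)
        fix e :: real assume e: "e > 0"
        define x where "x = \<delta> - min (\<delta> / 2) (e / 2)"
        have x: "x \<in> {0<..\<delta>}" "x \<noteq> \<delta>" "\<bar>x - \<delta>\<bar> < e"
          using d(1) e by (auto simp: x_def min_def)
        have "dist (complex_of_real x) (of_real \<delta>) < e"
          using x(3) by (simp add: dist_norm flip: of_real_diff)
        then show "\<exists>x'\<in>of_real ` {0<..\<delta>}. x' \<noteq> complex_of_real \<delta> \<and> dist x' (of_real \<delta>) < e"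
          using x by (intro bexI[of _ "of_real x"]) auto
      qed
      show "tricomi_U \<nu> m z - Kummer_Psi_nonint \<nu> m z = 0" if "z \<in> of_real ` {0<..\<delta>}" for z
        using that d(2) by auto
    qed
    then show ?thesis by simp
  qed
  have t0: "t \<noteq> 0" using t by auto
  have "connected (UNIV - \<int> :: complex set)"
    by (intro connected_open_diff_countable) (auto simp: Ints_def)
  then have con: "connected (- \<int> :: complex set)" by (simp add: Compl_eq_Diff_UNIV)
  show ?thesis
  proof (rule analytic_continuation_open[where s="{m. 0 < Re m} \<inter> {m. Re m < 1}" and s'="- \<int>"
        and f="\<lambda>m. tricomi_U \<nu> m t" and g="\<lambda>m. Kummer_Psi_nonint \<nu> m t"])
    show "{m. 0 < Re m} \<inter> {m. Re m < 1} \<noteq> {}"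
    proof -
      have "1 / 2 \<in> {m. 0 < Re m} \<inter> {m. Re m < 1}" by simp
      then show ?thesis by blast
    qed
    show "(\<lambda>m. tricomi_U \<nu> m t) holomorphic_on - \<int>"
      using tricomi_U_index_holomorphic[OF nu t] holomorphic_on_subset by blast
  qed (use strip notI m con Kummer_Psi_nonint_index_holomorphic[OF t0] in
      \<open>auto intro!: open_Int open_halfspace_Re_gt open_halfspace_Re_lt\<close>)
qed

section \<open>Holomorphy and growth of Tricomi's function\<close>

abbreviation strip :: "complex set" where
  "strip \<equiv> {m. 0 < Re m \<and> Re m < 2}"

lemma open_strip: "open strip"
  using open_Int[OF open_halfspace_Re_gt open_halfspace_Re_lt, of 0 2] by (simp add: Int_def)

lemma strip_Ints_iff: "m \<in> strip \<Longrightarrow> m \<in> \<int> \<longleftrightarrow> m = 1"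
  by (auto elim!: Ints_cases)

lemma Kummer_Psi_strip_eq: "m \<in> strip \<Longrightarrow> m \<noteq> 1 \<Longrightarrow> Kummer_Psi \<nu> m t = Kummer_Psi_nonint \<nu> m t"
  using strip_Ints_iff by (auto simp: Kummer_Psi_def)

text \<open>By the reflection formula the non-integer expression is
  \<open>pi * P m / sin (pi * m)\<close> with \<open>P\<close> holomorphic on the strip. Since
  \<open>P 1 = 0\<close>, the simple zero of the sine at \<open>1\<close> is cancelled, and the
  limit defining \<open>Kummer_Psi\<close> at \<open>m = 1\<close> exists.\<close>

lemma Kummer_Psi_index_holomorphic:
  assumes t: "t \<noteq> 0"
  shows "(\<lambda>m. Kummer_Psi \<nu> m t) holomorphic_on strip"
proof -
  define P where "P m = rGamma m * rGamma (\<nu> + 1 - m) * Kummer_Phi \<nu> m t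
      - rGamma (2 - m) * rGamma \<nu> * t powr (1 - m) * Kummer_Phi (\<nu> + 1 - m) (2 - m) t" for m
  define s where "s m = sin (of_real pi * m)" for m :: complex
  \<comment> \<open>\<open>Q\<close> and \<open>T\<close> are \<open>P\<close> and \<open>s\<close>
    with the zero at \<open>1\<close> divided out; the derivative fills the gap. \<open>T\<close>
    has no zero in the strip, so \<open>R\<close> is holomorphic there.\<close>
  define Q where "Q m = (if m = 1 then deriv P 1 else (P m - P 1) / (m - 1))" for m
  define T where "T m = (if m = 1 then deriv s 1 else (s m - s 1) / (m - 1))" for m
  define R where "R m = of_real pi * Q m / T m" for m
  have n: "m \<notin> \<int>\<^sub>\<le>\<^sub>0" "2 - m \<notin> \<int>\<^sub>\<le>\<^sub>0" if "m \<in> strip" for m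
    using that by (auto intro!: Re_pos_imp_notin_nonpos_Ints)
  have P1: "P 1 = 0" using t by (simp add: P_def)
  have s1: "s 1 = 0" by (simp add: s_def)
  have one: "1 \<in> interior strip" using open_strip by (simp add: interior_open)
  have "P holomorphic_on strip"
    unfolding P_def using n t open_strip by (intro holomorphic_intros Kummer_Phi_holomorphic) auto
  then have Q: "Q holomorphic_on strip"
    unfolding Q_def by (rule pole_lemma[OF _ one])
  have "s holomorphic_on strip" unfolding s_def by (intro holomorphic_intros)
  then have T: "T holomorphic_on strip"
    unfolding T_def by (rule pole_lemma[OF _ one])
  have "deriv s 1 = - of_real pi"
    unfolding s_def by (rule DERIV_imp_deriv) (auto intro!: derivative_eq_intros)
  then have T0: "T m \<noteq> 0" if "m \<in> strip" for m
  proof (cases "m = 1")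
    case False
    have "s m \<noteq> 0"
    proof
      assume "s m = 0"
      then obtain k where "m = of_int k"
        unfolding s_def sin_eq_0 by (auto simp: mult.commute)
      then show False using that False strip_Ints_iff by auto
    qed
    then show ?thesis using False s1 by (simp add: T_def)
  qed (simp add: T_def)
  have R: "R holomorphic_on strip"
    unfolding R_def using T0 by (intro holomorphic_intros Q T)
  have eq: "Kummer_Psi_nonint \<nu> m t = R m" if m: "m \<in> strip" "m \<noteq> 1" for m
  proof -
    have R': "R m = of_real pi * P m / s m"
      using m by (simp add: R_def Q_def T_def P1 s1)
    have g: "Gamma m \<noteq> 0" "Gamma (2 - m) \<noteq> 0" using n[OF m(1)] by (auto simp: Gamma_eq_zero_iff)
    have 1: "Gamma (1 - m) = rGamma m * (of_real pi / s m)"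
    proof -
      have "Gamma (1 - m) = (Gamma m * Gamma (1 - m)) / Gamma m" using g by simp
      then show ?thesis
        unfolding Gamma_reflection_complex by (simp add: s_def rGamma_inverse_Gamma divide_inverse mult_ac)
    qed
    have "Gamma (m - 1) * Gamma (2 - m) = of_real pi / sin (of_real pi * (m - 1))"
      using Gamma_reflection_complex[of "m - 1"] by simp
    also have "sin (of_real pi * (m - 1)) = - s m"
      by (simp add: s_def right_diff_distrib sin_diff)
    finally have r: "Gamma (m - 1) * Gamma (2 - m) = of_real pi / - s m" .
    have 2: "Gamma (m - 1) = - rGamma (2 - m) * (of_real pi / s m)"
    proof -
      have "Gamma (m - 1) = (Gamma (m - 1) * Gamma (2 - m)) / Gamma (2 - m)" using g by simp
      then show ?thesis
        unfolding r by (simp add: rGamma_inverse_Gamma divide_inverse mult_ac)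
    qed
    show ?thesis
      unfolding R' P_def Kummer_Psi_nonint_def 1 2 by (simp add: field_simps diff_divide_distrib)
  qed
  have "isCont R 1"
    using holomorphic_on_imp_continuous_on[OF R] open_strip by (simp add: continuous_on_eq_continuous_at)
  then have "(R \<longlongrightarrow> R 1) (at 1)" by (simp add: isCont_def)
  then have "((\<lambda>m. Kummer_Psi_nonint \<nu> m t) \<longlongrightarrow> R 1) (at 1)"
    by (rule Lim_transform_within_open[OF _ open_strip]) (auto simp: eq)
  then have K1: "Kummer_Psi \<nu> 1 t = R 1"
    unfolding Kummer_Psi_def by (simp add: tendsto_Lim)
  show ?thesis
    by (rule holomorphic_transform[OF R]) (use K1 eq Kummer_Psi_strip_eq in metis)
qed

text \<open>Bounds at the exceptional parameter \<open>m = 1\<close> are thus obtained from a circle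
  of non-integer parameters, where explicit formulas are available.\<close>

lemma Kummer_Psi_maximum_modulus:
  assumes "cball c r \<subseteq> strip" and "t \<noteq> 0"
    and "\<And>m. m \<in> sphere c r \<Longrightarrow> norm (Kummer_Psi \<nu> m t) \<le> B" and "m \<in> cball c r"
  shows "norm (Kummer_Psi \<nu> m t) \<le> B"
proof (rule maximum_modulus_frontier[of "\<lambda>m. Kummer_Psi \<nu> m t" "cball c r"])
  have hol: "(\<lambda>m. Kummer_Psi \<nu> m t) holomorphic_on cball c r"
    using Kummer_Psi_index_holomorphic[OF assms(2)] assms(1) holomorphic_on_subset by blast
  then show "(\<lambda>m. Kummer_Psi \<nu> m t) holomorphic_on interior (cball c r)"
    using interior_subset holomorphic_on_subset by blast
  show "continuous_on (closure (cball c r)) (\<lambda>m. Kummer_Psi \<nu> m t)"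
    using holomorphic_on_imp_continuous_on[OF hol] by simp
qed (use assms in auto)

lemma norm_powr_le:
  assumes "t \<noteq> 0"
  shows "norm (t powr w) \<le> exp (\<bar>Im w\<bar> * pi) * norm t powr Re w"
proof -
  have "\<bar>Im (Ln t)\<bar> \<le> pi" using Im_Ln_le_pi[OF assms] mpi_less_Im_Ln[OF assms] by linarith
  then have "- (Im w * Im (Ln t)) \<le> \<bar>Im w\<bar> * pi"
    by (intro order_trans[OF abs_ge_minus_self]) (auto simp: abs_mult intro!: mult_left_mono)
  moreover have "norm (t powr w) = exp (Re w * ln (norm t) + - (Im w * Im (Ln t)))"
    using assms by (simp add: powr_def)
  moreover have "norm t powr Re w = exp (Re w * ln (norm t))"
    using assms by (simp add: powr_def)
  ultimately show ?thesis by (simp add: add.commute flip: exp_add)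
qed

lemma compact_norm_bound:
  fixes f :: "complex \<Rightarrow> complex"
  assumes "compact K" and "f holomorphic_on K"
  obtains C where "C \<ge> 0" and "\<And>m. m \<in> K \<Longrightarrow> norm (f m) \<le> C"
proof -
  have "bounded (f ` K)"
    using assms compact_continuous_image compact_imp_bounded holomorphic_on_imp_continuous_on by blast
  then obtain C where "\<And>m. m \<in> K \<Longrightarrow> norm (f m) \<le> C" by (auto simp: bounded_iff)
  then have "\<And>m. m \<in> K \<Longrightarrow> norm (f m) \<le> max C 0" by fastforce
  then show ?thesis by (rule that[rotated]) auto
qed

text \<open>The two terms of the definition are estimated separately. Compactness of
  \<open>K\<close> away from the integers bounds the Gamma factors and both Kummer series
  uniformly.\<close>

lemma Kummer_Psi_nonint_bound_small:
  assumes K: "compact K" "K \<subseteq> - \<int>"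
  obtains C where "C \<ge> 0"
    and "\<And>m t. m \<in> K \<Longrightarrow> t \<noteq> 0 \<Longrightarrow> norm t \<le> R \<Longrightarrow> norm (Kummer_Psi_nonint \<nu> m t) \<le> C * (1 + norm t powr (1 - Re m))"
proof -
  have n: "m \<notin> \<int>\<^sub>\<le>\<^sub>0" "1 - m \<notin> \<int>\<^sub>\<le>\<^sub>0" "m - 1 \<notin> \<int>\<^sub>\<le>\<^sub>0" "2 - m \<notin> \<int>\<^sub>\<le>\<^sub>0" if "m \<in> - \<int>" for m :: complex
    using that by (auto intro!: notin_Ints_imp_notin_nonpos_Ints simp: Ints_diff_left_iff
        dest: Ints_add[of "m - 1" 1])
  have K2: "compact ((\<lambda>m. 2 - m) ` K)" "(\<lambda>m. 2 - m) ` K \<inter> \<int>\<^sub>\<le>\<^sub>0 = {}"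
    using K n by (auto intro!: compact_continuous_image continuous_intros)
  obtain d2 where d2': "d2 > 0" "\<And>z k. z \<in> (\<lambda>m. 2 - m) ` K \<Longrightarrow> d2 \<le> norm (z + of_nat k)"
    using compact_avoids_nonpos_Ints[OF K2] by metis
  have d2: "d2 > 0" "\<And>m k. m \<in> K \<Longrightarrow> d2 \<le> norm (2 - m + of_nat k)"
    using d2'(1) d2'(2)[OF imageI] by auto
  have K1: "K \<inter> \<int>\<^sub>\<le>\<^sub>0 = {}" using K n by auto
  obtain d1 where d1: "d1 > 0" "\<And>m k. m \<in> K \<Longrightarrow> d1 \<le> norm (m + of_nat k)"
    using compact_avoids_nonpos_Ints[OF K(1) K1] by metis
  obtain B1 where B1: "B1 \<ge> 0" "\<And>m. m \<in> K \<Longrightarrow> norm (\<nu> - m) \<le> B1"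
    by (rule compact_norm_bound[OF K(1), of "\<lambda>m. \<nu> - m"]) (auto intro!: holomorphic_intros)
  obtain A1 where A1: "A1 \<ge> 0" "\<And>m. m \<in> K \<Longrightarrow> norm (Gamma (1 - m) * rGamma (\<nu> + 1 - m)) \<le> A1"
    by (rule compact_norm_bound[OF K(1), of "\<lambda>m. Gamma (1 - m) * rGamma (\<nu> + 1 - m)"])
       (use K n in \<open>auto intro!: holomorphic_intros\<close>)
  obtain A2 where A2: "A2 \<ge> 0" "\<And>m. m \<in> K \<Longrightarrow> norm (Gamma (m - 1) * rGamma \<nu>) \<le> A2"
    by (rule compact_norm_bound[OF K(1), of "\<lambda>m. Gamma (m - 1) * rGamma \<nu>"])
       (use K n in \<open>auto intro!: holomorphic_intros\<close>)
  obtain B3 where B3: "B3 \<ge> 0" "\<And>m. m \<in> K \<Longrightarrow> norm (1 - m) \<le> B3"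
    by (rule compact_norm_bound[OF K(1), of "\<lambda>m. 1 - m"]) (auto intro!: holomorphic_intros)
  define E1 where "E1 = exp ((1 + B1 / d1) * R)"
  define E2 where "E2 = exp ((1 + norm (\<nu> - 1) / d2) * R)"
  define C where "C = A1 * E1 + A2 * E2 * exp (B3 * pi)"
  have pos: "E1 > 0" "E2 > 0" by (auto simp: E1_def E2_def)
  have "C \<ge> 0" using A1(1) A2(1) pos by (simp add: C_def)
  moreover have "norm (Kummer_Psi_nonint \<nu> m t) \<le> C * (1 + norm t powr (1 - Re m))"
    if m: "m \<in> K" and t: "t \<noteq> 0" "norm t \<le> R" for m t
  proof -
    have p1: "norm (Kummer_Phi \<nu> m t) \<le> E1"
    proof -
      have "norm (\<nu> - m) / d1 \<le> B1 / d1" using B1(2)[OF m] d1(1) by (intro divide_right_mono) auto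
      then show ?thesis unfolding E1_def by (rule norm_Kummer_Phi_le[OF d1(1) d1(2)[OF m] _ t(2)])
    qed
    have p2: "norm (Kummer_Phi (\<nu> + 1 - m) (2 - m) t) \<le> E2"
    proof -
      have "norm (\<nu> + 1 - m - (2 - m)) / d2 \<le> norm (\<nu> - 1) / d2" by simp
      then show ?thesis unfolding E2_def by (rule norm_Kummer_Phi_le[OF d2(1) d2(2)[OF m] _ t(2)])
    qed
    have "norm (t powr (1 - m)) \<le> exp (\<bar>Im (1 - m)\<bar> * pi) * norm t powr Re (1 - m)"
      by (rule norm_powr_le[OF t(1)])
    also have "\<dots> \<le> exp (B3 * pi) * norm t powr (1 - Re m)"
      using B3(2)[OF m] abs_Im_le_cmod[of "1 - m"] by (auto intro!: mult_right_mono)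
    finally have p3: "norm (t powr (1 - m)) \<le> exp (B3 * pi) * norm t powr (1 - Re m)" .
    have "norm (Gamma (1 - m) * rGamma (\<nu> + 1 - m) * Kummer_Phi \<nu> m t) \<le> A1 * E1"
      unfolding norm_mult[of _ "Kummer_Phi \<nu> m t"] using A1 m p1 by (intro mult_mono) auto
    moreover have "norm (Gamma (m - 1) * rGamma \<nu> * t powr (1 - m) * Kummer_Phi (\<nu> + 1 - m) (2 - m) t)
        \<le> A2 * (exp (B3 * pi) * norm t powr (1 - Re m)) * E2"
      unfolding norm_mult[of _ "Kummer_Phi (\<nu> + 1 - m) (2 - m) t"] norm_mult[of _ "t powr (1 - m)"]
      using A2 m p2 p3 by (intro mult_mono) auto
    ultimately have "norm (Kummer_Psi_nonint \<nu> m t) \<le> A1 * E1 * 1 + A2 * E2 * exp (B3 * pi) * norm t powr (1 - Re m)"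
      unfolding Kummer_Psi_nonint_def by (intro order_trans[OF norm_triangle_ineq] add_mono) (auto simp: mult_ac)
    also have "\<dots> \<le> C * 1 + C * norm t powr (1 - Re m)"
      using A1(1) A2(1) pos by (intro add_mono mult_right_mono) (auto simp: C_def)
    finally show ?thesis by (simp add: algebra_simps)
  qed
  ultimately show ?thesis by (rule that)
qed

text \<open>At \<open>m = 1\<close> no formula in \<open>t\<close> is at hand; the function is a
  locally uniform limit of \<open>Kummer_Psi \<nu> (q n)\<close> with \<open>q n\<close> tending to
  \<open>1\<close>, by a Lipschitz estimate in \<open>m\<close>.\<close>

lemma Kummer_Psi_holomorphic:
  assumes m: "m \<in> strip"
  shows "Kummer_Psi \<nu> m holomorphic_on - \<real>\<^sub>\<le>\<^sub>0"
proof (cases "m = 1")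
  case False
  then have "Kummer_Psi_nonint \<nu> m holomorphic_on - \<real>\<^sub>\<le>\<^sub>0"
    using m strip_Ints_iff by (intro Kummer_Psi_nonint_holomorphic) auto
  then show ?thesis
    by (rule holomorphic_transform) (use False m in \<open>auto simp: Kummer_Psi_strip_eq\<close>)
next
  case True
  \<comment> \<open>The offset \<open>4\<close> puts every \<open>q n\<close> into the disc of
    radius \<open>1 / 4\<close> on which the Lipschitz estimate holds.\<close>
  define q where "q n = (1 + of_real (1 / (real n + 4)) :: complex)" for n
  have qs: "q n \<in> strip" "q n \<noteq> 1" for n
    by (auto simp: q_def field_simps simp del: of_real_divide)
  have op: "open (- \<real>\<^sub>\<le>\<^sub>0 :: complex set)" by (simp add: open_Compl)
  have "Kummer_Psi \<nu> 1 holomorphic_on - \<real>\<^sub>\<le>\<^sub>0"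
  proof (rule holomorphic_uniform_sequence[OF op, of "\<lambda>n. Kummer_Psi \<nu> (q n)"])
    show "Kummer_Psi \<nu> (q n) holomorphic_on - \<real>\<^sub>\<le>\<^sub>0" for n
    proof -
      have "Kummer_Psi_nonint \<nu> (q n) holomorphic_on - \<real>\<^sub>\<le>\<^sub>0"
        using qs[of n] strip_Ints_iff by (intro Kummer_Psi_nonint_holomorphic) auto
      then show ?thesis
        by (rule holomorphic_transform) (simp only: Kummer_Psi_strip_eq[OF qs])
    qed
    fix t :: complex assume "t \<in> - \<real>\<^sub>\<le>\<^sub>0"
    then obtain d where d: "d > 0" "cball t d \<subseteq> - \<real>\<^sub>\<le>\<^sub>0" using op open_contains_cball by blast
    have cs: "cball 1 (1/2) \<subseteq> strip"
    proof
      fix z :: complex assume "z \<in> cball 1 (1/2)"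
      then have "\<bar>1 - Re z\<bar> \<le> 1/2" using abs_Re_le_cmod[of "1 - z"] by (auto simp: dist_norm)
      then have "0 < Re z" "Re z < 2" by linarith+
      then show "z \<in> strip" by simp
    qed
    have sp: "sphere 1 (1/2) \<subseteq> (- \<int> :: complex set)"
    proof
      fix z :: complex assume z: "z \<in> sphere 1 (1/2)"
      then have "z \<in> strip" using cs sphere_cball[of 1 "1/2"] by blast
      moreover have "z \<noteq> 1" using z by auto
      ultimately show "z \<in> - \<int>" using strip_Ints_iff by auto
    qed
    obtain C where C: "C \<ge> 0" "\<And>m u. m \<in> sphere 1 (1/2) \<Longrightarrow> u \<noteq> 0 \<Longrightarrow> norm u \<le> norm t + d \<Longrightarrow>
        norm (Kummer_Psi_nonint \<nu> m u) \<le> C * (1 + norm u powr (1 - Re m))"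
      using Kummer_Psi_nonint_bound_small[OF compact_sphere sp] by blast
    have "(0::complex) \<in> \<real>\<^sub>\<le>\<^sub>0" by simp
    then have z0: "0 \<notin> cball t d" using d by blast
    then obtain e where e: "e > 0" "\<And>u. u \<in> cball t d \<Longrightarrow> e \<le> norm u"
      using separate_point_closed[of "cball t d" 0] by (auto simp: dist_norm)
    \<comment> \<open>On the strip the exponent \<open>1 - Re m\<close> lies between
      \<open>- 1\<close> and \<open>1\<close>; the two summands handle \<open>norm u <= 1\<close>
      and \<open>norm u > 1\<close>.\<close>
    define B where "B = C * (1 + (e powr (- 1) + (norm t + d + 1) powr 1))"
    have "norm (Kummer_Psi \<nu> m u) \<le> B" if u: "u \<in> cball t d" and m: "m \<in> sphere 1 (1/2)" for u m
    proof -
      have "m \<in> strip" using m cs sphere_cball[of 1 "1/2"] by blast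
      moreover have "m \<noteq> 1" using m by auto
      ultimately have m': "m \<in> strip" "m \<noteq> 1" .
      have un: "norm u \<le> norm t + d" using u norm_triangle_ineq[of t "u - t"] by (auto simp: dist_norm norm_minus_commute)
      have u0: "u \<noteq> 0" using u z0 by metis
      have "norm u powr (1 - Re m) \<le> e powr (- 1) + (norm t + d + 1) powr 1"
      proof (cases "norm u \<le> 1")
        case True
        have "norm u powr (1 - Re m) \<le> norm u powr (- 1)"
          using True u0 m' by (intro powr_mono') auto
        also have "\<dots> \<le> e powr (- 1)"
          using e u by (intro powr_mono2') auto
        finally show ?thesis using d by (simp add: add_increasing2)
      next
        case False
        have "norm u powr (1 - Re m) \<le> norm u powr 1"
          using False m' by (intro powr_mono) auto
        also have "\<dots> \<le> (norm t + d + 1) powr 1"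
          using un by (intro powr_mono2) auto
        finally show ?thesis by (simp add: add_increasing)
      qed
      then show ?thesis
        unfolding Kummer_Psi_strip_eq[OF m'] B_def
        by (intro order_trans[OF C(2)[OF m u0 un]] mult_left_mono C(1)) auto
    qed
    then have B: "norm (Kummer_Psi \<nu> m u) \<le> B" if "u \<in> cball t d" "m \<in> cball 1 (1/2)" for u m
      using Kummer_Psi_maximum_modulus[OF cs] that z0 by metis
    \<comment> \<open>The bound \<open>B\<close> holds for \<open>m\<close> within
      \<open>1 / 2\<close> of \<open>1\<close>, leaving radius \<open>1 / 4\<close> for Cauchy's
      inequality around each point of the smaller disc; hence the factor \<open>4\<close>.\<close>
    have lip: "norm (Kummer_Psi \<nu> m u - Kummer_Psi \<nu> 1 u) \<le> 4 * B * norm (m - 1)"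
      if u: "u \<in> cball t d" and m: "m \<in> cball 1 (1/4)" for u m
    proof (rule field_differentiable_bound[OF convex_cball])
      have "u \<noteq> 0" using u z0 by metis
      note hol = Kummer_Psi_index_holomorphic[OF this, of \<nu>]
      fix z :: complex assume z: "z \<in> cball 1 (1/4)"
      have sub: "cball z (1/4) \<subseteq> cball 1 (1/2)"
      proof
        fix v assume "v \<in> cball z (1/4)"
        then show "v \<in> cball 1 (1/2)" using z dist_triangle[of 1 v z] by auto
      qed
      have "z \<in> cball z (1/4)" by simp
      then have "z \<in> strip" using sub cs by blast
      then show "((\<lambda>m. Kummer_Psi \<nu> m u) has_field_derivative deriv (\<lambda>m. Kummer_Psi \<nu> m u) z) (at z within cball 1 (1/4))"
        using hol open_strip holomorphic_derivI has_field_derivative_at_within by blast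
      have "norm ((deriv ^^ 1) (\<lambda>m. Kummer_Psi \<nu> m u) z) \<le> fact 1 * B / (1/4) ^ 1"
      proof (rule Cauchy_inequality)
        show "(\<lambda>m. Kummer_Psi \<nu> m u) holomorphic_on ball z (1/4)"
          using sub cs ball_subset_cball[of z "1/4"] by (intro holomorphic_on_subset[OF hol]) blast
        show "continuous_on (cball z (1/4)) (\<lambda>m. Kummer_Psi \<nu> m u)"
          using sub cs by (intro continuous_on_subset[OF holomorphic_on_imp_continuous_on[OF hol]]) blast
        show "norm (Kummer_Psi \<nu> v u) \<le> B" if "norm (z - v) = 1/4" for v
        proof -
          have "v \<in> cball z (1/4)" using that by (simp add: dist_norm)
          then show ?thesis using sub by (intro B[OF u]) blast
        qed
      qed auto
      then show "norm (deriv (\<lambda>m. Kummer_Psi \<nu> m u) z) \<le> 4 * B" by simp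
    qed (use m in auto)
    have "uniform_limit (cball t d) (\<lambda>n. Kummer_Psi \<nu> (q n)) (Kummer_Psi \<nu> 1) sequentially"
    proof (rule uniform_limitI)
      fix \<epsilon> :: real assume eps: "\<epsilon> > 0"
      have "(\<lambda>n. 4 * B * (1 / (real n + 4))) \<longlonglongrightarrow> 0" by real_asymp
      then have "\<forall>\<^sub>F n in sequentially. 4 * B * (1 / (real n + 4)) < \<epsilon>"
        using eps by (rule order_tendstoD(2))
      then show "\<forall>\<^sub>F n in sequentially. \<forall>u\<in>cball t d. dist (Kummer_Psi \<nu> (q n) u) (Kummer_Psi \<nu> 1 u) < \<epsilon>"
      proof eventually_elim
        case (elim n)
        have nq: "norm (q n - 1) = 1 / (real n + 4)"
          unfolding q_def add_diff_cancel_left' norm_of_real by simp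
        moreover have "1 / (real n + 4) \<le> 1 / 4" by (intro divide_left_mono) auto
        ultimately have "q n \<in> cball 1 (1/4)" by (simp add: dist_norm norm_minus_commute[of 1])
        show ?case
        proof
          fix u assume "u \<in> cball t d"
          from lip[OF this \<open>q n \<in> cball 1 (1/4)\<close>] show "dist (Kummer_Psi \<nu> (q n) u) (Kummer_Psi \<nu> 1 u) < \<epsilon>"
            using elim by (simp add: dist_norm nq)
        qed
      qed
    qed
    then show "\<exists>d>0. cball t d \<subseteq> - \<real>\<^sub>\<le>\<^sub>0 \<and> uniform_limit (cball t d) (\<lambda>n. Kummer_Psi \<nu> (q n)) (Kummer_Psi \<nu> 1) sequentially"
      using d by blast
  qed
  then show ?thesis using True by simp
qed

text \<open>For \<open>Re \<nu> > 1\<close> the down relation replaces \<open>m\<close> by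
  \<open>m - 1\<close>, where the integral is uniformly bounded. Below that, each step of the
  recurrence in \<open>\<nu>\<close> costs one power of \<open>norm t\<close>.\<close>

lemma Kummer_Psi_nonint_bound_large:
  assumes K: "compact K" "K \<subseteq> - \<int>" "\<And>m. m \<in> K \<Longrightarrow> Re m < 2"
    and nu: "Re \<nu> > 1 - real n"
  shows "\<exists>C. \<forall>m\<in>K. \<forall>t. Re t > 0 \<longrightarrow> norm t \<ge> 1 \<longrightarrow> norm (Kummer_Psi_nonint \<nu> m t) \<le> C * norm t ^ n"
  using nu
proof (induction n arbitrary: \<nu> rule: less_induct)
  case (less n)
  show ?case
  proof (cases "Re \<nu> > 1")
    case True
    \<comment> \<open>Compactness turns \<open>Re m < 2\<close> into a uniform gap, which is what
      \<open>tricomi_U_bound\<close> needs at \<open>m - 1\<close>.\<close>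
    obtain d where d: "d > 0" "\<And>m. m \<in> K \<Longrightarrow> Re m \<le> 2 - d"
    proof (cases "K = {}")
      case False
      obtain m0 where "m0 \<in> K" "\<And>m. m \<in> K \<Longrightarrow> Re m \<le> Re m0"
        using continuous_attains_sup[OF K(1) False continuous_on_Re[OF continuous_on_id]] by auto
      then show ?thesis using that[of "2 - Re m0"] K(3) by auto
    qed (use that[of 1] in auto)
    obtain B where B: "B \<ge> 0" "\<And>m. m \<in> K \<Longrightarrow> norm (\<nu> - m + 1) \<le> B"
      by (rule compact_norm_bound[OF K(1), of "\<lambda>m. \<nu> - m + 1"]) (auto intro!: holomorphic_intros)
    obtain C1 where C1: "\<And>m t. Re m \<le> 1 - d \<Longrightarrow> Re t > 0 \<Longrightarrow> norm (tricomi_U (\<nu> - 1) m t) \<le> C1"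
      using tricomi_U_bound[of "\<nu> - 1" d] d True by auto
    obtain C2 where C2: "\<And>m t. Re m \<le> 1 - d \<Longrightarrow> Re t > 0 \<Longrightarrow> norm (tricomi_U \<nu> m t) \<le> C2"
      using tricomi_U_bound[of \<nu> d] d True by auto
    show ?thesis
    proof (intro exI[of _ "C1 + B * C2"] ballI allI impI)
      fix m t assume m: "m \<in> K" and t: "Re t > 0" "norm t \<ge> 1"
      have "norm t * norm (tricomi_U \<nu> m t) = norm (tricomi_U (\<nu> - 1) (m - 1) t - (\<nu> - m + 1) * tricomi_U \<nu> (m - 1) t)"
        unfolding tricomi_U_down[OF True t(1), symmetric] norm_mult ..
      also have "\<dots> \<le> norm (tricomi_U (\<nu> - 1) (m - 1) t) + norm (\<nu> - m + 1) * norm (tricomi_U \<nu> (m - 1) t)"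
        unfolding norm_mult[symmetric] by (rule norm_triangle_ineq4)
      also have "\<dots> \<le> C1 + B * C2"
        using d(2)[OF m] t B m by (intro add_mono mult_mono C1 C2) auto
      finally have *: "norm t * norm (tricomi_U \<nu> m t) \<le> C1 + B * C2" .
      moreover have "1 * norm (tricomi_U \<nu> m t) \<le> norm t * norm (tricomi_U \<nu> m t)"
        using t by (intro mult_right_mono) auto
      ultimately have "norm (tricomi_U \<nu> m t) \<le> C1 + B * C2" by simp
      moreover have "(C1 + B * C2) * 1 \<le> (C1 + B * C2) * norm t ^ n"
        using t * by (intro mult_left_mono) (auto intro: order_trans[OF _ *])
      ultimately show "norm (Kummer_Psi_nonint \<nu> m t) \<le> (C1 + B * C2) * norm t ^ n"
        using tricomi_U_eq_Kummer_Psi_nonint[of \<nu> t m] True t K(2) m by auto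
    qed
  next
    case False
    then obtain n' where n': "n = Suc n'" using less.prems by (cases n) auto
    obtain C1 where C1: "\<And>m t. m \<in> K \<Longrightarrow> Re t > 0 \<Longrightarrow> norm t \<ge> 1 \<Longrightarrow> norm (Kummer_Psi_nonint (\<nu> + 1) m t) \<le> C1 * norm t ^ n'"
      using less.IH[of n' "\<nu> + 1"] less.prems n' by auto
    obtain C2 where C2: "\<And>m t. m \<in> K \<Longrightarrow> Re t > 0 \<Longrightarrow> norm t \<ge> 1 \<Longrightarrow> norm (Kummer_Psi_nonint (\<nu> + 2) m t) \<le> C2 * norm t ^ n'"
      using less.IH[of n' "\<nu> + 2"] less.prems n' by auto
    obtain B1 where B1: "B1 \<ge> 0" "\<And>m. m \<in> K \<Longrightarrow> norm (2 * (\<nu> + 1) - m) \<le> B1"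
      by (rule compact_norm_bound[OF K(1), of "\<lambda>m. 2 * (\<nu> + 1) - m"]) (auto intro!: holomorphic_intros)
    obtain B2 where B2: "B2 \<ge> 0" "\<And>m. m \<in> K \<Longrightarrow> norm ((\<nu> + 1) * (\<nu> + 1 - m + 1)) \<le> B2"
      by (rule compact_norm_bound[OF K(1), of "\<lambda>m. (\<nu> + 1) * (\<nu> + 1 - m + 1)"]) (auto intro!: holomorphic_intros)
    show ?thesis
    proof (intro exI[of _ "(1 + B1) * C1 + B2 * C2"] ballI allI impI)
      fix m t assume m: "m \<in> K" and t: "Re t > 0" "norm t \<ge> 1"
      have t0: "t \<noteq> 0" using t by auto
      have mI: "m \<notin> \<int>" using K m by auto
      have "norm (t + 2 * (\<nu> + 1) - m) \<le> norm t + norm (2 * (\<nu> + 1) - m)"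
        using norm_triangle_ineq[of t "2 * (\<nu> + 1) - m"] by (simp add: algebra_simps)
      also have "\<dots> \<le> norm t + B1 * norm t"
        using B1 m t mult_left_mono[of 1 "norm t" B1] by (intro add_left_mono) (auto intro: order_trans)
      finally have b1: "norm (t + 2 * (\<nu> + 1) - m) \<le> (1 + B1) * norm t" by (simp add: algebra_simps)
      have b2: "norm ((\<nu> + 1) * (\<nu> + 1 - m + 1)) \<le> B2 * norm t"
        using B2 m t mult_left_mono[of 1 "norm t" B2] by (auto intro: order_trans)
      have "Kummer_Psi_nonint \<nu> m t = (t + 2 * (\<nu> + 1) - m) * Kummer_Psi_nonint (\<nu> + 1) m t
          - ((\<nu> + 1) * (\<nu> + 1 - m + 1)) * Kummer_Psi_nonint (\<nu> + 2) m t"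
        using Kummer_Psi_nonint_lower[OF mI t0, of "\<nu> + 1"] by (simp add: add.assoc)
      then have "norm (Kummer_Psi_nonint \<nu> m t) \<le> norm (t + 2 * (\<nu> + 1) - m) * norm (Kummer_Psi_nonint (\<nu> + 1) m t)
          + norm ((\<nu> + 1) * (\<nu> + 1 - m + 1)) * norm (Kummer_Psi_nonint (\<nu> + 2) m t)"
        using norm_triangle_ineq4 by (metis norm_mult)
      also have "\<dots> \<le> ((1 + B1) * norm t) * (C1 * norm t ^ n') + (B2 * norm t) * (C2 * norm t ^ n')"
        using b1 b2 C1[OF m t] C2[OF m t] B1(1) B2(1) by (intro add_mono mult_mono) auto
      also have "\<dots> = ((1 + B1) * C1 + B2 * C2) * norm t ^ n"
        by (simp add: n' algebra_simps)
      finally show "norm (Kummer_Psi_nonint \<nu> m t) \<le> ((1 + B1) * C1 + B2 * C2) * norm t ^ n" .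
    qed
  qed
qed

text \<open>Joins the two regimes into one estimate, uniform in a disc of \<open>m\<close> that may
  contain \<open>1\<close> and valid up to the imaginary axis. The inequality
  \<open>\<eta> + 2 * c <= Re m\<close> reserves integrability of the kernel at
  \<open>0\<close>.\<close>

lemma Kummer_Psi_bound:
  assumes mu: "\<mu> \<in> strip"
  shows "\<exists>r>0. \<exists>c\<ge>0. \<exists>\<eta>>0. \<exists>C\<ge>0. \<exists>n. (\<forall>m\<in>cball \<mu> r. m \<in> strip \<and> \<eta> + 2 * c \<le> Re m) \<and>
    (\<forall>m\<in>cball \<mu> r. \<forall>t. Re t \<ge> 0 \<longrightarrow> t \<noteq> 0 \<longrightarrow>
       norm (Kummer_Psi \<nu> m t) \<le> C * (norm t powr (- c) + norm t ^ n))"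
proof -
  define \<rho> where "\<rho> = min (Re \<mu>) (2 - Re \<mu>)"
  have rho: "\<rho> > 0" using mu by (simp add: \<rho>_def)
  \<comment> \<open>The circle must miss \<open>1\<close>, the only integer in the strip; of two
    candidate radii at most one equals the distance to \<open>1\<close>.\<close>
  obtain r where r: "r > 0" "r \<le> \<rho> / 8" "r \<noteq> dist \<mu> 1"
  proof (cases "dist \<mu> 1 = \<rho> / 8")
    case True
    then show ?thesis using that[of "\<rho> / 10"] rho by auto
  next
    case False
    then show ?thesis using that[of "\<rho> / 8"] rho by auto
  qed
  \<comment> \<open>Makes \<open>c >= Re m - 1\<close> on the whole disc, so
    \<open>norm t powr (- c)\<close> dominates the singular term near \<open>0\<close>. It enters
    doubled above because \<open>t\<close> will be a multiple of \<open>x^2\<close>.\<close>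
  define c where "c = max 0 (Re \<mu> + r - 1)"
  define \<eta> where "\<eta> = \<rho> / 2"
  have c0: "c \<ge> 0" by (simp add: c_def)
  have Rem: "Re \<mu> - r \<le> Re m" "Re m \<le> Re \<mu> + r" if "m \<in> cball \<mu> r" for m
    using that abs_Re_le_cmod[of "\<mu> - m"] by (auto simp: dist_norm abs_le_iff)
  have cb: "m \<in> strip \<and> \<eta> + 2 * c \<le> Re m" if "m \<in> cball \<mu> r" for m
  proof -
    have "\<rho> \<le> Re \<mu>" "\<rho> \<le> 2 - Re \<mu>" by (auto simp: \<rho>_def)
    moreover have "c = 0 \<or> c = Re \<mu> + r - 1" by (auto simp: c_def)
    ultimately show ?thesis
      using Rem[OF that] r(2) rho unfolding \<eta>_def mem_Collect_eq by auto
  qed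
  have sp: "sphere \<mu> r \<subseteq> - \<int>"
  proof
    fix z assume z: "z \<in> sphere \<mu> r"
    then have "z \<noteq> 1" using r(3) by auto
    moreover have "z \<in> strip" using z cb by auto
    ultimately show "z \<in> - \<int>" using strip_Ints_iff by auto
  qed
  obtain n :: nat where n: "Re \<nu> > 1 - real n"
    using reals_Archimedean2[of "1 - Re \<nu>"] by (auto simp: algebra_simps)
  obtain C1 where C1: "C1 \<ge> 0" "\<And>m t. m \<in> sphere \<mu> r \<Longrightarrow> t \<noteq> 0 \<Longrightarrow> norm t \<le> 1 \<Longrightarrow>
      norm (Kummer_Psi_nonint \<nu> m t) \<le> C1 * (1 + norm t powr (1 - Re m))"
    using Kummer_Psi_nonint_bound_small[OF compact_sphere sp] by blast
  obtain C2 where C2: "\<And>m t. m \<in> sphere \<mu> r \<Longrightarrow> Re t > 0 \<Longrightarrow> norm t \<ge> 1 \<Longrightarrow>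
      norm (Kummer_Psi_nonint \<nu> m t) \<le> C2 * norm t ^ n"
    using Kummer_Psi_nonint_bound_large[OF compact_sphere sp _ n] cb by (metis (no_types, lifting) mem_Collect_eq sphere_cball subset_iff)
  define C where "C = 2 * C1 + max C2 0"
  have C: "C \<ge> 0" "2 * C1 \<le> C" "C2 \<le> C" using C1(1) by (auto simp: C_def)
  have half: "norm (Kummer_Psi_nonint \<nu> m t) \<le> C * (norm t powr (- c) + norm t ^ n)"
    if m: "m \<in> sphere \<mu> r" and t: "Re t > 0" for m t
  proof (cases "norm t \<le> 1")
    case True
    have t0: "t \<noteq> 0" using t by auto
    have "Re m \<le> c + 1" using Rem[of m] m by (auto simp: c_def)
    then have "norm t powr (1 - Re m) \<le> norm t powr (- c)"
      using True t0 by (intro powr_mono') auto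
    moreover have "norm t powr 0 \<le> norm t powr (- c)"
      using True t0 c0 by (intro powr_mono') auto
    ultimately have "C1 * (1 + norm t powr (1 - Re m)) \<le> C1 * (2 * norm t powr (- c))"
      using t0 by (intro mult_left_mono C1(1)) auto
    also have "\<dots> = (2 * C1) * norm t powr (- c)" by simp
    also have "\<dots> \<le> C * (norm t powr (- c) + norm t ^ n)"
      using C by (intro mult_mono) auto
    finally show ?thesis using C1(2)[OF m t0 True] by simp
  next
    case False
    have "C2 * norm t ^ n \<le> C * (norm t powr (- c) + norm t ^ n)"
      using C by (intro mult_mono) auto
    then show ?thesis using C2[OF m t] False by simp
  qed
  \<comment> \<open>The large-argument bound is known only for \<open>Re t > 0\<close>; the
    imaginary axis is reached by continuity along \<open>t + 1 / (k + 1)\<close>.\<close>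
  have sphere_bound: "norm (Kummer_Psi_nonint \<nu> m t) \<le> C * (norm t powr (- c) + norm t ^ n)"
    if m: "m \<in> sphere \<mu> r" and t: "Re t \<ge> 0" "t \<noteq> 0" for m t
  proof -
    define T where "T k = t + of_real (1 / (real k + 1))" for k
    have T: "T \<longlonglongrightarrow> t"
    proof -
      have "(\<lambda>k. 1 / (real k + 1)) \<longlonglongrightarrow> 0" by real_asymp
      then have "T \<longlonglongrightarrow> t + of_real 0" unfolding T_def by (intro tendsto_intros)
      then show ?thesis by simp
    qed
    have tn: "t \<notin> \<real>\<^sub>\<le>\<^sub>0" using t by (auto simp: complex_nonpos_Reals_iff complex_eq_iff)
    have "m \<notin> \<int>" using sp m by auto
    then have "isCont (Kummer_Psi_nonint \<nu> m) t"
      using DERIV_isCont Kummer_Psi_nonint_has_derivative tn by blast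
    then have l1: "(\<lambda>k. norm (Kummer_Psi_nonint \<nu> m (T k))) \<longlonglongrightarrow> norm (Kummer_Psi_nonint \<nu> m t)"
      using T by (intro tendsto_norm isCont_tendsto_compose[where g="Kummer_Psi_nonint \<nu> m"])
    have l2: "(\<lambda>k. C * (norm (T k) powr (- c) + norm (T k) ^ n)) \<longlonglongrightarrow> C * (norm t powr (- c) + norm t ^ n)"
      using t by (intro tendsto_intros T) auto
    have "norm (Kummer_Psi_nonint \<nu> m (T k)) \<le> C * (norm (T k) powr (- c) + norm (T k) ^ n)" for k
      using t by (intro half[OF m]) (auto simp: T_def add_nonneg_pos simp del: of_real_divide)
    then show ?thesis by (intro LIMSEQ_le[OF l1 l2]) blast
  qed
  have "\<forall>m\<in>cball \<mu> r. \<forall>t. Re t \<ge> 0 \<longrightarrow> t \<noteq> 0 \<longrightarrow>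
      norm (Kummer_Psi \<nu> m t) \<le> C * (norm t powr (- c) + norm t ^ n)"
  proof (intro ballI allI impI)
    fix m t assume m: "m \<in> cball \<mu> r" and t: "Re t \<ge> 0" "t \<noteq> 0"
    show "norm (Kummer_Psi \<nu> m t) \<le> C * (norm t powr (- c) + norm t ^ n)"
    proof (rule Kummer_Psi_maximum_modulus[OF _ t(2) _ m])
      show "cball \<mu> r \<subseteq> strip" using cb by blast
      fix z assume z: "z \<in> sphere \<mu> r"
      then have "z \<in> strip" "z \<noteq> 1" using cb r(3) by auto
      then show "norm (Kummer_Psi \<nu> z t) \<le> C * (norm t powr (- c) + norm t ^ n)"
        using sphere_bound[OF z t] by (simp add: Kummer_Psi_strip_eq)
    qed
  qed
  moreover have "\<forall>m\<in>cball \<mu> r. m \<in> strip \<and> \<eta> + 2 * c \<le> Re m"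
    using cb by (intro ballI)
  moreover have "\<eta> > 0" using rho by (simp add: \<eta>_def)
  ultimately show ?thesis
    using r(1) c0 C(1) by (intro exI[of _ r] exI[of _ c] exI[of _ \<eta>] exI[of _ C] exI[of _ n] conjI)
qed

section \<open>The Laplace transform of the kernel\<close>

lemma a_square_notin_nonpos_Reals:
  assumes "Re a \<ge> 0" and "a \<noteq> 0" and "x > 0"
  shows "a * (complex_of_real x)\<^sup>2 \<notin> \<real>\<^sub>\<le>\<^sub>0"
proof
  assume "a * (complex_of_real x)\<^sup>2 \<in> \<real>\<^sub>\<le>\<^sub>0"
  then have "Re (a * of_real (x\<^sup>2)) \<le> 0" "Im (a * of_real (x\<^sup>2)) = 0"
    by (auto simp: complex_nonpos_Reals_iff simp del: times_complex.sel)
  then show False using assms by (auto simp: complex_eq_iff mult_le_0_iff)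
qed

lemma continuous_on_Psi_kernel:
  assumes "m \<in> strip" and "Re a \<ge> 0" and "a \<noteq> 0"
  shows "continuous_on {0<..} (Psi_kernel a \<nu> m)"
proof -
  have "continuous_on {0<..} (\<lambda>x. Kummer_Psi \<nu> m (a * (of_real x)\<^sup>2))"
    by (rule continuous_on_compose2[OF holomorphic_on_imp_continuous_on[OF Kummer_Psi_holomorphic[OF assms(1)]]])
       (use a_square_notin_nonpos_Reals[OF assms(2,3)] in \<open>auto intro!: continuous_intros\<close>)
  then show ?thesis
    unfolding Psi_kernel_def by (intro continuous_intros continuous_on_of_real_powr) auto
qed

lemma continuous_on_laplace_integrand:
  assumes "m \<in> strip" and "Re a \<ge> 0" and "a \<noteq> 0"
  shows "continuous_on {0<..} (laplace_integrand a \<nu> m w)"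
  unfolding laplace_integrand_def
  by (intro continuous_intros continuous_on_Psi_kernel assms)

lemma laplace_integrand_index_holomorphic:
  assumes "a \<noteq> 0" and "x > 0"
  shows "(\<lambda>m. laplace_integrand a \<nu> m w x) holomorphic_on strip"
  unfolding laplace_integrand_def Psi_kernel_def using assms
  by (intro holomorphic_intros Kummer_Psi_index_holomorphic) auto

lemma laplace_integrand_holomorphic_param:
  assumes "m \<in> strip" and "x > 0"
  shows "(\<lambda>a. laplace_integrand a \<nu> m w x) holomorphic_on {a. Re a > 0}"
proof -
  have "(\<lambda>a. a * (complex_of_real x)\<^sup>2) holomorphic_on {a. Re a > 0}"
    by (intro holomorphic_intros)
  moreover have "(\<lambda>a. a * (complex_of_real x)\<^sup>2) ` {a. Re a > 0} \<subseteq> - \<real>\<^sub>\<le>\<^sub>0"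
  proof (intro image_subsetI ComplI)
    fix a :: complex assume "a \<in> {a. Re a > 0}" "a * (of_real x)\<^sup>2 \<in> \<real>\<^sub>\<le>\<^sub>0"
    moreover have "Re a \<ge> 0" "a \<noteq> 0" using calculation(1) by auto
    ultimately show False using a_square_notin_nonpos_Reals assms(2) by blast
  qed
  ultimately have "(\<lambda>a. Kummer_Psi \<nu> m (a * (of_real x)\<^sup>2)) holomorphic_on {a. Re a > 0}"
    using holomorphic_on_compose_gen[OF _ Kummer_Psi_holomorphic[OF assms(1)]] by (auto simp: o_def)
  then show ?thesis
    unfolding laplace_integrand_def Psi_kernel_def by (intro holomorphic_intros) auto
qed

lemma exp_linear_minus_square_le:
  fixes b c :: real
  assumes "b > 0"
  shows "exp (c * x - b * x\<^sup>2) \<le> exp ((c + 1)\<^sup>2 / (4 * b)) * exp (- (1 * x))"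
proof -
  \<comment> \<open>Completing the square with \<open>c + 1\<close> instead of \<open>c\<close>
    leaves a spare factor \<open>exp (- x)\<close>.\<close>
  have "0 \<le> (2 * b * x - (c + 1))\<^sup>2 / (4 * b)" using assms by simp
  also have "\<dots> = b * x\<^sup>2 - (c + 1) * x + (c + 1)\<^sup>2 / (4 * b)"
    using assms by (simp add: power2_eq_square field_simps)
  finally show ?thesis by (simp add: algebra_simps flip: exp_add)
qed

text \<open>One majorant uniform in \<open>m\<close>, \<open>a\<close> and \<open>w\<close> feeds
  all continuity and holomorphy statements about the transform. Decay comes from the Gaussian if
  \<open>Re a0 > 0\<close> and from \<open>exp (- w * x)\<close> otherwise; in the latter case the
  disc around \<open>a0\<close> can leave the half-plane, hence the side condition
  \<open>Re a >= 0\<close>.\<close>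

lemma laplace_integrand_dominated:
  fixes m0 a0 w0 \<nu> :: complex
  assumes m0: "m0 \<in> strip" and a0: "Re a0 \<ge> 0" "a0 \<noteq> 0" and aw: "Re a0 > 0 \<or> Re w0 > 0"
  shows "\<exists>r>0. \<exists>h. set_integrable lborel {0<..} h \<and> cball m0 r \<subseteq> strip \<and>
    (\<forall>a\<in>cball a0 r. a \<noteq> 0 \<and> (Re a0 > 0 \<longrightarrow> Re a > 0)) \<and> (\<forall>w\<in>cball w0 r. Re w0 > 0 \<longrightarrow> Re w > 0) \<and>
    (\<forall>m\<in>cball m0 r. \<forall>a\<in>cball a0 r. \<forall>w\<in>cball w0 r. \<forall>x>0. Re a \<ge> 0 \<longrightarrow>
       norm (laplace_integrand a \<nu> m w x) \<le> h x)"
proof -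
  obtain r1 c \<eta> C n where r1: "r1 > 0" and c: "c \<ge> 0" and eta: "\<eta> > 0" and C: "C \<ge> 0"
    and strip': "\<forall>m\<in>cball m0 r1. m \<in> strip \<and> \<eta> + 2 * c \<le> Re m"
    and Psi': "\<forall>m\<in>cball m0 r1. \<forall>t. Re t \<ge> 0 \<longrightarrow> t \<noteq> 0 \<longrightarrow>
       norm (Kummer_Psi \<nu> m t) \<le> C * (norm t powr (- c) + norm t ^ n)"
    using Kummer_Psi_bound[OF m0, of \<nu>] by (elim exE conjE) (rule that)
  note strip = bspec[OF strip'] and Psi = Psi'[rule_format]
  define ra where "ra = (if Re a0 > 0 then Re a0 / 2 else 1)"
  define rw where "rw = (if Re w0 > 0 then Re w0 / 2 else 1)"
  define r where "r = min r1 (min (norm a0 / 2) (min ra rw))"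
  have r: "r > 0" "r \<le> r1" "r \<le> norm a0 / 2" "r \<le> ra" "r \<le> rw"
    using r1 a0 by (auto simp: r_def ra_def rw_def)
  have Rew: "Re w \<ge> Re w0 - r" if "w \<in> cball w0 r" for w
    using that abs_Re_le_cmod[of "w0 - w"] by (auto simp: dist_norm abs_le_iff)
  have Rea: "Re a \<ge> Re a0 - r" if "a \<in> cball a0 r" for a
    using that abs_Re_le_cmod[of "a0 - a"] by (auto simp: dist_norm abs_le_iff)
  have na: "norm a \<ge> norm a0 / 2" "norm a \<le> 2 * norm a0" if "a \<in> cball a0 r" for a
    using that r(3) norm_triangle_ineq2[of a0 a] norm_triangle_ineq2[of a a0]
    by (auto simp: dist_norm norm_minus_commute)
  obtain K b where K: "K \<ge> 0" and b: "b > 0"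
    and E: "\<And>a w x. a \<in> cball a0 r \<Longrightarrow> Re a \<ge> 0 \<Longrightarrow> w \<in> cball w0 r \<Longrightarrow> x > 0 \<Longrightarrow>
        exp (- (Re w * x) - Re a * x\<^sup>2 / 2) \<le> K * exp (- (b * x))"
  proof (cases "Re a0 > 0")
    case True
    define c where "c = r - Re w0"
    have "exp (- (Re w * x) - Re a * x\<^sup>2 / 2) \<le> exp ((c + 1)\<^sup>2 / (4 * (Re a0 / 4))) * exp (- (1 * x))"
      if "a \<in> cball a0 r" "w \<in> cball w0 r" "x > 0" for a w x
    proof -
      have "Re a0 / 2 \<le> Re a" using Rea[OF that(1)] r True by (simp add: ra_def)
      then have "Re a0 / 2 * (x\<^sup>2 / 2) \<le> Re a * (x\<^sup>2 / 2)" by (rule mult_right_mono) simp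
      moreover have "- Re w * x \<le> c * x"
        using Rew[OF that(2)] that(3) by (intro mult_right_mono) (auto simp: c_def)
      ultimately have "exp (- (Re w * x) - Re a * x\<^sup>2 / 2) \<le> exp (c * x - Re a0 / 4 * x\<^sup>2)" by simp
      also have "\<dots> \<le> exp ((c + 1)\<^sup>2 / (4 * (Re a0 / 4))) * exp (- (1 * x))"
        using True by (intro exp_linear_minus_square_le) auto
      finally show ?thesis .
    qed
    then show ?thesis by (intro that[of "exp ((c + 1)\<^sup>2 / (4 * (Re a0 / 4)))" 1]) auto
  next
    case False
    then have w0: "Re w0 > 0" using aw by simp
    have "exp (- (Re w * x) - Re a * x\<^sup>2 / 2) \<le> 1 * exp (- (Re w0 / 2 * x))"
      if "Re a \<ge> 0" "w \<in> cball w0 r" "x > 0" for a w x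
    proof -
      have "Re w0 / 2 \<le> Re w" using Rew[OF that(2)] r w0 by (simp add: rw_def)
      then have "Re w0 / 2 * x \<le> Re w * x" using that by (intro mult_right_mono) auto
      moreover have "0 \<le> Re a * x\<^sup>2 / 2" using that by simp
      ultimately show ?thesis unfolding mult_1 exp_le_cancel_iff by linarith
    qed
    then show ?thesis using w0 by (intro that[of 1 "Re w0 / 2"]) auto
  qed
  \<comment> \<open>Bounds both \<open>norm a powr (- c)\<close> and \<open>norm a ^ n\<close>,
    since \<open>norm a\<close> stays between half and twice \<open>norm a0\<close>.\<close>
  define D where "D = (norm a0 / 2) powr (- c) + (2 * norm a0) ^ n"
  have D: "D \<ge> 0" by (simp add: D_def)
  \<comment> \<open>The exponent \<open>\<eta> - 1\<close> governs \<open>x <= 1\<close> and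
    \<open>2 * n + 2 - 1\<close> governs \<open>x > 1\<close>, because \<open>Re m < 2\<close>; the
    factor \<open>2\<close> counts the two terms in the bound for \<open>Kummer_Psi\<close>.\<close>
  define h where "h x = K * (C * D) * 2 * (x powr (\<eta> - 1) * exp (- (b * x)) + x powr (real (2 * n + 2) - 1) * exp (- (b * x)))" for x
  have h_int: "set_integrable lborel {0<..} h"
    unfolding h_def using eta b
    by (intro set_integrable_mult_right set_integral_add LINT_Gamma_real) auto
  have bound: "norm (laplace_integrand a \<nu> m w x) \<le> h x"
    if m: "m \<in> cball m0 r" and a: "a \<in> cball a0 r" "Re a \<ge> 0" and w: "w \<in> cball w0 r" and x: "x > 0" for m a w and x :: real
  proof -
    have m1: "m \<in> cball m0 r1" using m r by auto
    note ms = strip[OF m1]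
    have anz: "a \<noteq> 0" using na[OF a(1)] a0 by auto
    define t where "t = a * (of_real x)\<^sup>2"
    have t: "Re t \<ge> 0" "t \<noteq> 0" and nt: "norm t = norm a * x\<^sup>2"
      using a(2) anz x by (auto simp: t_def norm_mult norm_power simp flip: of_real_power)
    have "norm t powr (- c) = norm a powr (- c) * (x\<^sup>2) powr (- c)"
      unfolding nt by (rule powr_mult) 
    also have "(x\<^sup>2) powr (- c) = x powr (- 2 * c)"
      using x by (simp add: powr_powr flip: powr_numeral)
    finally have n0: "norm t powr (- c) = norm a powr (- c) * x powr (- 2 * c)" .
    have n1: "norm t powr (- c) \<le> D * x powr (- 2 * c)"
    proof -
      have "norm a powr (- c) \<le> (norm a0 / 2) powr (- c)"
        using na[OF a(1)] a0 c by (intro powr_mono2') auto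
      then have "norm a powr (- c) \<le> D" by (simp add: D_def add_increasing2)
      then show ?thesis unfolding n0 by (rule mult_right_mono) simp
    qed
    have n2: "norm t ^ n \<le> D * x ^ (2 * n)"
    proof -
      have "norm a ^ n \<le> (2 * norm a0) ^ n" using na[OF a(1)] by (intro power_mono) auto
      then have "norm a ^ n \<le> D" by (simp add: D_def add_increasing)
      then show ?thesis unfolding nt power_mult_distrib power_mult by (intro mult_right_mono) auto
    qed
    have k: "x powr (Re m - 1) * (x powr (- 2 * c) + x ^ (2 * n)) \<le> 2 * (x powr (\<eta> - 1) + x powr (real (2 * n + 2) - 1))"
    proof -
      have e1: "x powr (Re m - 1) * x powr (- 2 * c) = x powr (Re m - 1 - 2 * c)"
        by (simp flip: powr_add)
      have e2: "x powr (Re m - 1) * x ^ (2 * n) = x powr (Re m - 1 + real (2 * n))"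
        using x by (simp add: powr_add powr_realpow del: of_nat_mult)
      have "x powr (Re m - 1 - 2 * c) \<le> x powr (\<eta> - 1) + x powr (real (2 * n + 2) - 1)
          \<and> x powr (Re m - 1 + real (2 * n)) \<le> x powr (\<eta> - 1) + x powr (real (2 * n + 2) - 1)"
      proof (cases "x \<le> 1")
        case True
        have "x powr (Re m - 1 - 2 * c) \<le> x powr (\<eta> - 1)" "x powr (Re m - 1 + real (2 * n)) \<le> x powr (\<eta> - 1)"
          using True x ms c by (auto intro!: powr_mono')
        then show ?thesis by (simp add: add_increasing2)
      next
        case False
        have "x powr (Re m - 1 - 2 * c) \<le> x powr (real (2 * n + 2) - 1)" "x powr (Re m - 1 + real (2 * n)) \<le> x powr (real (2 * n + 2) - 1)"
          using False x ms c by (auto intro!: powr_mono)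
        then show ?thesis by (simp add: add_increasing)
      qed
      then show ?thesis unfolding distrib_left e1 e2 by linarith
    qed
    have "norm (Kummer_Psi \<nu> m t) \<le> C * (norm t powr (- c) + norm t ^ n)"
      by (rule Psi[OF m1 t])
    also have "\<dots> \<le> C * (D * x powr (- 2 * c) + D * x ^ (2 * n))"
      by (intro mult_left_mono add_mono n1 n2 C)
    finally have p: "norm (Kummer_Psi \<nu> m t) \<le> (C * D) * (x powr (- 2 * c) + x ^ (2 * n))"
      by (simp add: algebra_simps)
    have "norm (laplace_integrand a \<nu> m w x) = exp (- (Re w * x) - Re a * x\<^sup>2 / 2) * (x powr (Re m - 1) * norm (Kummer_Psi \<nu> m t))"
    proof -
      have "exp (- (w * of_real x)) * exp (- (a * (of_real x)\<^sup>2 / 2)) = exp (- (w * of_real x) - a * (of_real x)\<^sup>2 / 2)"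
        by (simp flip: exp_add)
      moreover have "Re (- (w * of_real x) - a * (of_real x)\<^sup>2 / 2) = - (Re w * x) - Re a * x\<^sup>2 / 2"
        by (simp flip: of_real_power)
      ultimately have e: "norm (exp (- (w * of_real x))) * norm (exp (- (a * (of_real x)\<^sup>2 / 2))) = exp (- (Re w * x) - Re a * x\<^sup>2 / 2)"
        unfolding norm_mult[symmetric] by (simp only: norm_exp_eq_Re)
      show ?thesis
        unfolding laplace_integrand_def Psi_kernel_def norm_mult t_def norm_of_real_powr[OF x] e[symmetric]
        by simp
    qed
    also have "\<dots> \<le> (K * exp (- (b * x))) * (x powr (Re m - 1) * ((C * D) * (x powr (- 2 * c) + x ^ (2 * n))))"
      using K by (intro mult_mono E a w x mult_left_mono p mult_nonneg_nonneg) auto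
    also have "\<dots> = (K * exp (- (b * x)) * (C * D)) * (x powr (Re m - 1) * (x powr (- 2 * c) + x ^ (2 * n)))"
      by (simp only: mult_ac)
    also have "\<dots> \<le> (K * exp (- (b * x)) * (C * D)) * (2 * (x powr (\<eta> - 1) + x powr (real (2 * n + 2) - 1)))"
      using K C D by (intro mult_left_mono k) auto
    also have "\<dots> = h x" by (simp add: h_def algebra_simps)
    finally show ?thesis .
  qed
  have "cball m0 r \<subseteq> strip"
  proof
    fix m assume "m \<in> cball m0 r"
    then show "m \<in> strip" using strip[of m] r by auto
  qed
  moreover have "\<forall>a\<in>cball a0 r. a \<noteq> 0 \<and> (Re a0 > 0 \<longrightarrow> Re a > 0)"
  proof
    fix a assume a: "a \<in> cball a0 r"
    show "a \<noteq> 0 \<and> (Re a0 > 0 \<longrightarrow> Re a > 0)"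
      using na[OF a] a0 Rea[OF a] r by (auto simp: ra_def)
  qed
  moreover have "\<forall>w\<in>cball w0 r. Re w0 > 0 \<longrightarrow> Re w > 0"
  proof
    fix w assume w: "w \<in> cball w0 r"
    show "Re w0 > 0 \<longrightarrow> Re w > 0" using Rew[OF w] r by (auto simp: rw_def)
  qed
  moreover have "\<forall>m\<in>cball m0 r. \<forall>a\<in>cball a0 r. \<forall>w\<in>cball w0 r. \<forall>x>0. Re a \<ge> 0 \<longrightarrow>
       norm (laplace_integrand a \<nu> m w x) \<le> h x"
    using bound by blast
  ultimately show ?thesis
    using r(1) h_int by (intro exI[of _ r] exI[of _ h] conjI)
qed

text \<open>The Lebesgue counterpart of \<open>Psi_hat\<close>, used where convergence is absolute;
  Abel's theorem later relates the two.\<close>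

definition Psi_laplace :: "complex \<Rightarrow> complex \<Rightarrow> complex \<Rightarrow> complex \<Rightarrow> complex" where
  "Psi_laplace a \<nu> m w = (LINT x:{0<..}|lborel. laplace_integrand a \<nu> m w x)"

lemma set_integrable_laplace:
  assumes "m \<in> strip" and "Re a \<ge> 0" and "a \<noteq> 0" and "Re a > 0 \<or> Re w > 0"
  shows "set_integrable lborel {0<..} (laplace_integrand a \<nu> m w)"
proof -
  obtain r h where rh: "r > 0" "set_integrable lborel {0<..} h"
    and MAW: "cball m r \<subseteq> strip" "\<forall>a'\<in>cball a r. a' \<noteq> 0 \<and> (Re a > 0 \<longrightarrow> Re a' > 0)"
      "\<forall>w'\<in>cball w r. Re w > 0 \<longrightarrow> Re w' > 0"
    and le: "\<forall>m'\<in>cball m r. \<forall>a'\<in>cball a r. \<forall>w'\<in>cball w r. \<forall>x>0. Re a' \<ge> 0 \<longrightarrow>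
         norm (laplace_integrand a' \<nu> m' w' x) \<le> h x"
    using laplace_integrand_dominated[OF assms, where \<nu>=\<nu>] by (elim exE conjE) (rule that)
  show ?thesis
    by (rule set_integrable_Ioi_bound[OF rh(2) set_borel_measurable_Ioi[OF continuous_on_laplace_integrand[OF assms(1-3)]]])
       (use le rh(1) assms(2) in simp)
qed

lemma Psi_laplace_has_derivative:
  assumes m: "m \<in> strip" and a: "Re a \<ge> 0" "a \<noteq> 0" and w: "Re a > 0 \<or> Re w > 0"
  shows "(Psi_laplace a \<nu> m has_field_derivative
           - (LINT x:{0<..}|lborel. of_real x * laplace_integrand a \<nu> m w x)) (at w)"
proof -
  \<comment> \<open>The open set of \<open>w\<close> on which the majorant is available: everything
    under Gaussian decay, otherwise a half-plane.\<close>
  define A where "A = (if Re a > 0 then UNIV else {w. Re w > 0})"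
  have "open A" by (simp add: A_def open_halfspace_Re_gt)
  have d: "((\<lambda>w. laplace_integrand a \<nu> m w x) has_field_derivative (- 1) * (of_real x * laplace_integrand a \<nu> m w x)) (at w)" for w x
    unfolding laplace_integrand_def by (auto intro!: derivative_eq_intros)
  have dom: "\<exists>r>0. \<exists>h. set_integrable lborel {0<..} h \<and>
      (\<forall>u\<in>cball z r. u \<in> A \<and> (\<forall>x\<in>{0<..}. norm (laplace_integrand a \<nu> m u x) \<le> h x))" if "z \<in> A" for z
  proof -
    have z: "Re a > 0 \<or> Re z > 0" using that by (auto simp: A_def split: if_splits)
    obtain r h where rh: "r > 0" "set_integrable lborel {0<..} h"
      and MAW: "cball m r \<subseteq> strip" "\<forall>a'\<in>cball a r. a' \<noteq> 0 \<and> (Re a > 0 \<longrightarrow> Re a' > 0)"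
        "\<forall>w'\<in>cball z r. Re z > 0 \<longrightarrow> Re w' > 0"
      and le: "\<forall>m'\<in>cball m r. \<forall>a'\<in>cball a r. \<forall>w'\<in>cball z r. \<forall>x>0. Re a' \<ge> 0 \<longrightarrow>
           norm (laplace_integrand a' \<nu> m' w' x) \<le> h x"
      using laplace_integrand_dominated[OF m a z, where \<nu>=\<nu>] by (elim exE conjE) (rule that)
    have "u \<in> A" if "u \<in> cball z r" for u using MAW(3) that z by (auto simp: A_def)
    moreover have "norm (laplace_integrand a \<nu> m u x) \<le> h x" if "u \<in> cball z r" "x > 0" for u x
      using le that rh(1) a by simp
    ultimately show ?thesis using rh by (intro exI[of _ r] conjI exI[of _ h]) auto
  qed
  have wA: "w \<in> A" using w by (auto simp: A_def)
  have hol: "(\<lambda>w. laplace_integrand a \<nu> m w x) holomorphic_on A" for x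
    using d by (auto simp: holomorphic_on_def field_differentiable_def intro: has_field_derivative_at_within)
  have meas: "set_borel_measurable borel {0<..} (laplace_integrand a \<nu> m z)" for z
    by (rule set_borel_measurable_Ioi[OF continuous_on_laplace_integrand[OF m a]])
  note P = holomorphic_parametric_integral[where X="{0<..}", OF \<open>open A\<close> _ hol meas dom wA]
  have "(LINT x:{0<..}|lborel. deriv (\<lambda>w. laplace_integrand a \<nu> m w x) w) =
      (LINT x:{0<..}|lborel. (- 1) * (of_real x * laplace_integrand a \<nu> m w x))"
    by (simp only: DERIV_imp_deriv[OF d])
  also have "\<dots> = - (LINT x:{0<..}|lborel. of_real x * laplace_integrand a \<nu> m w x)"
    unfolding set_integral_mult_right by simp
  finally show "(Psi_laplace a \<nu> m has_field_derivative
           - (LINT x:{0<..}|lborel. of_real x * laplace_integrand a \<nu> m w x)) (at w)"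
    using P unfolding Psi_laplace_def[abs_def] by simp
qed

lemma Psi_laplace_holomorphic:
  assumes "m \<in> strip" and "Re a > 0"
  shows "Psi_laplace a \<nu> m holomorphic_on A"
proof -
  have "Re a \<ge> 0" "a \<noteq> 0" using assms(2) by auto
  then show ?thesis
    unfolding holomorphic_on_def field_differentiable_def
    using Psi_laplace_has_derivative[OF assms(1)] assms(2) has_field_derivative_at_within by blast
qed

lemma Psi_laplace_index_holomorphic:
  assumes a: "Re a \<ge> 0" "a \<noteq> 0" and w: "Re a > 0 \<or> Re w > 0"
  shows "(\<lambda>m. Psi_laplace a \<nu> m w) holomorphic_on strip"
  unfolding Psi_laplace_def
proof (rule holomorphic_on_parametric_integral[OF open_strip])
  fix m assume m: "m \<in> strip"
  show "set_borel_measurable borel {0<..} (laplace_integrand a \<nu> m w)"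
    by (rule set_borel_measurable_Ioi[OF continuous_on_laplace_integrand[OF m a]])
  obtain r h where rh: "r > 0" "set_integrable lborel {0<..} h"
    and MAW: "cball m r \<subseteq> strip" "\<forall>a'\<in>cball a r. a' \<noteq> 0 \<and> (Re a > 0 \<longrightarrow> Re a' > 0)"
      "\<forall>w'\<in>cball w r. Re w > 0 \<longrightarrow> Re w' > 0"
    and le: "\<forall>m'\<in>cball m r. \<forall>a'\<in>cball a r. \<forall>w'\<in>cball w r. \<forall>x>0. Re a' \<ge> 0 \<longrightarrow>
         norm (laplace_integrand a' \<nu> m' w' x) \<le> h x"
    using laplace_integrand_dominated[OF m a w, where \<nu>=\<nu>] by (elim exE conjE) (rule that)
  show "\<exists>r>0. \<exists>h. set_integrable lborel {0<..} h \<and>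
      (\<forall>u\<in>cball m r. u \<in> strip \<and> (\<forall>x\<in>{0<..}. norm (laplace_integrand a \<nu> u w x) \<le> h x))"
  proof (intro exI[of _ r] conjI exI[of _ h] ballI rh)
    fix u assume u: "u \<in> cball m r"
    show "u \<in> strip" using MAW(1) u by blast
    show "norm (laplace_integrand a \<nu> u w x) \<le> h x" if "x \<in> {0<..}" for x
      using le u that rh(1) a by simp
  qed
qed (use laplace_integrand_index_holomorphic[OF a(2)] in auto)

lemma Psi_laplace_holomorphic_param:
  assumes m: "m \<in> strip"
  shows "(\<lambda>a. Psi_laplace a \<nu> m w) holomorphic_on {a. Re a > 0}"
  unfolding Psi_laplace_def
proof (rule holomorphic_on_parametric_integral[OF open_halfspace_Re_gt])
  fix a :: complex assume "a \<in> {a. Re a > 0}"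
  then have a: "Re a \<ge> 0" "a \<noteq> 0" "Re a > 0" by auto
  show "set_borel_measurable borel {0<..} (laplace_integrand a \<nu> m w)"
    by (rule set_borel_measurable_Ioi[OF continuous_on_laplace_integrand[OF m a(1,2)]])
  obtain r h where rh: "r > 0" "set_integrable lborel {0<..} h"
    and MAW: "cball m r \<subseteq> strip" "\<forall>a'\<in>cball a r. a' \<noteq> 0 \<and> (Re a > 0 \<longrightarrow> Re a' > 0)"
      "\<forall>w'\<in>cball w r. Re w > 0 \<longrightarrow> Re w' > 0"
    and le: "\<forall>m'\<in>cball m r. \<forall>a'\<in>cball a r. \<forall>w'\<in>cball w r. \<forall>x>0. Re a' \<ge> 0 \<longrightarrow>
         norm (laplace_integrand a' \<nu> m' w' x) \<le> h x"
    using laplace_integrand_dominated[OF m a(1,2) disjI1[OF a(3), of "Re w > 0"], where \<nu>=\<nu>] by (elim exE conjE) (rule that)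
  show "\<exists>r>0. \<exists>h. set_integrable lborel {0<..} h \<and>
      (\<forall>u\<in>cball a r. u \<in> {a. Re a > 0} \<and> (\<forall>x\<in>{0<..}. norm (laplace_integrand u \<nu> m w x) \<le> h x))"
  proof (intro exI[of _ r] conjI exI[of _ h] ballI rh)
    fix u assume u: "u \<in> cball a r"
    show u': "u \<in> {a. Re a > 0}" using MAW(2) u a(3) by simp
    show "norm (laplace_integrand u \<nu> m w x) \<le> h x" if "x \<in> {0<..}" for x
      using le u that u' rh(1) by simp
  qed
qed (use laplace_integrand_holomorphic_param[OF m] in auto)

text \<open>Approaches \<open>a\<close> from inside the open half-plane, which gives access to
  purely imaginary \<open>a\<close>; \<open>Re w > 0\<close> then supplies the decay.\<close>

lemma Psi_laplace_boundary_limit: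
  assumes m: "m \<in> strip" and a: "Re a \<ge> 0" "a \<noteq> 0" and w: "Re w > 0"
  shows "(\<lambda>n. Psi_laplace (a + of_real (1 / (real n + 1))) \<nu> m w) \<longlonglongrightarrow> Psi_laplace a \<nu> m w"
proof -
  obtain r h where rh: "r > 0" "set_integrable lborel {0<..} h"
    and MAW: "cball m r \<subseteq> strip" "\<forall>a'\<in>cball a r. a' \<noteq> 0 \<and> (Re a > 0 \<longrightarrow> Re a' > 0)"
      "\<forall>w'\<in>cball w r. Re w > 0 \<longrightarrow> Re w' > 0"
    and le: "\<forall>m'\<in>cball m r. \<forall>a'\<in>cball a r. \<forall>w'\<in>cball w r. \<forall>x>0. Re a' \<ge> 0 \<longrightarrow>
         norm (laplace_integrand a' \<nu> m' w' x) \<le> h x"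
    using laplace_integrand_dominated[OF m a disjI2[OF w], where \<nu>=\<nu>] by (elim exE conjE) (rule that)
  define b where "b n = a + of_real (1 / (real n + 1))" for n
  have lim0: "(\<lambda>n. 1 / (real n + 1)) \<longlonglongrightarrow> 0" by real_asymp
  then have b: "b \<longlonglongrightarrow> a"
    unfolding b_def using tendsto_add[OF tendsto_const tendsto_of_real[OF lim0], of a] by simp
  obtain N where "\<forall>n\<ge>N. norm (b n - a) < r"
    using LIMSEQ_D[OF b rh(1)] by blast
  then have N: "\<And>n. n \<ge> N \<Longrightarrow> b n \<in> cball a r"
    by (auto simp: dist_norm norm_minus_commute less_imp_le)
  have bp: "Re (b n) \<ge> 0" for n using a by (simp add: b_def del: of_real_divide)
  have bn: "b (n + N) \<noteq> 0" for n using MAW(2) N[of "n + N"] by simp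
  have "(\<lambda>n. LINT x:{0<..}|lborel. laplace_integrand (b (n + N)) \<nu> m w x) \<longlonglongrightarrow>
     (LINT x:{0<..}|lborel. laplace_integrand a \<nu> m w x)"
  proof (rule LINT_Ioi_dominated_convergence(2)[OF rh(2)])
    show "set_borel_measurable borel {0<..} (laplace_integrand (b (n + N)) \<nu> m w)" for n
      by (rule set_borel_measurable_Ioi[OF continuous_on_laplace_integrand[OF m bp bn]])
    show "norm (laplace_integrand (b (n + N)) \<nu> m w x) \<le> h x" if "x > 0" for n x
      using N[of "n + N"] rh(1) bp[of "n + N"] that le by simp
    fix x :: real assume x: "x > 0"
    have "isCont (Kummer_Psi \<nu> m) (a * (of_real x)\<^sup>2)"
      using holomorphic_on_imp_continuous_on[OF Kummer_Psi_holomorphic[OF m]]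
        a_square_notin_nonpos_Reals[OF a x]
      by (simp add: continuous_on_eq_continuous_at open_Compl)
    then have "(\<lambda>n. Kummer_Psi \<nu> m (b n * (of_real x)\<^sup>2)) \<longlonglongrightarrow> Kummer_Psi \<nu> m (a * (of_real x)\<^sup>2)"
      by (rule isCont_tendsto_compose) (intro tendsto_intros b)
    then have "(\<lambda>n. laplace_integrand (b n) \<nu> m w x) \<longlonglongrightarrow> laplace_integrand a \<nu> m w x"
      unfolding laplace_integrand_def Psi_kernel_def by (intro tendsto_intros b) auto
    then show "(\<lambda>n. laplace_integrand (b (n + N)) \<nu> m w x) \<longlonglongrightarrow> laplace_integrand a \<nu> m w x"
      by (rule LIMSEQ_ignore_initial_segment)
  qed
  then show ?thesis
    unfolding Psi_laplace_def b_def[symmetric] by (rule LIMSEQ_offset)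
qed

section \<open>Contiguous relations under the Laplace transform\<close>

lemma laplace_integrand_1:
  assumes "m \<in> strip" "m \<noteq> 1"
  shows "laplace_integrand 1 \<nu> m w x = exp (- (w * of_real x)) *
    (of_real x powr (m - 1) * exp (- ((of_real x)\<^sup>2 / 2)) * Kummer_Psi_nonint \<nu> m ((of_real x)\<^sup>2))"
  using assms by (simp add: laplace_integrand_def Psi_kernel_def Kummer_Psi_strip_eq)

lemma strip_noninteger: "m \<in> strip \<Longrightarrow> m \<noteq> 1 \<Longrightarrow> m \<notin> \<int>"
  using strip_Ints_iff by blast

text \<open>The factor \<open>x\<close> raises the exponent \<open>m - 1\<close> by one, and the up
  relation at \<open>t = x^2\<close> raises the parameter of \<open>\<Psi>\<close> to match.\<close>

lemma laplace_integrand_1_up: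
  assumes m: "m \<in> strip" "Re m < 1" and x: "x > 0"
  shows "of_real x * laplace_integrand 1 \<nu> m w x =
    laplace_integrand 1 \<nu> (m + 1) w x - \<nu> * laplace_integrand 1 (\<nu> + 1) (m + 1) w x"
proof -
  have m': "m \<noteq> 1" "m + 1 \<in> strip" "m + 1 \<noteq> 1" using m by auto
  have p: "of_real x * of_real x powr (m - 1) = complex_of_real x powr (m + 1 - 1)"
    using powr_add[of "of_real x" 1 "m - 1"] x by simp
  have "(complex_of_real x)\<^sup>2 \<noteq> 0" using x by simp
  note up = Kummer_Psi_nonint_up[OF strip_noninteger[OF m(1) m'(1)] this, of \<nu>]
  show ?thesis
    unfolding laplace_integrand_1[OF m(1) m'(1)] laplace_integrand_1[OF m'(2,3)] up p[symmetric]
    by (simp add: algebra_simps)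
qed

text \<open>Here \<open>x * x powr (m - 1)\<close> is read as \<open>x powr (m - 2) * x^2\<close>,
  and the down relation at \<open>t = x^2\<close> consumes the square.\<close>

lemma laplace_integrand_1_down:
  assumes m: "m \<in> strip" "Re m > 1" and x: "x > 0"
  shows "of_real x * laplace_integrand 1 \<nu> m w x =
    laplace_integrand 1 (\<nu> - 1) (m - 1) w x - (\<nu> - m + 1) * laplace_integrand 1 \<nu> (m - 1) w x"
proof -
  have m': "m \<noteq> 1" "m - 1 \<in> strip" "m - 1 \<noteq> 1" using m by auto
  have p: "of_real x * of_real x powr (m - 1) = complex_of_real x powr (m - 1 - 1) * (of_real x)\<^sup>2"
    using powr_add[of "of_real x" 1 "m - 1 - 1"] x by (simp add: power2_eq_square)
  have "(complex_of_real x)\<^sup>2 \<noteq> 0" using x by simp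
  note down = Kummer_Psi_nonint_down[OF strip_noninteger[OF m(1) m'(1)] this, of \<nu>]
  have "of_real x * laplace_integrand 1 \<nu> m w x = exp (- (w * of_real x)) * exp (- ((of_real x)\<^sup>2 / 2)) *
     (of_real x * of_real x powr (m - 1)) * Kummer_Psi_nonint \<nu> m ((of_real x)\<^sup>2)"
    unfolding laplace_integrand_1[OF m(1) m'(1)] by (simp only: mult_ac)
  also have "\<dots> = exp (- (w * of_real x)) * exp (- ((of_real x)\<^sup>2 / 2)) * of_real x powr (m - 1 - 1) *
      ((of_real x)\<^sup>2 * Kummer_Psi_nonint \<nu> m ((of_real x)\<^sup>2))"
    unfolding p by (simp only: mult_ac)
  also have "\<dots> = laplace_integrand 1 (\<nu> - 1) (m - 1) w x - (\<nu> - m + 1) * laplace_integrand 1 \<nu> (m - 1) w x"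
    unfolding down laplace_integrand_1[OF m'(2,3)] by (simp add: algebra_simps)
  finally show ?thesis .
qed

lemma Psi_laplace_derivative_aux:
  assumes m: "m \<in> strip" and m': "m' \<in> strip"
    and eq: "\<And>x. x > 0 \<Longrightarrow> of_real x * laplace_integrand 1 \<nu> m w x =
      c1 * laplace_integrand 1 \<nu>1 m' w x - c2 * laplace_integrand 1 \<nu>2 m' w x"
  shows "(Psi_laplace 1 \<nu> m has_field_derivative c2 * Psi_laplace 1 \<nu>2 m' w - c1 * Psi_laplace 1 \<nu>1 m' w) (at w)"
proof -
  have i: "set_integrable lborel {0<..} (\<lambda>x. c * laplace_integrand 1 a m' w x)" for a c
    using set_integrable_laplace[OF m', of 1 w a] by (intro set_integrable_mult_right) auto
  have "(LINT x:{0<..}|lborel. of_real x * laplace_integrand 1 \<nu> m w x) =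
     (LINT x:{0<..}|lborel. c1 * laplace_integrand 1 \<nu>1 m' w x - c2 * laplace_integrand 1 \<nu>2 m' w x)"
    using eq by (intro set_lebesgue_integral_cong) auto
  also have "\<dots> = c1 * Psi_laplace 1 \<nu>1 m' w - c2 * Psi_laplace 1 \<nu>2 m' w"
    unfolding Psi_laplace_def set_integral_diff(2)[OF i i] set_integral_mult_right ..
  finally show ?thesis
    using Psi_laplace_has_derivative[OF m, of 1 w \<nu>] by simp
qed

lemma Psi_laplace_derivative_up:
  assumes "m \<in> strip" "Re m < 1"
  shows "(Psi_laplace 1 \<nu> m has_field_derivative \<nu> * Psi_laplace 1 (\<nu> + 1) (m + 1) w - Psi_laplace 1 \<nu> (m + 1) w) (at w)"
  using Psi_laplace_derivative_aux[OF assms(1), of "m + 1" \<nu> w 1 \<nu> \<nu> "\<nu> + 1"] assms laplace_integrand_1_up[OF assms]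
  by simp

lemma Psi_laplace_derivative_down:
  assumes "m \<in> strip" "Re m > 1"
  shows "(Psi_laplace 1 \<nu> m has_field_derivative
     (\<nu> - m + 1) * Psi_laplace 1 \<nu> (m - 1) w - Psi_laplace 1 (\<nu> - 1) (m - 1) w) (at w)"
  using Psi_laplace_derivative_aux[OF assms(1), of "m - 1" \<nu> w 1 "\<nu> - 1" "\<nu> - m + 1" \<nu>] assms laplace_integrand_1_down[OF assms]
  by simp

section \<open>Gaussian and beta integrals for the value at the origin\<close>

lemma LINT_Gaussian:
  assumes z: "Re z > 0" and b: "b > 0"
  shows "set_integrable lborel {0<..} (\<lambda>x. of_real x powr (z - 1) * of_real (exp (- (b * x\<^sup>2))))"
    and "(LINT x:{0<..}|lborel. of_real x powr (z - 1) * of_real (exp (- (b * x\<^sup>2)))) =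
           Gamma (z / 2) * of_real b powr (- (z / 2)) / 2"
proof -
  define f where "f y = of_real y powr (z / 2 - 1) * complex_of_real (exp (- (b * y)))" for y
  show i: "set_integrable lborel {0<..} (\<lambda>x. of_real x powr (z - 1) * of_real (exp (- (b * x\<^sup>2))))"
  proof (rule set_integrable_Ioi_bound)
    show "set_integrable lborel {0<..} (\<lambda>x. exp ((0 + 1)\<^sup>2 / (4 * b)) * (x powr (Re z - 1) * exp (- (1 * x))))"
      by (intro set_integrable_mult_right LINT_Gamma_real z) auto
    show "set_borel_measurable borel {0<..} (\<lambda>x. of_real x powr (z - 1) * complex_of_real (exp (- (b * x\<^sup>2))))"
      by (intro set_borel_measurable_Ioi continuous_intros continuous_on_of_real_powr)
    fix x :: real assume x: "x > 0"
    have "x powr (Re z - 1) * exp (0 * x - b * x\<^sup>2) \<le> x powr (Re z - 1) * (exp ((0 + 1)\<^sup>2 / (4 * b)) * exp (- (1 * x)))"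
      by (intro mult_left_mono exp_linear_minus_square_le b) auto
    then show "norm (of_real x powr (z - 1) * complex_of_real (exp (- (b * x\<^sup>2)))) \<le> exp ((0 + 1)\<^sup>2 / (4 * b)) * (x powr (Re z - 1) * exp (- (1 * x)))"
      using x by (simp add: norm_mult norm_of_real_powr mult_ac)
  qed
  \<comment> \<open>The substitution \<open>y = x^2\<close> with its Jacobian \<open>2 * x\<close>;
    it turns the Gamma integral at \<open>z / 2\<close> into the Gaussian one.\<close>
  have sub: "(2 * x) *\<^sub>R f (x\<^sup>2) = 2 * (of_real x powr (z - 1) * of_real (exp (- (b * x\<^sup>2))))" if x: "x > 0" for x
  proof -
    have "complex_of_real (x\<^sup>2) powr (z / 2 - 1) = of_real x powr (z / 2 - 1) * of_real x powr (z / 2 - 1)"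
      unfolding power2_eq_square of_real_mult using x by (intro powr_times_real) auto
    also have "\<dots> = of_real x powr (z - 2)"
      by (simp flip: powr_add)
    finally have "of_real x * complex_of_real (x\<^sup>2) powr (z / 2 - 1) = of_real x powr (z - 1)"
      using powr_add[of "of_real x" 1 "z - 2"] x by simp
    then show ?thesis unfolding f_def by (simp add: scaleR_conv_of_real mult.assoc[symmetric])
  qed
  have "(LBINT y=0..\<infinity>. f y) = (LBINT x=0..\<infinity>. (2 * x) *\<^sub>R f (x\<^sup>2))"
  proof (rule interval_integral_substitution_integrable)
    show "((\<lambda>x. x\<^sup>2) has_real_derivative 2 * x) (at x)" for x :: real
      by (auto intro!: derivative_eq_intros)
    show "isCont f (x\<^sup>2)" if "0 < ereal x" for x
    proof -
      have "continuous_on {0<..} f"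
        unfolding f_def by (intro continuous_intros continuous_on_of_real_powr)
      then show ?thesis using that by (simp add: continuous_on_eq_continuous_at)
    qed
    show "((ereal \<circ> (\<lambda>x. x\<^sup>2) \<circ> real_of_ereal) \<longlongrightarrow> 0) (at_right 0)"
      unfolding zero_ereal_def ereal_tendsto_simps by (auto intro!: tendsto_eq_intros)
    show "((ereal \<circ> (\<lambda>x. x\<^sup>2) \<circ> real_of_ereal) \<longlongrightarrow> \<infinity>) (at_left \<infinity>)"
      unfolding ereal_tendsto_simps by real_asymp
    show "set_integrable lborel (einterval 0 \<infinity>) f"
      using LINT_Gamma(1)[of "z / 2" b] z b unfolding f_def by (simp add: zero_ereal_def)
    show "set_integrable lborel (einterval 0 \<infinity>) (\<lambda>x. (2 * x) *\<^sub>R f (x\<^sup>2))"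
      using set_integrable_mult_right[of 2, OF i]
      by (subst set_integrable_cong[OF refl _ sub]) (auto simp: zero_ereal_def)
  qed (auto simp: zero_ereal_def)
  then have "(LINT y:{0<..}|lborel. f y) = (LINT x:{0<..}|lborel. (2 * x) *\<^sub>R f (x\<^sup>2))"
    by (simp add: interval_lebesgue_integral_0_infty)
  also have "\<dots> = 2 * (LINT x:{0<..}|lborel. of_real x powr (z - 1) * of_real (exp (- (b * x\<^sup>2))))"
    unfolding set_integral_mult_right[symmetric] using sub by (intro set_lebesgue_integral_cong) auto
  finally show "(LINT x:{0<..}|lborel. of_real x powr (z - 1) * of_real (exp (- (b * x\<^sup>2)))) =
           Gamma (z / 2) * of_real b powr (- (z / 2)) / 2"
    using LINT_Gamma(2)[of "z / 2" b] z b unfolding f_def by simp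
qed

lemma LINT_Gaussian_real:
  fixes \<alpha> b :: real
  assumes "\<alpha> > 0" and "b > 0"
  shows "(LINT x:{0<..}|lborel. x powr (\<alpha> - 1) * exp (- (b * x\<^sup>2))) = Gamma (\<alpha> / 2) * b powr (- (\<alpha> / 2)) / 2"
proof -
  have "complex_of_real (LINT x:{0<..}|lborel. x powr (\<alpha> - 1) * exp (- (b * x\<^sup>2))) =
     (LINT x:{0<..}|lborel. of_real x powr (of_real \<alpha> - 1) * of_real (exp (- (b * x\<^sup>2))))"
    unfolding set_integral_complex_of_real[symmetric]
    using powr_of_real[of _ "\<alpha> - 1"] by (intro set_lebesgue_integral_cong) auto
  also have "\<dots> = of_real (Gamma (\<alpha> / 2) * b powr (- (\<alpha> / 2)) / 2)"
    using LINT_Gaussian(2)[of "of_real \<alpha>" b] assms powr_of_real[of b "- (\<alpha> / 2)"]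
      Gamma_complex_of_real[of "\<alpha> / 2"] by simp
  finally show ?thesis unfolding of_real_eq_iff .
qed

text \<open>The substitution \<open>\<sigma> = s\<^sup>2 / (1 + 2 * s)\<close>, for which \<open>1 + \<sigma> = (1 + s)\<^sup>2 / (1 + 2 * s)\<close>,
  reduces the integral to Euler's beta integral.\<close>

lemma LINT_quadratic_Beta:
  assumes nu: "Re \<nu> > 0" and m: "m \<in> strip"
  shows "set_integrable lborel {0<..} (\<lambda>s. s powr (Re \<nu> - 1) * (1 + s) powr (Re m - Re \<nu> - 1) * (1 + 2 * s) powr (- (Re m / 2)))"
    and "(LINT s:{0<..}|lborel. of_real s powr (\<nu> - 1) * (1 + of_real s) powr (m - \<nu> - 1) * of_real (1 + 2 * s) powr (- (m / 2))) =
      Gamma (\<nu> / 2) * Gamma (1 - m / 2) * rGamma (\<nu> / 2 + 1 - m / 2) / 2"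
proof -
  define f where "f y = of_real y powr (\<nu> / 2 - 1) * (1 + complex_of_real y) powr (- (\<nu> / 2) - (1 - m / 2))" for y
  define k where "k s = of_real s powr (\<nu> - 1) * (1 + of_real s) powr (m - \<nu> - 1) * complex_of_real (1 + 2 * s) powr (- (m / 2))" for s
  define g where "g s = s\<^sup>2 / (1 + 2 * s)" for s :: real
  define g' where "g' s = 2 * s * (1 + s) / (1 + 2 * s)\<^sup>2" for s :: real
  have kc: "continuous_on {0<..} k"
    unfolding k_def by (intro continuous_intros continuous_on_of_real_powr continuous_on_one_plus_of_real_powr
       continuous_on_compose2[OF continuous_on_of_real_powr[of "- (m / 2)"]]) (auto simp: add_pos_pos)
  have nk: "norm (k s) = s powr (Re \<nu> - 1) * (1 + s) powr (Re m - Re \<nu> - 1) * (1 + 2 * s) powr (- (Re m / 2))" if "s > 0" for s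
    unfolding k_def norm_mult using that norm_of_real_powr[of "1 + 2 * s" "- (m / 2)"]
    by (simp add: norm_of_real_powr norm_one_plus_of_real_powr)
  have le: "norm (k s) \<le> s powr (Re \<nu> - 1) * (1 + s) powr (- Re \<nu> - (1 - Re m / 2))" if s: "s > 0" for s
  proof -
    \<comment> \<open>The exponent is negative because \<open>Re m > 0\<close>. Replacing
      \<open>1 + 2 * s\<close> by \<open>1 + s\<close> leaves a beta kernel whose second parameter
      \<open>1 - Re m / 2\<close> is positive because \<open>Re m < 2\<close>.\<close>
    have "(1 + 2 * s) powr (- (Re m / 2)) \<le> (1 + s) powr (- (Re m / 2))"
      using m s by (intro powr_mono2') auto
    then have "norm (k s) \<le> s powr (Re \<nu> - 1) * (1 + s) powr (Re m - Re \<nu> - 1) * (1 + s) powr (- (Re m / 2))"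
      unfolding nk[OF s] by (intro mult_left_mono) auto
    also have "\<dots> = s powr (Re \<nu> - 1) * ((1 + s) powr (Re m - Re \<nu> - 1) * (1 + s) powr (- (Re m / 2)))"
      by (simp only: mult.assoc)
    also have "(1 + s) powr (Re m - Re \<nu> - 1) * (1 + s) powr (- (Re m / 2)) = (1 + s) powr (- Re \<nu> - (1 - Re m / 2))"
      by (simp add: algebra_simps flip: powr_add)
    finally show ?thesis .
  qed
  have ki: "set_integrable lborel {0<..} k"
    by (rule set_integrable_Ioi_bound[OF set_integrable_Beta_kernel set_borel_measurable_Ioi[OF kc] le])
       (use nu m in auto)
  then show "set_integrable lborel {0<..} (\<lambda>s. s powr (Re \<nu> - 1) * (1 + s) powr (Re m - Re \<nu> - 1) * (1 + 2 * s) powr (- (Re m / 2)))"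
    using nk by (subst set_integrable_cong[OF refl refl nk[symmetric]]) (auto intro: set_integrable_norm)
  have sub: "g' s *\<^sub>R f (g s) = 2 * k s" if s: "s > 0" for s
  proof -
    \<comment> \<open>All bases are positive reals, so their logarithms are real and the identity of
      complex powers becomes a linear identity between exponents.\<close>
    define A where "A = complex_of_real s"
    define B where "B = complex_of_real (1 + s)"
    define C where "C = complex_of_real (1 + 2 * s)"
    have nz: "A \<noteq> 0" "B \<noteq> 0" "C \<noteq> 0" using s unfolding A_def B_def C_def of_real_eq_0_iff by auto
    have lnA: "Ln A = of_real (ln s)" and lnB: "Ln B = of_real (ln (1 + s))" and lnC: "Ln C = of_real (ln (1 + 2 * s))"
      unfolding A_def B_def C_def using s by (intro Ln_of_real; simp)+
    have gp: "g s > 0" using s by (simp add: g_def)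
    have "1 + g s = (1 + s)\<^sup>2 / (1 + 2 * s)" using s by (simp add: g_def power2_eq_square field_simps)
    then have l2: "ln (1 + g s) = 2 * ln (1 + s) - ln (1 + 2 * s)"
      using s by (simp add: ln_div ln_realpow)
    have l1: "ln (g s) = 2 * ln s - ln (1 + 2 * s)"
      unfolding g_def using s by (simp add: ln_div ln_realpow)
    have L1: "Ln (of_real (g s)) = 2 * Ln A - Ln C"
      unfolding lnA lnC using gp by (simp add: Ln_of_real l1)
    have L2: "Ln (1 + of_real (g s)) = 2 * Ln B - Ln C"
      unfolding lnB lnC using gp Ln_of_real[of "1 + g s"] by (simp add: l2)
    have gnz: "complex_of_real (g s) \<noteq> 0" "1 + complex_of_real (g s) \<noteq> 0"
      using gp by (auto simp: complex_eq_iff)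
    have gd: "complex_of_real (g' s) = 2 * exp (Ln A + Ln B - 2 * Ln C)"
      using nz by (simp add: exp_diff exp_add exp_double power2_eq_square g'_def A_def B_def C_def)
    have "g' s *\<^sub>R f (g s) = 2 * exp (Ln A + Ln B - 2 * Ln C + (\<nu> / 2 - 1) * (2 * Ln A - Ln C) + (- (\<nu> / 2) - (1 - m / 2)) * (2 * Ln B - Ln C))"
      unfolding f_def scaleR_conv_of_real powr_def using gnz
      by (simp add: L1 L2 gd exp_add mult.assoc)
    also have "\<dots> = 2 * exp ((\<nu> - 1) * Ln A + (m - \<nu> - 1) * Ln B + (- (m / 2)) * Ln C)"
      by (rule arg_cong[where f="\<lambda>x. 2 * exp x"]) (simp add: field_simps)
    also have "\<dots> = 2 * (A powr (\<nu> - 1) * B powr (m - \<nu> - 1) * C powr (- (m / 2)))"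
      unfolding exp_add using nz by (simp add: powr_def)
    finally show ?thesis by (simp add: k_def A_def B_def C_def)
  qed
  have "(LBINT y=0..\<infinity>. f y) = (LBINT x=0..\<infinity>. g' x *\<^sub>R f (g x))"
  proof (rule interval_integral_substitution_integrable)
    show "(g has_real_derivative g' x) (at x)" if "0 < ereal x" for x
      unfolding g_def[abs_def] g'_def using that
      by (auto intro!: derivative_eq_intros simp: power2_eq_square field_simps)
    show "isCont f (g x)" if "0 < ereal x" for x
    proof -
      have "continuous_on {0<..} f"
        unfolding f_def by (intro continuous_intros continuous_on_of_real_powr continuous_on_one_plus_of_real_powr)
      moreover have "g x > 0" using that by (simp add: g_def)
      ultimately show ?thesis by (simp add: continuous_on_eq_continuous_at)
    qed
    show "isCont g' x" if "0 < ereal x" for x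
      unfolding g'_def[abs_def] using that by (auto intro!: continuous_intros)
    show "0 \<le> g' x" if "0 \<le> ereal x" for x using that by (simp add: g'_def)
    show "((ereal \<circ> g \<circ> real_of_ereal) \<longlongrightarrow> 0) (at_right 0)"
      unfolding zero_ereal_def ereal_tendsto_simps g_def by (auto intro!: tendsto_eq_intros)
    show "((ereal \<circ> g \<circ> real_of_ereal) \<longlongrightarrow> \<infinity>) (at_left \<infinity>)"
      unfolding ereal_tendsto_simps g_def by real_asymp
    show "set_integrable lborel (einterval 0 \<infinity>) f"
      using LINT_Beta(1)[of "\<nu> / 2" "1 - m / 2"] nu m unfolding f_def by (simp add: zero_ereal_def)
    show "set_integrable lborel (einterval 0 \<infinity>) (\<lambda>x. g' x *\<^sub>R f (g x))"
      using set_integrable_mult_right[of 2, OF ki]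
      by (subst set_integrable_cong[OF refl _ sub]) (auto simp: zero_ereal_def)
  qed auto
  then have "(LINT y:{0<..}|lborel. f y) = (LINT x:{0<..}|lborel. g' x *\<^sub>R f (g x))"
    by (simp add: interval_lebesgue_integral_0_infty)
  also have "\<dots> = 2 * (LINT s:{0<..}|lborel. k s)"
    unfolding set_integral_mult_right[symmetric] using sub by (intro set_lebesgue_integral_cong) auto
  finally have "(LINT y:{0<..}|lborel. f y) = 2 * (LINT s:{0<..}|lborel. k s)" .
  moreover have "(LINT y:{0<..}|lborel. f y) = Gamma (\<nu> / 2) * Gamma (1 - m / 2) * rGamma (\<nu> / 2 + (1 - m / 2))"
    unfolding f_def by (rule LINT_Beta(2)) (use nu m in auto)
  ultimately show "(LINT s:{0<..}|lborel. of_real s powr (\<nu> - 1) * (1 + of_real s) powr (m - \<nu> - 1) * of_real (1 + 2 * s) powr (- (m / 2))) =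
      Gamma (\<nu> / 2) * Gamma (1 - m / 2) * rGamma (\<nu> / 2 + 1 - m / 2) / 2"
    unfolding k_def by (simp add: add_diff_eq)
qed

section \<open>The sine transform for \<open>a = 1\<close>\<close>

text \<open>Insert the integral representation of \<open>\<Psi>\<close> and exchange integrals: the
  \<open>x\<close>-integral is Gaussian with rate \<open>s + 1/2\<close>, and the remaining
  \<open>s\<close>-integral is the quadratic beta integral.\<close>

lemma Psi_laplace_at_0_Re_pos:
  assumes nu: "Re \<nu> > 0" and m: "m \<in> strip" "m \<noteq> 1"
  shows "Psi_laplace 1 \<nu> m 0 = rGamma \<nu> * (Gamma (m / 2) / 2 * 2 powr (m / 2) *
     (Gamma (\<nu> / 2) * Gamma (1 - m / 2) * rGamma (\<nu> / 2 + 1 - m / 2) / 2))"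
proof -
  define f where "f x s = (of_real s powr (\<nu> - 1) * (1 + of_real s) powr (m - \<nu> - 1)) *
      (complex_of_real x powr (m - 1) * of_real (exp (- ((s + 1/2) * x\<^sup>2))))" for x s :: real
  have m0: "Re m > 0" using m by simp
  have cont: "continuous_on ({0<..} \<times> {0<..}) (\<lambda>(x, s). f x s)"
    unfolding f_def case_prod_beta
    by (intro continuous_intros continuous_on_compose2[OF continuous_on_of_real_powr continuous_on_fst]
        continuous_on_compose2[OF continuous_on_of_real_powr continuous_on_snd]
        continuous_on_compose2[OF continuous_on_one_plus_of_real_powr continuous_on_snd]) (auto intro!: continuous_intros)
  have half: "(s + 1/2) powr (- (\<alpha> / 2)) = 2 powr (\<alpha> / 2) * (1 + 2 * s) powr (- (\<alpha> / 2))" if "s > 0" for s \<alpha> :: real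
  proof -
    have "(1 + 2 * s) powr (- (\<alpha> / 2)) = (2 * (s + 1/2)) powr (- (\<alpha> / 2))"
      by (simp add: algebra_simps)
    also have "\<dots> = 2 powr (- (\<alpha> / 2)) * (s + 1/2) powr (- (\<alpha> / 2))"
      by (rule powr_mult)
    finally show ?thesis by (simp add: powr_minus)
  qed
  have halfc: "of_real (s + 1/2) powr (- (m / 2)) = 2 powr (m / 2) * complex_of_real (1 + 2 * s) powr (- (m / 2))" if "s > 0" for s :: real
  proof -
    have "complex_of_real (1 + 2 * s) = of_real 2 * of_real (s + 1/2)"
      by simp
    then have "complex_of_real (1 + 2 * s) powr (- (m / 2)) = of_real 2 powr (- (m / 2)) * of_real (s + 1/2) powr (- (m / 2))"
      by (simp only:) (rule powr_times_real, use that in auto)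
    then show ?thesis by (simp add: powr_minus)
  qed
  have i1: "set_integrable lborel {0<..} (\<lambda>x. f x s)" if "s > 0" for s
    unfolding f_def using that by (intro set_integrable_mult_right LINT_Gaussian(1)[OF m0]) auto
  have i2: "(LINT x:{0<..}|lborel. f x s) = Gamma (m / 2) / 2 * 2 powr (m / 2) *
     (of_real s powr (\<nu> - 1) * (1 + of_real s) powr (m - \<nu> - 1) * of_real (1 + 2 * s) powr (- (m / 2)))" if "s > 0" for s
    unfolding f_def set_integral_mult_right using LINT_Gaussian(2)[OF m0, of "s + 1/2"] halfc[OF that] that by simp
  have i3: "(LINT x:{0<..}|lborel. norm (f x s)) = Gamma (Re m / 2) / 2 * 2 powr (Re m / 2) *
     (s powr (Re \<nu> - 1) * (1 + s) powr (Re m - Re \<nu> - 1) * (1 + 2 * s) powr (- (Re m / 2)))" if s: "s > 0" for s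
  proof -
    have "(LINT x:{0<..}|lborel. norm (f x s)) = (LINT x:{0<..}|lborel. (s powr (Re \<nu> - 1) * (1 + s) powr (Re m - Re \<nu> - 1)) *
       (x powr (Re m - 1) * exp (- ((s + 1/2) * x\<^sup>2))))"
      using s by (intro set_lebesgue_integral_cong)
        (auto simp: f_def norm_mult norm_of_real_powr norm_one_plus_of_real_powr)
    also have "\<dots> = (s powr (Re \<nu> - 1) * (1 + s) powr (Re m - Re \<nu> - 1)) * (Gamma (Re m / 2) * (s + 1/2) powr (- (Re m / 2)) / 2)"
      unfolding set_integral_mult_right using LINT_Gaussian_real[OF m0, of "s + 1/2"] s by simp
    finally show ?thesis unfolding half[OF s] by simp
  qed
  have i4: "set_integrable lborel {0<..} (\<lambda>s. LINT x:{0<..}|lborel. norm (f x s))"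
    by (subst set_integrable_cong[OF refl refl i3])
       (use LINT_quadratic_Beta(1)[OF nu m(1)] in \<open>auto intro!: set_integrable_mult_right\<close>)
  have l: "laplace_integrand 1 \<nu> m 0 x = rGamma \<nu> * (LINT s:{0<..}|lborel. f x s)" if x: "x > 0" for x
  proof -
    have "Re ((complex_of_real x)\<^sup>2) > 0" using x by (simp flip: of_real_power)
    then have U: "Kummer_Psi_nonint \<nu> m ((of_real x)\<^sup>2) = tricomi_U \<nu> m ((of_real x)\<^sup>2)"
      using tricomi_U_eq_Kummer_Psi_nonint[OF nu _ strip_noninteger[OF m]] by simp
    have "f x s = (of_real x powr (m - 1) * exp (- ((of_real x)\<^sup>2 / 2))) * tricomi_integrand \<nu> m ((of_real x)\<^sup>2) s" for s
    proof -
      have "complex_of_real (exp (- ((s + 1/2) * x\<^sup>2))) = exp (- ((of_real x)\<^sup>2 / 2)) * exp (- ((of_real x)\<^sup>2 * of_real s))"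
        by (simp add: exp_of_real[symmetric] algebra_simps flip: exp_add)
      then show ?thesis unfolding f_def tricomi_integrand_def by (simp only: mult_ac)
    qed
    then have "(LINT s:{0<..}|lborel. f x s) = (of_real x powr (m - 1) * exp (- ((of_real x)\<^sup>2 / 2))) *
        (LINT s:{0<..}|lborel. tricomi_integrand \<nu> m ((of_real x)\<^sup>2) s)"
      unfolding set_integral_mult_right[symmetric] by simp
    then show ?thesis
      unfolding laplace_integrand_1[OF m] U tricomi_U_def by simp
  qed
  have "Psi_laplace 1 \<nu> m 0 = rGamma \<nu> * (LINT x:{0<..}|lborel. LINT s:{0<..}|lborel. f x s)"
    unfolding Psi_laplace_def set_integral_mult_right[symmetric]
    using l by (intro set_lebesgue_integral_cong) auto
  also have "(LINT x:{0<..}|lborel. LINT s:{0<..}|lborel. f x s) = (LINT s:{0<..}|lborel. LINT x:{0<..}|lborel. f x s)"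
    by (rule LINT_Ioi_Fubini(2)[OF cont i1 i4])
  also have "\<dots> = Gamma (m / 2) / 2 * 2 powr (m / 2) *
     (LINT s:{0<..}|lborel. of_real s powr (\<nu> - 1) * (1 + of_real s) powr (m - \<nu> - 1) * of_real (1 + 2 * s) powr (- (m / 2)))"
    unfolding set_integral_mult_right[symmetric] using i2 by (intro set_lebesgue_integral_cong) auto
  finally show ?thesis
    unfolding LINT_quadratic_Beta(2)[OF nu m(1)] .
qed

text \<open>The closed form of the sine transform at \<open>0\<close>. Written with
  \<open>rGamma\<close> it has no exceptional \<open>\<nu>\<close>, so it can follow the recurrence
  to all \<open>\<nu>\<close>.\<close>

definition moment_value :: "complex \<Rightarrow> complex \<Rightarrow> complex" where
  "moment_value \<nu> m = of_real pi * of_real (sqrt pi) * 2 powr (m / 2 - \<nu> - 1) *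
     rGamma (\<nu> / 2 + 1/2) * rGamma (\<nu> / 2 + 1 - m / 2)"

lemma moment_value_recurrence:
  "moment_value (\<nu> - 1) m = \<nu> * (\<nu> - m + 1) * moment_value (\<nu> + 1) m"
proof -
  have "2 powr (m / 2 - (\<nu> - 1) - 1) = 2 powr (2 + (m / 2 - (\<nu> + 1) - 1))" by (simp add: algebra_simps)
  also have "\<dots> = 4 * 2 powr (m / 2 - (\<nu> + 1) - 1)" unfolding powr_add by simp
  finally have 1: "2 powr (m / 2 - (\<nu> - 1) - 1) = 4 * 2 powr (m / 2 - (\<nu> + 1) - 1)" .
  have e: "(\<nu> - 1) / 2 + 1 / 2 = \<nu> / 2" "(\<nu> + 1) / 2 + 1 / 2 = \<nu> / 2 + 1" "(\<nu> - 1) / 2 + 1 - m / 2 = (\<nu> - m + 1) / 2"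
     "(\<nu> + 1) / 2 + 1 - m / 2 = (\<nu> - m + 1) / 2 + 1"
    by (simp_all add: field_simps)
  show ?thesis
    unfolding moment_value_def 1 e rGamma_eq_mult_rGamma_plus1[of "\<nu> / 2"] rGamma_eq_mult_rGamma_plus1[of "(\<nu> - m + 1) / 2"]
    by simp
qed

lemma sin_half_pi_nonzero:
  assumes "m \<in> strip"
  shows "sin (of_real pi * m / 2) \<noteq> 0"
proof
  assume "sin (of_real pi * m / 2) = 0"
  then obtain k where "of_real pi * m / 2 = of_real (real_of_int k * pi)"
    unfolding sin_eq_0 by auto
  then have "m = of_int (2 * k)" by (simp add: field_simps)
  then show False using assms by auto
qed

text \<open>The reflection formula at \<open>m / 2\<close> cancels the sine against two Gamma
  factors, and Legendre's duplication combines \<open>rGamma \<nu>\<close> with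
  \<open>Gamma (\<nu> / 2)\<close>.\<close>

lemma sin_times_Psi_laplace_at_0_Re_pos:
  assumes nu: "Re \<nu> > 0" and m: "m \<in> strip" "m \<noteq> 1"
  shows "sin (of_real pi * m / 2) * Psi_laplace 1 \<nu> m 0 = moment_value \<nu> m"
proof -
  define s where "s = sin (of_real pi * (m / 2))"
  have s0: "s \<noteq> 0" using sin_half_pi_nonzero[OF m(1)] by (simp add: s_def)
  have refl: "Gamma (m / 2) * Gamma (1 - m / 2) = of_real pi / s"
    unfolding s_def by (rule Gamma_reflection_complex)
  have n: "\<nu> / 2 \<notin> \<int>\<^sub>\<le>\<^sub>0" "\<nu> / 2 + 1/2 \<notin> \<int>\<^sub>\<le>\<^sub>0" "\<nu> \<notin> \<int>\<^sub>\<le>\<^sub>0"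
    using nu by (auto intro!: Re_pos_imp_notin_nonpos_Ints)
  have g: "Gamma \<nu> \<noteq> 0" "Gamma (\<nu> / 2 + 1/2) \<noteq> 0" using n by (auto simp: Gamma_eq_zero_iff)
  have "exp ((1 - \<nu>) * of_real (ln 2)) = 2 powr (1 - \<nu>)"
    using Ln_of_real[of 2] by (simp add: powr_def)
  then have "Gamma (\<nu> / 2) * Gamma (\<nu> / 2 + 1/2) = 2 powr (1 - \<nu>) * of_real (sqrt pi) * Gamma \<nu>"
    using Gamma_legendre_duplication[OF n(1,2)] by simp
  then have dup: "rGamma \<nu> * Gamma (\<nu> / 2) = 2 powr (1 - \<nu>) * of_real (sqrt pi) * rGamma (\<nu> / 2 + 1/2)"
    using g by (simp add: rGamma_inverse_Gamma field_simps)
  have p: "2 powr (m / 2) * 2 powr (1 - \<nu>) = 4 * 2 powr (m / 2 - \<nu> - 1)"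
  proof -
    have "2 powr (m / 2) * 2 powr (1 - \<nu>) = 2 powr (2 + (m / 2 - \<nu> - 1))"
      unfolding powr_add[symmetric] by (simp add: algebra_simps)
    then show ?thesis unfolding powr_add by simp
  qed
  have "sin (of_real pi * m / 2) * Psi_laplace 1 \<nu> m 0 =
     s * (Gamma (m / 2) * Gamma (1 - m / 2)) * (rGamma \<nu> * Gamma (\<nu> / 2)) * 2 powr (m / 2) * rGamma (\<nu> / 2 + 1 - m / 2) / 4"
    unfolding Psi_laplace_at_0_Re_pos[OF assms] s_def by simp
  also have "\<dots> = of_real pi * (2 powr (m / 2) * 2 powr (1 - \<nu>)) * of_real (sqrt pi) * rGamma (\<nu> / 2 + 1/2) * rGamma (\<nu> / 2 + 1 - m / 2) / 4"
    unfolding refl dup using s0 by simp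
  also have "\<dots> = moment_value \<nu> m"
    unfolding p moment_value_def by simp
  finally show ?thesis .
qed

text \<open>The contiguous relations rewrite the derivative of \<open>x\<close> times the kernel as
  a combination of the kernels with first parameters \<open>\<nu> + 1\<close> and
  \<open>\<nu> - 1\<close> at the same \<open>m\<close>; its integral has no boundary terms.\<close>

lemma Psi_laplace_at_0_recurrence:
  assumes m: "m \<in> strip" "m \<noteq> 1"
  shows "Psi_laplace 1 (\<nu> - 1) m 0 = \<nu> * (\<nu> - m + 1) * Psi_laplace 1 (\<nu> + 1) m 0"
proof -
  note mI = strip_noninteger[OF m]
  have mI1: "m + 1 \<notin> \<int>" using mI Ints_diff[of "m + 1" 1] by auto
  \<comment> \<open>This is \<open>x\<close> times the kernel at \<open>w = 0\<close>, taken at a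
    complex argument so that complex differentiation rules apply.\<close>
  define G where "G z = z powr m * exp (- (z\<^sup>2 / 2)) * Kummer_Psi_nonint \<nu> m (z\<^sup>2)" for z
  define f where "f x = \<nu> * (\<nu> - m + 1) * laplace_integrand 1 (\<nu> + 1) m 0 x - laplace_integrand 1 (\<nu> - 1) m 0 x" for x
  have i: "set_integrable lborel {0<..} (laplace_integrand 1 a m 0)" for a
    using set_integrable_laplace[OF m(1), of 1 0 a] by simp
  have ic: "set_integrable lborel {0<..} (\<lambda>x. c * laplace_integrand 1 a m 0 x)" for a c
    using i by (rule set_integrable_mult_right)
  obtain r c \<eta> C n where r: "r > 0" and c: "c \<ge> 0" and eta: "\<eta> > 0" and C: "C \<ge> 0"
    and strip': "\<forall>z\<in>cball m r. z \<in> strip \<and> \<eta> + 2 * c \<le> Re z"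
    and Psi': "\<forall>z\<in>cball m r. \<forall>t. Re t \<ge> 0 \<longrightarrow> t \<noteq> 0 \<longrightarrow>
       norm (Kummer_Psi \<nu> z t) \<le> C * (norm t powr (- c) + norm t ^ n)"
    using Kummer_Psi_bound[OF m(1), of \<nu>] by (elim exE conjE) (rule that)
  have mr: "m \<in> cball m r" using r by simp
  have ec: "\<eta> + 2 * c \<le> Re m" using strip' mr by blast
  have Gle: "norm (G (of_real x)) \<le> C * (x powr (Re m - 2 * c) * exp (- (x\<^sup>2 / 2)) + x powr (Re m + 2 * real n) * exp (- (x\<^sup>2 / 2)))"
    if x: "x > 0" for x
  proof -
    have t: "Re ((complex_of_real x)\<^sup>2) \<ge> 0" "(complex_of_real x)\<^sup>2 \<noteq> 0" and nt: "norm ((complex_of_real x)\<^sup>2) = x powr 2"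
      using x by (simp_all add: norm_power flip: of_real_power)
    have "norm (Kummer_Psi \<nu> m ((of_real x)\<^sup>2)) \<le> C * (norm ((complex_of_real x)\<^sup>2) powr (- c) + norm ((complex_of_real x)\<^sup>2) ^ n)"
      using Psi' mr t by blast
    also have "norm ((complex_of_real x)\<^sup>2) powr (- c) = x powr (- 2 * c)"
      unfolding nt powr_powr by simp
    also have "norm ((complex_of_real x)\<^sup>2) ^ n = x powr (2 * real n)"
      unfolding nt using powr_realpow[of "x powr 2" n, symmetric] x by (simp only: powr_powr) simp
    finally have "norm (Kummer_Psi_nonint \<nu> m ((of_real x)\<^sup>2)) \<le> C * (x powr (- 2 * c) + x powr (2 * real n))"
      unfolding Kummer_Psi_strip_eq[OF m] .
    then have K: "x powr Re m * exp (- (x\<^sup>2 / 2)) * norm (Kummer_Psi_nonint \<nu> m ((of_real x)\<^sup>2))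
        \<le> x powr Re m * exp (- (x\<^sup>2 / 2)) * (C * (x powr (- 2 * c) + x powr (2 * real n)))"
      by (rule mult_left_mono) simp
    have E: "norm (exp (- ((complex_of_real x)\<^sup>2 / 2))) = exp (- (x\<^sup>2 / 2))"
      by (simp flip: of_real_power)
    have "norm (G (of_real x)) \<le> x powr Re m * exp (- (x\<^sup>2 / 2)) * (C * (x powr (- 2 * c) + x powr (2 * real n)))"
      unfolding G_def norm_mult norm_of_real_powr[OF x] E by (rule K)
    also have "\<dots> = C * ((x powr Re m * x powr (- 2 * c)) * exp (- (x\<^sup>2 / 2)) + (x powr Re m * x powr (2 * real n)) * exp (- (x\<^sup>2 / 2)))"
      by (simp add: algebra_simps)
    finally show ?thesis unfolding powr_add[symmetric] by simp
  qed
  \<comment> \<open>Positivity of the first exponent, guaranteed by the margin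
    \<open>\<eta>\<close>, makes the boundary term at \<open>0\<close> vanish.\<close>
  have pos: "Re m - 2 * c > 0" "Re m + 2 * real n > 0" using ec eta m by auto
  have "(LINT x:{0<..}|lborel. f x) = 0 - 0"
  proof (rule LINT_Ioi_FTC[where F="\<lambda>x. G (of_real x)"])
    show "continuous_on {0<..} f"
      unfolding f_def using m by (intro continuous_intros continuous_on_laplace_integrand) auto
    show "set_integrable lborel {0<..} f"
      unfolding f_def by (intro set_integral_diff ic i)
    show "((\<lambda>x. G (of_real x)) \<longlongrightarrow> 0) (at_right 0)"
    proof (rule Lim_null_comparison)
      show "\<forall>\<^sub>F x in at_right 0. norm (G (of_real x)) \<le> C * (x powr (Re m - 2 * c) * exp (- (x\<^sup>2 / 2)) + x powr (Re m + 2 * real n) * exp (- (x\<^sup>2 / 2)))"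
        using Gle by (auto simp: eventually_at_filter)
      have p: "((\<lambda>x. x powr b * exp (- (x\<^sup>2 / 2))) \<longlongrightarrow> 0) (at_right 0)" if "b > 0" for b :: real
      proof -
        have "((\<lambda>x::real. x powr b) \<longlongrightarrow> 0) (at_right 0)"
          using that by (intro tendsto_eq_intros) (auto simp: eventually_at_filter)
        moreover have "((\<lambda>x::real. exp (- (x\<^sup>2 / 2))) \<longlongrightarrow> exp (- (0\<^sup>2 / 2))) (at_right 0)"
          by (intro tendsto_intros) simp
        ultimately show ?thesis using tendsto_mult by fastforce
      qed
      have "((\<lambda>x. C * (x powr (Re m - 2 * c) * exp (- (x\<^sup>2 / 2)) + x powr (Re m + 2 * real n) * exp (- (x\<^sup>2 / 2)))) \<longlongrightarrow> C * (0 + 0)) (at_right 0)"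
        by (intro tendsto_mult tendsto_add tendsto_const p pos)
      then show "((\<lambda>x. C * (x powr (Re m - 2 * c) * exp (- (x\<^sup>2 / 2)) + x powr (Re m + 2 * real n) * exp (- (x\<^sup>2 / 2)))) \<longlongrightarrow> 0) (at_right 0)"
        by simp
    qed
    show "((\<lambda>x. G (of_real x)) \<longlongrightarrow> 0) at_top"
    proof (rule Lim_null_comparison)
      show "\<forall>\<^sub>F x in at_top. norm (G (of_real x)) \<le> C * (x powr (Re m - 2 * c) * exp (- (x\<^sup>2 / 2)) + x powr (Re m + 2 * real n) * exp (- (x\<^sup>2 / 2)))"
        using eventually_gt_at_top[of 0] by eventually_elim (rule Gle)
      have p: "((\<lambda>x. x powr b * exp (- (x\<^sup>2 / 2))) \<longlongrightarrow> 0) at_top" for b :: real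
        by real_asymp
      have "((\<lambda>x. C * (x powr (Re m - 2 * c) * exp (- (x\<^sup>2 / 2)) + x powr (Re m + 2 * real n) * exp (- (x\<^sup>2 / 2)))) \<longlongrightarrow> C * (0 + 0)) at_top"
        by (intro tendsto_mult tendsto_add tendsto_const p)
      then show "((\<lambda>x. C * (x powr (Re m - 2 * c) * exp (- (x\<^sup>2 / 2)) + x powr (Re m + 2 * real n) * exp (- (x\<^sup>2 / 2)))) \<longlongrightarrow> 0) at_top"
        by simp
    qed
    fix x :: real assume x: "x > 0"
    define z where "z = complex_of_real x"
    have z: "z \<noteq> 0" "z \<notin> \<real>\<^sub>\<le>\<^sub>0" "z\<^sup>2 \<notin> \<real>\<^sub>\<le>\<^sub>0" "z\<^sup>2 \<noteq> 0"
      using x a_square_notin_nonpos_Reals[of 1 x] by (auto simp: z_def)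
    define P where "P = z powr (m - 1)"
    define E where "E = exp (- (z\<^sup>2 / 2))"
    define K where "K = Kummer_Psi_nonint \<nu> m (z\<^sup>2)"
    define K1 where "K1 = Kummer_Psi_nonint (\<nu> + 1) (m + 1) (z\<^sup>2)"
    define Kp where "Kp = Kummer_Psi_nonint (\<nu> + 1) m (z\<^sup>2)"
    define Km where "Km = Kummer_Psi_nonint (\<nu> - 1) m (z\<^sup>2)"
    have zp: "z powr m = z * P" unfolding P_def using powr_add[of z 1 "m - 1"] z by simp
    have dK: "((\<lambda>z. Kummer_Psi_nonint \<nu> m (z\<^sup>2)) has_field_derivative (- \<nu> * K1) * (2 * z)) (at z)"
      unfolding K1_def
      by (rule DERIV_chain2[where f="Kummer_Psi_nonint \<nu> m" and g="\<lambda>z. z\<^sup>2"])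
         (use Kummer_Psi_nonint_has_derivative[OF mI z(3)] in \<open>auto intro!: derivative_eq_intros\<close>)
    have dG: "(G has_field_derivative (m * P * E - z * (z * P) * E) * K + z * P * E * (2 * z * (- \<nu> * K1))) (at z)"
      unfolding G_def[abs_def] P_def E_def K_def
      by (rule derivative_eq_intros has_field_derivative_powr z refl dK | simp)+
         (simp add: zp[unfolded P_def] algebra_simps)
    have down: "z\<^sup>2 * K1 = K - (\<nu> - m + 1) * Kp"
      using Kummer_Psi_nonint_down[OF mI1 z(4), of "\<nu> + 1"] by (simp add: K1_def K_def Kp_def)
    have low: "Km = (z\<^sup>2 + 2 * \<nu> - m) * K - \<nu> * (\<nu> - m + 1) * Kp"
      using Kummer_Psi_nonint_lower[OF mI z(4), of \<nu>] by (simp add: K_def Kp_def Km_def)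
    have "(m * P * E - z * (z * P) * E) * K + z * P * E * (2 * z * (- \<nu> * K1)) =
       P * E * (m * K - z\<^sup>2 * K - 2 * \<nu> * (z\<^sup>2 * K1))"
      by (simp add: algebra_simps power2_eq_square)
    also have "\<dots> = P * E * (\<nu> * (\<nu> - m + 1) * Kp - Km)"
      unfolding down low by (simp add: algebra_simps)
    also have "\<dots> = f x"
      unfolding f_def laplace_integrand_1[OF m] Kp_def Km_def P_def E_def z_def by (simp add: algebra_simps)
    finally show "((\<lambda>x. G (of_real x)) has_vector_derivative f x) (at x)"
      using has_vector_derivative_real_field[OF dG[unfolded z_def]] unfolding z_def by simp
  qed
  moreover have "(LINT x:{0<..}|lborel. f x) = \<nu> * (\<nu> - m + 1) * Psi_laplace 1 (\<nu> + 1) m 0 - Psi_laplace 1 (\<nu> - 1) m 0"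
    unfolding f_def Psi_laplace_def set_integral_diff(2)[OF ic i] set_integral_mult_right ..
  ultimately show ?thesis by simp
qed

text \<open>Both sides obey the same recurrence in steps of two, so the identity descends from
  \<open>Re \<nu> > 0\<close> to every \<open>\<nu>\<close>.\<close>

lemma sin_times_Psi_laplace_at_0:
  assumes m: "m \<in> strip" "m \<noteq> 1"
  shows "sin (of_real pi * m / 2) * Psi_laplace 1 \<nu> m 0 = moment_value \<nu> m"
proof -
  have "\<forall>\<nu>. Re \<nu> > - real n \<longrightarrow> sin (of_real pi * m / 2) * Psi_laplace 1 \<nu> m 0 = moment_value \<nu> m" for n
  proof (induction n)
    case 0
    then show ?case using sin_times_Psi_laplace_at_0_Re_pos[OF _ m] by simp
  next
    case (Suc n)
    show ?case
    proof (intro allI impI)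
      fix \<nu> :: complex assume nu: "Re \<nu> > - real (Suc n)"
      have IH: "sin (of_real pi * m / 2) * Psi_laplace 1 (\<nu> + 2) m 0 = moment_value (\<nu> + 2) m"
        using Suc nu by auto
      have "sin (of_real pi * m / 2) * Psi_laplace 1 \<nu> m 0 =
          (\<nu> + 1) * (\<nu> + 1 - m + 1) * (sin (of_real pi * m / 2) * Psi_laplace 1 (\<nu> + 2) m 0)"
        using Psi_laplace_at_0_recurrence[OF m, of "\<nu> + 1"] by (simp add: add.assoc)
      also have "\<dots> = moment_value \<nu> m"
        unfolding IH using moment_value_recurrence[of "\<nu> + 1" m] by (simp add: add.assoc)
      finally show "sin (of_real pi * m / 2) * Psi_laplace 1 \<nu> m 0 = moment_value \<nu> m" .
    qed
  qed
  moreover obtain n :: nat where "- Re \<nu> < real n" using reals_Archimedean2 by blast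
  ultimately show ?thesis by (metis minus_less_iff)
qed

text \<open>The initial values of the two families agree up to \<open>sqrt (2 * pi) / 2\<close>;
  this fixes the constant of proportionality for all parameters.\<close>

lemma moment_value_eq_D_product:
  "moment_value \<nu> m = of_real (sqrt (2 * pi)) / 2 * D_product (- \<nu>) (m - \<nu> - 1) 0"
proof -
  define r where "r = (of_real (sqrt 2) :: complex)"
  define s where "s = (of_real (sqrt pi) :: complex)"
  have rr: "r * r = 2" by (simp add: r_def flip: of_real_mult)
  have ss: "s * s = of_real pi" by (simp add: s_def flip: of_real_mult)
  have r2: "2 powr (1/2) = r"
    unfolding r_def using csqrt_of_real_nonneg[of 2] by (simp add: csqrt_conv_powr)
  have rs: "of_real (sqrt (2 * pi)) = r * s" by (simp add: r_def s_def real_sqrt_mult)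
  have "2 powr (- \<nu> / 2) * 2 powr ((m - \<nu> - 1) / 2) = 2 powr (1/2 + (m / 2 - \<nu> - 1))"
  proof -
    have "- \<nu> / 2 + (m - \<nu> - 1) / 2 = 1/2 + (m / 2 - \<nu> - 1)" by (simp add: field_simps)
    then show ?thesis unfolding powr_add[symmetric] by (simp only:)
  qed
  then have p: "2 powr (- \<nu> / 2) * 2 powr ((m - \<nu> - 1) / 2) = r * 2 powr (m / 2 - \<nu> - 1)"
    unfolding powr_add r2 .
  have e: "1 / 2 - - \<nu> / 2 = \<nu> / 2 + 1 / 2" "1 / 2 - (m - \<nu> - 1) / 2 = \<nu> / 2 + 1 - m / 2"
    by (simp_all add: field_simps)
  have "of_real (sqrt (2 * pi)) / 2 * D_product (- \<nu>) (m - \<nu> - 1) 0 =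
     r * s / 2 * (2 powr (- \<nu> / 2) * 2 powr ((m - \<nu> - 1) / 2)) * (s * s) * rGamma (\<nu> / 2 + 1 / 2) * rGamma (\<nu> / 2 + 1 - m / 2)"
    unfolding D_product_def minus_zero parabolic_D_0 e rs s_def[symmetric] by simp
  also have "\<dots> = (r * r) / 2 * (of_real pi * s * 2 powr (m / 2 - \<nu> - 1) * rGamma (\<nu> / 2 + 1 / 2) * rGamma (\<nu> / 2 + 1 - m / 2))"
    unfolding p ss by simp
  also have "\<dots> = moment_value \<nu> m" unfolding rr moment_value_def s_def by simp
  finally show ?thesis by simp
qed

text \<open>By Euler's formula this is the integral of \<open>sin (z * x + pi * m / 2)\<close>
  against the kernel with \<open>a = 1\<close>. Raising \<open>m\<close> by one turns the sine into
  the cosine that differentiation in \<open>z\<close> produces.\<close>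

definition sine_transform :: "complex \<Rightarrow> complex \<Rightarrow> complex \<Rightarrow> complex" where
  "sine_transform \<nu> m z = (exp (\<i> * (of_real pi * m / 2)) * Psi_laplace 1 \<nu> m (- (\<i> * z))
     - exp (- (\<i> * (of_real pi * m / 2))) * Psi_laplace 1 \<nu> m (\<i> * z)) / (2 * \<i>)"

lemma sine_transform_0: "sine_transform \<nu> m 0 = sin (of_real pi * m / 2) * Psi_laplace 1 \<nu> m 0"
  by (simp add: sine_transform_def sin_exp_eq field_simps)

lemma exp_i_half_pi_shift:
  "exp (\<i> * (of_real pi * (m + 1) / 2)) = \<i> * exp (\<i> * (of_real pi * m / 2))"
  "exp (- (\<i> * (of_real pi * (m + 1) / 2))) = - \<i> * exp (- (\<i> * (of_real pi * m / 2)))"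
proof -
  have e: "exp (\<i> * (of_real pi / 2)) = \<i>" "exp (- (\<i> * (of_real pi / 2))) = - \<i>"
    using cis_conv_exp[of "pi / 2"] cis_conv_exp[of "- pi / 2"] by (auto simp: complex_eq_iff)
  have "\<i> * (of_real pi * (m + 1) / 2) = \<i> * (of_real pi / 2) + \<i> * (of_real pi * m / 2)"
    by (simp add: field_simps)
  then show "exp (\<i> * (of_real pi * (m + 1) / 2)) = \<i> * exp (\<i> * (of_real pi * m / 2))"
    by (simp only: exp_add e)
  have "- (\<i> * (of_real pi * (m + 1) / 2)) = - (\<i> * (of_real pi / 2)) + - (\<i> * (of_real pi * m / 2))"
    by (simp add: field_simps)
  then show "exp (- (\<i> * (of_real pi * (m + 1) / 2))) = - \<i> * exp (- (\<i> * (of_real pi * m / 2)))"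
    by (simp only: exp_add e)
qed

lemma sine_transform_has_derivative:
  assumes "\<And>w. (Psi_laplace 1 \<nu> m has_field_derivative F w) (at w)"
  shows "(sine_transform \<nu> m has_field_derivative
     - (exp (\<i> * (of_real pi * m / 2)) * F (- (\<i> * z)) + exp (- (\<i> * (of_real pi * m / 2))) * F (\<i> * z)) / 2) (at z)"
proof -
  have 1: "((\<lambda>z. Psi_laplace 1 \<nu> m (- (\<i> * z))) has_field_derivative F (- (\<i> * z)) * (- \<i>)) (at z)"
    by (rule DERIV_chain2[OF assms]) (auto intro!: derivative_eq_intros)
  have 2: "((\<lambda>z. Psi_laplace 1 \<nu> m (\<i> * z)) has_field_derivative F (\<i> * z) * \<i>) (at z)"
    by (rule DERIV_chain2[OF assms]) (auto intro!: derivative_eq_intros)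
  show ?thesis
    unfolding sine_transform_def[abs_def]
    by (rule DERIV_cong[OF DERIV_cdivide[OF DERIV_diff[OF DERIV_cmult[OF 1] DERIV_cmult[OF 2]]]])
       (simp add: field_simps)
qed

lemma sine_transform_derivative_up:
  assumes "m \<in> strip" "Re m < 1"
  shows "(sine_transform \<nu> m has_field_derivative
     - \<nu> * sine_transform (\<nu> + 1) (m + 1) z + sine_transform \<nu> (m + 1) z) (at z)"
  by (rule DERIV_cong[OF sine_transform_has_derivative[OF Psi_laplace_derivative_up[OF assms]]])
     (simp only: sine_transform_def exp_i_half_pi_shift, simp add: field_simps)

lemma sine_transform_derivative_down:
  assumes "m \<in> strip" "Re m > 1"
  shows "(sine_transform \<nu> m has_field_derivative
     - sine_transform (\<nu> - 1) (m - 1) z - (m - \<nu> - 1) * sine_transform \<nu> (m - 1) z) (at z)"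
proof -
  have e: "exp (\<i> * (of_real pi * m / 2)) = \<i> * exp (\<i> * (of_real pi * (m - 1) / 2))"
      "exp (- (\<i> * (of_real pi * m / 2))) = - \<i> * exp (- (\<i> * (of_real pi * (m - 1) / 2)))"
    using exp_i_half_pi_shift[of "m - 1"] by simp_all
  show ?thesis
    by (rule DERIV_cong[OF sine_transform_has_derivative[OF Psi_laplace_derivative_down[OF assms]]])
       (simp only: sine_transform_def e, simp add: field_simps)
qed

lemma sine_transform_holomorphic:
  assumes "m \<in> strip"
  shows "sine_transform \<nu> m holomorphic_on A"
proof -
  have h: "(\<lambda>z. Psi_laplace 1 \<nu> m (f z)) holomorphic_on A" if "f holomorphic_on A" for f
    using holomorphic_on_compose_gen[OF that Psi_laplace_holomorphic[OF assms, of 1 \<nu> UNIV]] by (simp add: o_def)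
  show ?thesis
    unfolding sine_transform_def by (intro holomorphic_intros h) auto
qed

text \<open>Both sides satisfy the same derivative relations, which move \<open>m\<close> back and forth between the
  two halves of the strip; so all their derivatives at \<open>0\<close> agree.\<close>

lemma sine_transform_eq_D_product_aux:
  assumes m: "m \<in> strip" "Re m \<noteq> 1"
  shows "sine_transform \<nu> m z = of_real (sqrt (2 * pi)) / 2 * D_product (- \<nu>) (m - \<nu> - 1) z"
proof -
  define \<kappa> where "\<kappa> = (of_real (sqrt (2 * pi)) / 2 :: complex)"
  \<comment> \<open>The statement must cover all parameters, as the next derivative involves
    \<open>m + 1\<close> or \<open>m - 1\<close>. For \<open>Re m\<close> other than
    \<open>1\<close> the appropriate neighbour is in the strip and again off that line.\<close>
  have "\<forall>\<nu> m. m \<in> strip \<longrightarrow> Re m \<noteq> 1 \<longrightarrow>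
      (deriv ^^ n) (sine_transform \<nu> m) 0 = (deriv ^^ n) (\<lambda>z. \<kappa> * D_product (- \<nu>) (m - \<nu> - 1) z) 0" for n
  proof (induction n)
    case 0
    show ?case
    proof (intro allI impI)
      fix \<nu> m :: complex assume m: "m \<in> strip" "Re m \<noteq> 1"
      then have "m \<noteq> 1" by auto
      then show "(deriv ^^ 0) (sine_transform \<nu> m) 0 = (deriv ^^ 0) (\<lambda>z. \<kappa> * D_product (- \<nu>) (m - \<nu> - 1) z) 0"
        using sin_times_Psi_laplace_at_0[OF m(1)] moment_value_eq_D_product[of \<nu> m]
        by (simp add: sine_transform_0 \<kappa>_def)
    qed
  next
    case (Suc n)
    show ?case
    proof (intro allI impI)
      fix \<nu> m :: complex assume m: "m \<in> strip" "Re m \<noteq> 1"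
      note hc = higher_deriv_cmult[where A=UNIV] and hs = higher_deriv_diff[where S=UNIV] and ha = higher_deriv_add[where S=UNIV]
      have D: "(\<lambda>z. c * D_product p q z) holomorphic_on UNIV" for c p q
        by (intro holomorphic_intros D_product_holomorphic)
      show "(deriv ^^ Suc n) (sine_transform \<nu> m) 0 = (deriv ^^ Suc n) (\<lambda>z. \<kappa> * D_product (- \<nu>) (m - \<nu> - 1) z) 0"
      proof (cases "Re m < 1")
        case True
        have m': "m + 1 \<in> strip" "Re (m + 1) \<noteq> 1" using m True by auto
        have S: "(\<lambda>z. c * sine_transform a (m + 1) z) holomorphic_on UNIV" "sine_transform a (m + 1) holomorphic_on UNIV" for a c
          by (intro holomorphic_intros sine_transform_holomorphic m')+
        have 1: "deriv (sine_transform \<nu> m) = (\<lambda>z. - \<nu> * sine_transform (\<nu> + 1) (m + 1) z + sine_transform \<nu> (m + 1) z)"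
          using sine_transform_derivative_up[OF m(1) True] by (intro ext DERIV_imp_deriv)
        have 2: "deriv (\<lambda>z. \<kappa> * D_product (- \<nu>) (m - \<nu> - 1) z) =
            (\<lambda>z. - \<nu> * (\<kappa> * D_product (- (\<nu> + 1)) (m + 1 - (\<nu> + 1) - 1) z) + \<kappa> * D_product (- \<nu>) (m + 1 - \<nu> - 1) z)"
        proof -
          have e: "- (\<nu> + 1) = - \<nu> - 1" "m + 1 - (\<nu> + 1) - 1 = m - \<nu> - 1" "m + 1 - \<nu> - 1 = m - \<nu> - 1 + 1"
            by simp_all
          show ?thesis unfolding e
            by (intro ext DERIV_imp_deriv DERIV_cong[OF DERIV_cmult[OF D_product_has_derivative_up]])
               (simp only: distrib_left mult_ac)
        qed
        have DD: "(\<lambda>z. - \<nu> * (\<kappa> * D_product p q z)) holomorphic_on UNIV" for p q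
          by (intro holomorphic_intros D_product_holomorphic)
        show ?thesis
          unfolding funpow_Suc_right o_apply 1 2 ha[OF S(1) S(2) open_UNIV UNIV_I] ha[OF DD D open_UNIV UNIV_I]
            hc[OF S(2) UNIV_I open_UNIV] hc[OF D UNIV_I open_UNIV]
          using Suc m' by simp
      next
        case False
        then have gt: "Re m > 1" using m by simp
        have m': "m - 1 \<in> strip" "Re (m - 1) \<noteq> 1" using m gt by auto
        have S: "(\<lambda>z. c * sine_transform a (m - 1) z) holomorphic_on UNIV" for a c
          by (intro holomorphic_intros sine_transform_holomorphic m')
        have S1: "sine_transform a (m - 1) holomorphic_on UNIV" for a
          by (intro sine_transform_holomorphic m')
        have 1: "deriv (sine_transform \<nu> m) =
            (\<lambda>z. (- 1) * sine_transform (\<nu> - 1) (m - 1) z - (m - \<nu> - 1) * sine_transform \<nu> (m - 1) z)"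
          using sine_transform_derivative_down[OF m(1) gt] by (intro ext DERIV_imp_deriv) simp
        have 2: "deriv (\<lambda>z. \<kappa> * D_product (- \<nu>) (m - \<nu> - 1) z) =
            (\<lambda>z. (- 1) * (\<kappa> * D_product (- (\<nu> - 1)) (m - 1 - (\<nu> - 1) - 1) z)
               - (m - \<nu> - 1) * (\<kappa> * D_product (- \<nu>) (m - 1 - \<nu> - 1) z))"
        proof -
          have e: "- (\<nu> - 1) = - \<nu> + 1" "m - 1 - (\<nu> - 1) - 1 = m - \<nu> - 1" "m - 1 - \<nu> - 1 = m - \<nu> - 1 - 1"
            by simp_all
          show ?thesis unfolding e
            by (intro ext DERIV_imp_deriv DERIV_cong[OF DERIV_cmult[OF D_product_has_derivative_down]])
               (simp only: right_diff_distrib mult_minus_right mult_minus_left mult_1 mult_ac)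
        qed
        have DD: "(\<lambda>z. c * (\<kappa> * D_product p q z)) holomorphic_on UNIV" for c p q
          by (intro holomorphic_intros D_product_holomorphic)
        show ?thesis
          unfolding funpow_Suc_right o_apply 1 2 hs[OF S S open_UNIV UNIV_I] hs[OF DD DD open_UNIV UNIV_I]
            hc[OF S1 UNIV_I open_UNIV] hc[OF D UNIV_I open_UNIV]
          using Suc m' by simp
      qed
    qed
  qed
  then have "(deriv ^^ n) (sine_transform \<nu> m) 0 = (deriv ^^ n) (\<lambda>z. \<kappa> * D_product (- \<nu>) (m - \<nu> - 1) z) 0" for n
    using m by blast
  then have "sine_transform \<nu> m z = \<kappa> * D_product (- \<nu>) (m - \<nu> - 1) z"
    by (rule holomorphic_fun_eq_on_connected[of _ UNIV _ 0 z, rotated 4])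
       (auto intro!: holomorphic_intros sine_transform_holomorphic D_product_holomorphic m(1) simp del: mem_Collect_eq)
  then show ?thesis by (simp add: \<kappa>_def)
qed

lemma sine_transform_index_holomorphic: "(\<lambda>m. sine_transform \<nu> m z) holomorphic_on strip"
  unfolding sine_transform_def
  by (intro holomorphic_intros Psi_laplace_index_holomorphic) auto

lemma sine_transform_eq_D_product:
  assumes m: "m \<in> strip"
  shows "sine_transform \<nu> m z = of_real (sqrt (2 * pi)) / 2 * D_product (- \<nu>) (m - \<nu> - 1) z"
proof (rule analytic_continuation_open[where s="{m. 0 < Re m} \<inter> {m. Re m < 1}" and s'=strip
    and f="\<lambda>m. sine_transform \<nu> m z"])
  show "{m. 0 < Re m} \<inter> {m. Re m < 1} \<noteq> {}"
  proof -
    have "1 / 2 \<in> {m. 0 < Re m} \<inter> {m. Re m < 1}" by simp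
    then show ?thesis by blast
  qed
  have "convex ({m. 0 < Re m} \<inter> {m. Re m < 2})"
    by (intro convex_Int convex_halfspace_Re_gt convex_halfspace_Re_lt)
  then show "connected strip" by (simp add: Int_def convex_connected)
  have "(\<lambda>m. parabolic_D (m - \<nu> - 1) (- z)) holomorphic_on strip"
  proof -
    have "(\<lambda>m. m - \<nu> - 1) holomorphic_on strip" by (intro holomorphic_intros)
    from holomorphic_on_compose_gen[OF this parabolic_D_index_holomorphic] show ?thesis by (simp add: o_def)
  qed
  then show "(\<lambda>m. of_real (sqrt (2 * pi)) / 2 * D_product (- \<nu>) (m - \<nu> - 1) z) holomorphic_on strip"
    unfolding D_product_def by (intro holomorphic_intros)
qed (use m sine_transform_index_holomorphic sine_transform_eq_D_product_aux open_strip in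
    \<open>auto intro!: open_Int open_halfspace_Re_gt open_halfspace_Re_lt\<close>)

section \<open>General \<open>a\<close> and Abel summation\<close>

text \<open>Rescaling \<open>x\<close> by \<open>sqrt \<alpha>\<close> turns
  \<open>\<alpha> * x^2\<close> into \<open>x^2\<close>; the measure and the factor
  \<open>x powr (m - 1)\<close> together produce the power of \<open>\<alpha>\<close>.\<close>

lemma Psi_laplace_of_real:
  assumes m: "m \<in> strip" and \<alpha>: "\<alpha> > 0"
  shows "Psi_laplace (of_real \<alpha>) \<nu> m w = of_real \<alpha> powr (- m / 2) * Psi_laplace 1 \<nu> m (w / csqrt (of_real \<alpha>))"
proof -
  define b where "b = sqrt \<alpha>"
  have b: "b > 0" "b\<^sup>2 = \<alpha>" using \<alpha> by (auto simp: b_def)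
  have sq: "csqrt (of_real \<alpha>) = of_real b"
    using csqrt_of_real_nonneg[of \<alpha>] \<alpha> by (simp add: b_def)
  have pw: "of_real b powr m = complex_of_real \<alpha> powr (m / 2)"
  proof -
    have "ln \<alpha> = 2 * ln b" unfolding b(2)[symmetric] using b(1) by (simp add: ln_realpow)
    then have "Ln (complex_of_real \<alpha>) = 2 * Ln (of_real b)"
      using b(1) \<alpha> by (simp add: Ln_of_real)
    then show ?thesis using b(1) \<alpha> by (simp add: powr_def)
  qed
  have l: "laplace_integrand 1 \<nu> m (w / of_real b) (b * x) = of_real b powr (m - 1) * laplace_integrand (of_real \<alpha>) \<nu> m w x"
    if "x > 0" for x
  proof -
    have "complex_of_real (b * x) powr (m - 1) = of_real b powr (m - 1) * of_real x powr (m - 1)"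
      unfolding of_real_mult using b(1) that by (intro powr_times_real) auto
    moreover have "(complex_of_real (b * x))\<^sup>2 = of_real \<alpha> * (of_real x)\<^sup>2"
      unfolding b(2)[symmetric] by (simp add: power_mult_distrib)
    ultimately show ?thesis
      using b(1) by (simp add: laplace_integrand_def Psi_kernel_def)
  qed
  have "Psi_laplace 1 \<nu> m (w / of_real b) = b *\<^sub>R (LINT x:{0<..}|lborel. laplace_integrand 1 \<nu> m (w / of_real b) (b * x))"
    unfolding Psi_laplace_def by (rule LINT_Ioi_scale(2)[OF b(1)])
  also have "(LINT x:{0<..}|lborel. laplace_integrand 1 \<nu> m (w / of_real b) (b * x)) =
      of_real b powr (m - 1) * Psi_laplace (of_real \<alpha>) \<nu> m w"
    unfolding Psi_laplace_def set_integral_mult_right[symmetric] using l by (intro set_lebesgue_integral_cong) auto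
  also have "b *\<^sub>R (of_real b powr (m - 1) * Psi_laplace (of_real \<alpha>) \<nu> m w) = of_real b powr m * Psi_laplace (of_real \<alpha>) \<nu> m w"
    using powr_add[of "of_real b" 1 "m - 1"] b(1) by (simp add: scaleR_conv_of_real)
  finally have "Psi_laplace 1 \<nu> m (w / of_real b) = of_real \<alpha> powr (m / 2) * Psi_laplace (of_real \<alpha>) \<nu> m w"
    unfolding pw .
  moreover have "of_real \<alpha> powr (- m / 2) * of_real \<alpha> powr (m / 2) = (1 :: complex)"
    using \<alpha> by (simp flip: powr_add)
  ultimately show ?thesis unfolding sq by (simp flip: mult.assoc)
qed

text \<open>Entire in \<open>w\<close> for every nonzero \<open>a\<close>, also when the defining
  integral of the transform diverges; this is the function to which Abel's theorem will be
  applied.\<close>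

definition Psi_laplace_extension :: "complex \<Rightarrow> complex \<Rightarrow> complex \<Rightarrow> complex \<Rightarrow> complex" where
  "Psi_laplace_extension a \<nu> m w = a powr (- m / 2) * Psi_laplace 1 \<nu> m (w / csqrt a)"

lemma Psi_laplace_extension_holomorphic:
  assumes "m \<in> strip" and "a \<noteq> 0" and "f holomorphic_on A"
  shows "(\<lambda>s. Psi_laplace_extension a \<nu> m (f s)) holomorphic_on A"
proof -
  have "(\<lambda>s. f s / csqrt a) holomorphic_on A" using assms by (intro holomorphic_intros) auto
  from holomorphic_on_compose_gen[OF this Psi_laplace_holomorphic[OF assms(1), of 1 \<nu> UNIV]] show ?thesis
    unfolding Psi_laplace_extension_def by (intro holomorphic_intros) (simp add: o_def)
qed

lemma Psi_laplace_eq_extension_Re_pos: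
  assumes m: "m \<in> strip" and a: "Re a > 0"
  shows "Psi_laplace a \<nu> m w = Psi_laplace_extension a \<nu> m w"
proof -
  have notneg: "a \<notin> \<real>\<^sub>\<le>\<^sub>0" "a \<noteq> 0" if "Re a > 0" for a
    using that by (auto simp: complex_nonpos_Reals_iff)
  have "Psi_laplace a \<nu> m w - Psi_laplace_extension a \<nu> m w = 0"
  proof (rule analytic_continuation[where f="\<lambda>a. Psi_laplace a \<nu> m w - Psi_laplace_extension a \<nu> m w"])
    have "(\<lambda>a. w / csqrt a) holomorphic_on {a. Re a > 0}"
      using notneg by (intro holomorphic_intros) auto
    from holomorphic_on_compose_gen[OF this Psi_laplace_holomorphic[OF m, of 1 \<nu> UNIV]]
    show "(\<lambda>a. Psi_laplace a \<nu> m w - Psi_laplace_extension a \<nu> m w) holomorphic_on {a. Re a > 0}"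
      unfolding Psi_laplace_extension_def using notneg
      by (intro holomorphic_intros Psi_laplace_holomorphic_param m) (auto simp: o_def)
    show "open {a. Re a > 0}" "connected {a. Re a > 0}"
      by (auto intro: open_halfspace_Re_gt convex_connected convex_halfspace_Re_gt)
    show "of_real ` {0<..} \<subseteq> {a. Re a > 0}" "(1 :: complex) \<in> {a. Re a > 0}" "a \<in> {a. Re a > 0}"
      using a by auto
    show "(1 :: complex) islimpt of_real ` {0<..}"
      unfolding islimpt_approachable
    proof (intro allI impI)
      fix e :: real assume e: "e > 0"
      have "dist (complex_of_real (1 + e / 2)) 1 = e / 2"
        using e by (simp add: dist_norm)
      then show "\<exists>x'\<in>of_real ` {0<..}. x' \<noteq> (1 :: complex) \<and> dist x' 1 < e"
        using e by (intro bexI[of _ "of_real (1 + e / 2)"] imageI) (auto simp: complex_eq_iff)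
    qed
    show "Psi_laplace z \<nu> m w - Psi_laplace_extension z \<nu> m w = 0" if "z \<in> of_real ` {0<..}" for z
      using that Psi_laplace_of_real[OF m] by (auto simp: Psi_laplace_extension_def)
  qed
  then show ?thesis by simp
qed

lemma Psi_laplace_eq_extension:
  assumes m: "m \<in> strip" and a: "Re a \<ge> 0" "a \<noteq> 0" and w: "Re w > 0"
  shows "Psi_laplace a \<nu> m w = Psi_laplace_extension a \<nu> m w"
proof -
  define b where "b n = a + of_real (1 / (real n + 1))" for n
  have lim0: "(\<lambda>n. 1 / (real n + 1)) \<longlonglongrightarrow> 0" by real_asymp
  then have b: "b \<longlonglongrightarrow> a"
    unfolding b_def using tendsto_add[OF tendsto_const tendsto_of_real[OF lim0], of a] by simp
  have bp: "Re (b n) > 0" for n using a by (simp add: b_def add_nonneg_pos del: of_real_divide)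
  \<comment> \<open>A nonzero \<open>a\<close> on the imaginary axis is off the cut, so
    \<open>csqrt\<close> and the complex power are continuous at it.\<close>
  have an: "a \<notin> \<real>\<^sub>\<le>\<^sub>0" using a by (auto simp: complex_nonpos_Reals_iff complex_eq_iff)
  have "isCont (Psi_laplace 1 \<nu> m) (w / csqrt a)"
    using Psi_laplace_has_derivative[OF m, of 1] by (auto intro: DERIV_isCont)
  then have "(\<lambda>n. Psi_laplace 1 \<nu> m (w / csqrt (b n))) \<longlonglongrightarrow> Psi_laplace 1 \<nu> m (w / csqrt a)"
    by (rule isCont_tendsto_compose)
       (intro tendsto_intros isCont_tendsto_compose[OF continuous_at_csqrt[OF an] b], use a in auto)
  then have "(\<lambda>n. Psi_laplace_extension (b n) \<nu> m w) \<longlonglongrightarrow> Psi_laplace_extension a \<nu> m w"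
    unfolding Psi_laplace_extension_def by (intro tendsto_mult tendsto_powr_complex b tendsto_const an)
  moreover have "(\<lambda>n. Psi_laplace_extension (b n) \<nu> m w) \<longlonglongrightarrow> Psi_laplace a \<nu> m w"
    using Psi_laplace_boundary_limit[OF assms] Psi_laplace_eq_extension_Re_pos[OF m bp] by (simp add: b_def)
  ultimately show ?thesis by (rule LIMSEQ_unique[symmetric])
qed

text \<open>An integral over an unbounded set is by definition approximated over all large boxes;
  the symmetric box meets the half-line in \<open>{0..X}\<close>.\<close>

lemma integral_tendsto_at_top:
  fixes h :: "real \<Rightarrow> complex"
  assumes "h integrable_on {0..}"
  shows "((\<lambda>X. integral {0..X} h) \<longlongrightarrow> integral {0..} h) at_top"
proof (rule tendstoI)
  fix e :: real assume e: "e > 0"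
  define g where "g = (\<lambda>x. if x \<in> {0..} then h x else 0)"
  have hI: "(h has_integral integral {0..} h) {0..}" using assms by (rule integrable_integral)
  \<comment> \<open>The half-line is not a box, so the clause of the definition for unbounded
    domains applies.\<close>
  have nc: "\<not> (\<exists>a b. {0..} = cbox a (b::real))"
  proof
    assume "\<exists>a b. {0..} = cbox a (b::real)"
    then have "bounded {0::real..}" using bounded_cbox by metis
    then obtain B where "\<And>x. x \<in> {0::real..} \<Longrightarrow> norm x \<le> B" by (auto simp: bounded_iff)
    from this[of "\<bar>B\<bar> + 1"] show False by simp
  qed
  obtain B where B: "B > 0"
      "\<forall>a b. ball 0 B \<subseteq> cbox a b \<longrightarrow> (\<exists>z. (g has_integral z) (cbox a b) \<and> norm (z - integral {0..} h) < e)"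
    by (rule has_integral_altD[OF hI nc e]) (rule that, simp, simp only: g_def)
  have "dist (integral {0..X} h) (integral {0..} h) < e" if X: "X \<ge> B" for X
  proof -
    have "ball 0 B \<subseteq> cbox (- X) X" using X by (auto simp: dist_norm)
    then obtain z where z: "(g has_integral z) (cbox (- X) X)" "norm (z - integral {0..} h) < e" using B(2) by blast
    have "(h has_integral z) (cbox (- X) X \<inter> {0..})"
      using z(1) has_integral_restrict_Int[of "{0..}" h z "cbox (- X) X"] by (simp add: g_def Int_commute)
    moreover have "cbox (- X) X \<inter> {0..} = {0..X}" using X B(1) by auto
    ultimately have "(h has_integral z) {0..X}" by (simp only:)
    then have "integral {0..X} h = z" by (rule integral_unique)
    then show ?thesis using z(2) by (simp add: dist_norm)
  qed
  then show "\<forall>\<^sub>F X in at_top. dist (integral {0..X} h) (integral {0..} h) < e"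
    by (auto simp: eventually_at_top_linorder)
qed

text \<open>Abel's theorem: integration by parts gives \<open>G s = s * L s\<close> with \<open>L\<close> the Laplace transform of the
  primitive of \<open>h\<close>, first for large real \<open>s\<close> and then, by the identity theorem, for \<open>Re s > 0\<close>.\<close>

lemma Abel_integral:
  fixes h :: "real \<Rightarrow> complex"
  assumes h: "h integrable_on {0..}" and cont: "continuous_on {0<..} h"
    and G: "G holomorphic_on UNIV"
    and int: "\<And>e. e \<ge> E \<Longrightarrow> set_integrable lborel {0<..} (\<lambda>x. exp (- (of_real e * of_real x)) * h x)"
    and eq: "\<And>e. e \<ge> E \<Longrightarrow> (LINT x:{0<..}|lborel. exp (- (of_real e * of_real x)) * h x) = G (of_real e)"
  shows "integral {0..} h = G 0"
proof -
  define I where "I = integral {0..} h"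
  define H where "H X = integral {0..X} h" for X
  have sub: "h integrable_on {0..b}" for b
    using integrable_on_subinterval[OF h, of 0 b] by auto
  have lim: "(H \<longlongrightarrow> I) at_top"
    unfolding H_def I_def by (rule integral_tendsto_at_top[OF h])
  have Hc: "continuous_on {0..b} H" for b
    unfolding H_def by (rule indefinite_integral_continuous_1[OF sub])
  have H0: "H 0 = 0" by (simp add: H_def)
  have Hd: "(H has_vector_derivative h x) (at x)" if x: "x > 0" for x
  proof -
    have "isCont h x" using cont x by (simp add: continuous_on_eq_continuous_at)
    then have "continuous (at x within ({0..x + 1} - {})) h"
      using continuous_at_imp_continuous_at_within by blast
    from integral_has_vector_derivative_continuous_at[OF sub _ _ this] x
    have "(H has_vector_derivative h x) (at x within {0..x + 1})"
      by (simp add: H_def[abs_def])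
    moreover have "at x within {0..x + 1} = at x"
      by (rule at_within_Icc_at) (use x in auto)
    ultimately show ?thesis by (simp only:)
  qed
  have Hcont: "continuous_on {0<..} H"
    by (rule continuous_on_vector_derivative, rule has_vector_derivative_at_within, rule Hd) simp
  \<comment> \<open>The primitive is continuous and has a limit at infinity, hence is bounded; its
    Laplace transform therefore exists for every \<open>s\<close> with
    \<open>Re s > 0\<close>.\<close>
  obtain M where M: "M \<ge> 0" "\<And>x. x \<ge> 0 \<Longrightarrow> norm (H x) \<le> M"
  proof -
    have "\<forall>\<^sub>F x in at_top. dist (H x) I < 1" using tendstoD[OF lim] by simp
    then obtain X where X: "\<And>x. x \<ge> X \<Longrightarrow> dist (H x) I < 1" by (auto simp: eventually_at_top_linorder)
    have "bounded (H ` {0..X})" by (intro compact_imp_bounded compact_continuous_image Hc) simp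
    then obtain C where C: "\<And>x. x \<in> {0..X} \<Longrightarrow> norm (H x) \<le> C"
      unfolding bounded_iff by blast
    have "norm (H x) \<le> max 0 (max C (norm I + 1))" if "x \<ge> 0" for x
    proof (cases "x \<le> X")
      case True
      then show ?thesis using C[of x] that by simp
    next
      case False
      then show ?thesis using X[of x] norm_triangle_ineq2[of "H x" I] by (simp add: dist_norm)
    qed
    then show ?thesis by (intro that[of "max 0 (max C (norm I + 1))"]) auto
  qed
  define l where "l s x = exp (- (s * of_real x)) * H x" for s and x :: real
  have nl: "norm (l s x) \<le> M * exp (- (\<tau> * x))" if "\<tau> \<le> Re s" "x > 0" for s x \<tau>
  proof -
    have "norm (exp (- (s * of_real x))) \<le> exp (- (\<tau> * x))"
      using that by (simp add: mult_right_mono)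
    then show ?thesis using M(2)[of x] that M(1) unfolding l_def norm_mult
      by (subst mult.commute) (intro mult_mono, auto)
  qed
  have exp_int: "set_integrable lborel {0<..} (\<lambda>x. M * exp (- (\<tau> * x)))" if "\<tau> > 0" for \<tau> :: real
  proof -
    have "set_integrable lborel {0<..} (\<lambda>x. x powr (1 - 1) * exp (- (\<tau> * x)))"
      using LINT_Gamma_real(1)[of 1 \<tau>] that by simp
    moreover have "x powr (1 - 1) * exp (- (\<tau> * x)) = exp (- (\<tau> * x))" if "x \<in> {0<..}" for x
      using that by simp
    ultimately have "set_integrable lborel {0<..} (\<lambda>x. exp (- (\<tau> * x)))"
      by (rule iffD1[OF set_integrable_cong[OF refl refl], rotated])
    then show ?thesis by (rule set_integrable_mult_right)
  qed
  have lmeas: "set_borel_measurable borel {0<..} (l s)" for s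
    unfolding l_def by (intro set_borel_measurable_Ioi continuous_intros Hcont)
  have lint: "set_integrable lborel {0<..} (l s)" if "Re s > 0" for s
    by (rule set_integrable_Ioi_bound[OF exp_int[OF that] lmeas nl]) auto
  define L where "L s = (LINT x:{0<..}|lborel. l s x)" for s
  have Lhol: "L holomorphic_on {s. Re s > 0}"
    unfolding L_def
  proof (rule holomorphic_on_parametric_integral[OF open_halfspace_Re_gt _ _ lmeas])
    show "(\<lambda>s. l s x) holomorphic_on {s. 0 < Re s}" for x
      unfolding l_def by (intro holomorphic_intros)
    fix z :: complex assume "z \<in> {s. 0 < Re s}"
    then have z: "Re z > 0" by simp
    have Rew: "Re w \<ge> Re z / 2" if "w \<in> cball z (Re z / 2)" for w
      using that abs_Re_le_cmod[of "z - w"] by (auto simp: dist_norm abs_le_iff)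
    show "\<exists>r>0. \<exists>h. set_integrable lborel {0<..} h \<and> (\<forall>w\<in>cball z r. w \<in> {s. 0 < Re s} \<and> (\<forall>x\<in>{0<..}. norm (l w x) \<le> h x))"
    proof (intro exI[of _ "Re z / 2"] exI[of _ "\<lambda>x. M * exp (- (Re z / 2 * x))"] conjI ballI)
      show "set_integrable lborel {0<..} (\<lambda>x. M * exp (- (Re z / 2 * x)))" using z by (intro exp_int) simp
      fix w assume w: "w \<in> cball z (Re z / 2)"
      show "w \<in> {s. 0 < Re s}" using Rew[OF w] z by simp
      show "norm (l w x) \<le> M * exp (- (Re z / 2 * x))" if "x \<in> {0<..}" for x
        using nl[OF Rew[OF w], of x] that by simp
    qed (use z in simp)
  qed simp
  have parts: "G (of_real e) = of_real e * L (of_real e)" if e: "e \<ge> E" "e > 0" for e :: real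
  proof -
    define f where "f x = exp (- (of_real e * of_real x)) * h x - of_real e * l (of_real e) x" for x
    have li: "set_integrable lborel {0<..} (\<lambda>x. of_real e * l (of_real e) x)"
      using lint[of "of_real e"] e by (intro set_integrable_mult_right) simp
    have "(LINT x:{0<..}|lborel. f x) = 0 - 0"
    proof (rule LINT_Ioi_FTC[where F="l (of_real e)"])
      show "(l (of_real e) has_vector_derivative f x) (at x)" if x: "x > 0" for x
      proof -
        have "((\<lambda>x. exp (- (of_real e * complex_of_real x))) has_vector_derivative - of_real e * exp (- (of_real e * of_real x))) (at x)"
          by (rule has_vector_derivative_real_field[where f="\<lambda>x. exp (- (of_real e * x))"])
             (auto intro!: derivative_eq_intros)
        from has_vector_derivative_mult[OF this Hd[OF x]] show ?thesis
          unfolding l_def[abs_def] f_def by (simp add: algebra_simps)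
      qed
      show "continuous_on {0<..} f"
        unfolding f_def l_def by (intro continuous_intros cont Hcont)
      show "set_integrable lborel {0<..} f"
        unfolding f_def by (intro set_integral_diff int[OF e(1)] li)
      have "((\<lambda>x. exp (- (of_real e * of_real x)) * H x) \<longlongrightarrow> exp (- (of_real e * of_real 0)) * H 0) (at_right 0)"
        using Hc[of 1] by (intro tendsto_intros) (auto simp: continuous_on_eq_continuous_within continuous_within at_within_Icc_at_right dest!: bspec[of _ _ 0])
      then show "(l (of_real e) \<longlongrightarrow> 0) (at_right 0)" by (simp add: l_def[abs_def] H0)
      show "(l (of_real e) \<longlongrightarrow> 0) at_top"
      proof (rule Lim_null_comparison)
        show "\<forall>\<^sub>F x in at_top. norm (l (of_real e) x) \<le> M * exp (- (e * x))"
          using eventually_gt_at_top[of 0] by eventually_elim (rule nl, auto)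
        show "((\<lambda>x. M * exp (- (e * x))) \<longlongrightarrow> 0) at_top"
          using e(2) by real_asymp
      qed
    qed
    then have "(LINT x:{0<..}|lborel. exp (- (of_real e * of_real x)) * h x) = of_real e * L (of_real e)"
      unfolding f_def set_integral_diff(2)[OF int[OF e(1)] li] set_integral_mult_right L_def by simp
    then show ?thesis using eq[OF e(1)] by simp
  qed
  \<comment> \<open>A positive start keeps the ray inside the half-plane on which \<open>L\<close>
    is holomorphic.\<close>
  define e0 where "e0 = max E 1"
  have GL: "G s - s * L s = 0" if s: "Re s > 0" for s
  proof (rule analytic_continuation[where f="\<lambda>s. G s - s * L s"])
    show "(\<lambda>s. G s - s * L s) holomorphic_on {s. Re s > 0}"
      by (intro holomorphic_intros Lhol holomorphic_on_subset[OF G]) auto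
    show "open {s. Re s > 0}" "connected {s. Re s > 0}"
      by (auto intro: open_halfspace_Re_gt convex_connected convex_halfspace_Re_gt)
    show "of_real ` {e0..} \<subseteq> {s. Re s > 0}" "complex_of_real e0 \<in> {s. Re s > 0}" "s \<in> {s. Re s > 0}"
      using s by (auto simp: e0_def)
    show "complex_of_real e0 islimpt of_real ` {e0..}"
      unfolding islimpt_approachable
    proof (intro allI impI)
      fix e :: real assume e: "e > 0"
      have "dist (complex_of_real (e0 + e / 2)) (of_real e0) = e / 2"
        using e by (simp add: dist_norm)
      then show "\<exists>x'\<in>of_real ` {e0..}. x' \<noteq> complex_of_real e0 \<and> dist x' (of_real e0) < e"
        using e by (intro bexI[of _ "of_real (e0 + e / 2)"] imageI) (auto simp: complex_eq_iff)
    qed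
    show "G z - z * L z = 0" if "z \<in> of_real ` {e0..}" for z
      using that parts by (auto simp: e0_def)
  qed
  define \<epsilon> where "\<epsilon> n = 1 / (real n + 1)" for n
  have eps: "\<epsilon> n > 0" for n by (simp add: \<epsilon>_def)
  \<comment> \<open>With \<open>y = \<epsilon> * x\<close> the product
    \<open>\<epsilon> * L \<epsilon>\<close> becomes an average of \<open>H (y / \<epsilon>)\<close>
    with weight \<open>exp (- y)\<close>, which tends to \<open>I\<close> by dominated
    convergence.\<close>
  have "(\<lambda>n. LINT y:{0<..}|lborel. of_real (exp (- y)) * H (1 / \<epsilon> n * y)) \<longlonglongrightarrow> (LINT y:{0<..}|lborel. of_real (exp (- y)) * I)"
  proof (rule LINT_Ioi_dominated_convergence(2))
    show "set_integrable lborel {0<..} (\<lambda>x. M * exp (- (1 * x)))" by (rule exp_int) simp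
    show "set_borel_measurable borel {0<..} (\<lambda>y. of_real (exp (- y)) * H (1 / \<epsilon> n * y))" for n
      by (intro set_borel_measurable_Ioi continuous_intros continuous_on_compose2[OF Hcont]) (use eps in auto)
    show "norm (of_real (exp (- x)) * H (1 / \<epsilon> n * x)) \<le> M * exp (- (1 * x))" if "x > 0" for n x
      using M(2)[of "1 / \<epsilon> n * x"] eps[of n] that by (simp add: norm_mult mult.commute[of M])
    show "(\<lambda>n. of_real (exp (- x)) * H (1 / \<epsilon> n * x)) \<longlonglongrightarrow> of_real (exp (- x)) * I" if "x > 0" for x
    proof (intro tendsto_mult tendsto_const filterlim_compose[OF lim])
      show "filterlim (\<lambda>n. 1 / \<epsilon> n * x) at_top sequentially"
        unfolding \<epsilon>_def using that by real_asymp
    qed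
  qed
  moreover have "(LINT y:{0<..}|lborel. of_real (exp (- y)) * H (1 / \<epsilon> n * y)) = G (of_real (\<epsilon> n))" for n
  proof -
    have "(LINT y:{0<..}|lborel. of_real (exp (- y)) * H (1 / \<epsilon> n * y)) =
        \<epsilon> n *\<^sub>R (LINT x:{0<..}|lborel. of_real (exp (- (\<epsilon> n * x))) * H (1 / \<epsilon> n * (\<epsilon> n * x)))"
      by (rule LINT_Ioi_scale(2)[OF eps])
    also have "(LINT x:{0<..}|lborel. of_real (exp (- (\<epsilon> n * x))) * H (1 / \<epsilon> n * (\<epsilon> n * x))) = L (of_real (\<epsilon> n))"
      unfolding L_def l_def using eps[of n] by (intro set_lebesgue_integral_cong) (auto simp: exp_of_real[symmetric])
    finally show ?thesis using GL[of "of_real (\<epsilon> n)"] eps[of n] by (simp add: scaleR_conv_of_real)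
  qed
  moreover have "(LINT y:{0<..}|lborel. of_real (exp (- y)) * I) = I"
  proof -
    have "(LINT y:{0<..}|lborel. complex_of_real (exp (- y))) = (LINT y:{0<..}|lborel. of_real y powr (1 - 1) * of_real (exp (- (1 * y))))"
      by (intro set_lebesgue_integral_cong) auto
    then show ?thesis using LINT_Gamma(2)[of 1 1] by simp
  qed
  moreover have "(\<lambda>n. G (of_real (\<epsilon> n))) \<longlonglongrightarrow> G 0"
  proof (rule isCont_tendsto_compose[where g=G])
    show "isCont G 0" using holomorphic_on_imp_continuous_on[OF G] by (simp add: continuous_on_eq_continuous_at)
    have "\<epsilon> \<longlonglongrightarrow> 0" unfolding \<epsilon>_def by real_asymp
    then show "(\<lambda>n. of_real (\<epsilon> n)) \<longlonglongrightarrow> (0 :: complex)" using tendsto_of_real by fastforce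
  qed
  ultimately have "I = G 0" using LIMSEQ_unique by auto
  then show ?thesis by (simp add: I_def)
qed

lemma integrable_on_atLeast_0:
  fixes f :: "real \<Rightarrow> complex"
  assumes "set_integrable lborel {0<..} f"
  shows "f integrable_on {0..}"
  by (rule integrable_spike_set[OF set_borel_integral_eq_integral(1)[OF assms]])
     (auto intro: negligible_subset[OF negligible_sing[of 0]])

lemma sine_integrand_eq:
  "sine_integrand a \<nu> \<mu> z x = (exp (\<i> * (of_real pi * \<mu> / 2)) * laplace_integrand a \<nu> \<mu> (- (\<i> * z)) x
     - exp (- (\<i> * (of_real pi * \<mu> / 2))) * laplace_integrand a \<nu> \<mu> (\<i> * z) x) / (2 * \<i>)"
proof -
  have "\<i> * (z * of_real x + of_real pi * \<mu> / 2) = \<i> * (of_real pi * \<mu> / 2) + - (- (\<i> * z) * of_real x)"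
    by (simp add: algebra_simps)
  then have 1: "exp (\<i> * (z * of_real x + of_real pi * \<mu> / 2)) = exp (\<i> * (of_real pi * \<mu> / 2)) * exp (- (- (\<i> * z) * of_real x))"
    by (simp only: exp_add)
  have "- (\<i> * (z * of_real x + of_real pi * \<mu> / 2)) = - (\<i> * (of_real pi * \<mu> / 2)) + - (\<i> * z * of_real x)"
    by (simp add: algebra_simps)
  then have 2: "exp (- (\<i> * (z * of_real x + of_real pi * \<mu> / 2))) = exp (- (\<i> * (of_real pi * \<mu> / 2))) * exp (- (\<i> * z * of_real x))"
    by (simp only: exp_add)
  show ?thesis
    unfolding sine_integrand_def sin_exp_eq 1 2 laplace_integrand_def by (simp add: field_simps)
qed

text \<open>Abel's damping factor only translates \<open>w\<close>, so the hypotheses of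
  \<open>Abel_integral\<close> are instances of results already known for the transform.\<close>

lemma exp_times_laplace_integrand:
  "exp (- (e * of_real x)) * laplace_integrand a \<nu> \<mu> w x = laplace_integrand a \<nu> \<mu> (w + e) x"
  by (simp add: laplace_integrand_def algebra_simps flip: exp_add mult.assoc)

text \<open>For \<open>Re a = 0\<close> the integrals can diverge for some \<open>z\<close>, and
  \<open>integral\<close> then returns \<open>0\<close>. The identities are therefore tied to
  convergence, and convergence is asserted separately where it is absolute.\<close>

theorem theorem2:
  fixes a \<nu> \<mu> :: complex
  assumes "a \<noteq> 0" and "Re a \<ge> 0" and "0 < Re \<mu>" and "Re \<mu> < 2"
  shows "(\<forall>z.
      (0 < Re a \<or> 0 < Re z \<longrightarrow> laplace_integrand a \<nu> \<mu> z integrable_on {0..}) \<and>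
      (laplace_integrand a \<nu> \<mu> z integrable_on {0..} \<longrightarrow>
        of_real (sqrt 2) * a powr (\<mu> / 2) * sin (of_real pi * \<mu>) / of_real (sqrt pi)
            * Psi_hat a \<nu> \<mu> z =
          exp (of_real pi * \<i> / 2 * \<mu>)
            * parabolic_D (- \<nu>) (\<i> * z / csqrt a)
            * parabolic_D (\<mu> - \<nu> - 1) (- (\<i> * z / csqrt a)) +
          exp (- (of_real pi * \<i> / 2 * \<mu>))
            * parabolic_D (- \<nu>) (- (\<i> * z / csqrt a))
            * parabolic_D (\<mu> - \<nu> - 1) (\<i> * z / csqrt a))) \<and>
    (\<forall>z.
      (0 < Re a \<longrightarrow> sine_integrand a \<nu> \<mu> z integrable_on {0..}) \<and>
      (sine_integrand a \<nu> \<mu> z integrable_on {0..} \<longrightarrow>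
        parabolic_D (- \<nu>) (z / csqrt a) * parabolic_D (\<mu> - \<nu> - 1) (- (z / csqrt a)) =
          2 * a powr (\<mu> / 2) / of_real (sqrt (2 * pi))
            * integral {0..} (sine_integrand a \<nu> \<mu> z)))"
proof -
  have mu: "\<mu> \<in> strip" using assms by simp
  note a = assms(2) assms(1)
  define c where "c = \<i> * (of_real pi * \<mu> / 2)"
  define \<kappa> where "\<kappa> = (of_real (sqrt (2 * pi)) / 2 :: complex)"
  have lap_int: "set_integrable lborel {0<..} (laplace_integrand a \<nu> \<mu> z)" if "0 < Re a \<or> 0 < Re z" for z
    by (rule set_integrable_laplace[OF mu a that])
  have sine_int: "set_integrable lborel {0<..} (\<lambda>x. (exp c * laplace_integrand a \<nu> \<mu> w1 x - exp (- c) * laplace_integrand a \<nu> \<mu> w2 x) / (2 * \<i>))"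
    if "0 < Re a \<or> 0 < Re w1" "0 < Re a \<or> 0 < Re w2" for w1 w2
    by (intro set_integrable_divide set_integral_diff set_integrable_mult_right lap_int that)
  have cancel: "a powr (\<mu> / 2) * a powr (- \<mu> / 2) = 1"
    using a by (simp flip: powr_add)
  have hat: "Psi_hat a \<nu> \<mu> z = Psi_laplace_extension a \<nu> \<mu> z"
    if "laplace_integrand a \<nu> \<mu> z integrable_on {0..}" for z
  proof -
    have "integral {0..} (laplace_integrand a \<nu> \<mu> z) = Psi_laplace_extension a \<nu> \<mu> (z + 0)"
    \<comment> \<open>Beyond this threshold \<open>z + e\<close> has positive real part, where
      transform and extension agree for all admissible \<open>a\<close>.\<close>
    proof (rule Abel_integral[OF that, of _ "\<bar>Re z\<bar> + 1"])
      show "continuous_on {0<..} (laplace_integrand a \<nu> \<mu> z)"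
        by (rule continuous_on_laplace_integrand[OF mu a])
      show "(\<lambda>s. Psi_laplace_extension a \<nu> \<mu> (z + s)) holomorphic_on UNIV"
        by (intro Psi_laplace_extension_holomorphic mu a holomorphic_intros)
      fix e :: real assume "e \<ge> \<bar>Re z\<bar> + 1"
      then have e: "Re (z + of_real e) > 0" by auto
      show "set_integrable lborel {0<..} (\<lambda>x. exp (- (of_real e * of_real x)) * laplace_integrand a \<nu> \<mu> z x)"
        unfolding exp_times_laplace_integrand using e by (intro lap_int) simp
      show "(LINT x:{0<..}|lborel. exp (- (of_real e * of_real x)) * laplace_integrand a \<nu> \<mu> z x) =
          Psi_laplace_extension a \<nu> \<mu> (z + of_real e)"
        unfolding exp_times_laplace_integrand using Psi_laplace_eq_extension[OF mu a e] by (simp add: Psi_laplace_def)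
    qed
    then show ?thesis by (simp add: Psi_hat_def)
  qed
  have sine: "integral {0..} (sine_integrand a \<nu> \<mu> z) = a powr (- \<mu> / 2) * (\<kappa> * D_product (- \<nu>) (\<mu> - \<nu> - 1) (z / csqrt a))"
    if "sine_integrand a \<nu> \<mu> z integrable_on {0..}" for z
  proof -
    define G where "G s = (exp c * Psi_laplace_extension a \<nu> \<mu> (- (\<i> * z) + s) - exp (- c) * Psi_laplace_extension a \<nu> \<mu> (\<i> * z + s)) / (2 * \<i>)" for s
    have seq: "exp (- (e * of_real x)) * sine_integrand a \<nu> \<mu> z x =
       (exp c * laplace_integrand a \<nu> \<mu> (- (\<i> * z) + e) x - exp (- c) * laplace_integrand a \<nu> \<mu> (\<i> * z + e) x) / (2 * \<i>)" for e x
      unfolding sine_integrand_eq c_def exp_times_laplace_integrand[symmetric] by (simp add: algebra_simps)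
    have "integral {0..} (sine_integrand a \<nu> \<mu> z) = G 0"
    \<comment> \<open>The Laplace variables \<open>- (\<i> * z)\<close> and \<open>\<i> * z\<close>
      have real parts \<open>Im z\<close> and \<open>- Im z\<close>; the threshold moves both into
      the right half-plane.\<close>
    proof (rule Abel_integral[OF that, of _ "\<bar>Im z\<bar> + 1"])
      show "continuous_on {0<..} (sine_integrand a \<nu> \<mu> z)"
        unfolding sine_integrand_def by (intro continuous_intros continuous_on_Psi_kernel[OF mu a])
      show "G holomorphic_on UNIV"
        unfolding G_def by (intro holomorphic_intros Psi_laplace_extension_holomorphic mu a) auto
      fix e :: real assume "e \<ge> \<bar>Im z\<bar> + 1"
      then have e: "Re (- (\<i> * z) + of_real e) > 0" "Re (\<i> * z + of_real e) > 0" by auto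
      show "set_integrable lborel {0<..} (\<lambda>x. exp (- (of_real e * of_real x)) * sine_integrand a \<nu> \<mu> z x)"
        unfolding seq using e by (intro sine_int) auto
      have i: "set_integrable lborel {0<..} (\<lambda>x. k * laplace_integrand a \<nu> \<mu> w x)" if "Re w > 0" for k w
        using that by (intro set_integrable_mult_right lap_int) auto
      show "(LINT x:{0<..}|lborel. exp (- (of_real e * of_real x)) * sine_integrand a \<nu> \<mu> z x) = G (of_real e)"
        unfolding seq set_integral_divide_zero set_integral_diff(2)[OF i[OF e(1)] i[OF e(2)]] set_integral_mult_right
        using Psi_laplace_eq_extension[OF mu a e(1)] Psi_laplace_eq_extension[OF mu a e(2)]
        by (simp add: Psi_laplace_def G_def)
    qed
    also have "G 0 = a powr (- \<mu> / 2) * sine_transform \<nu> \<mu> (z / csqrt a)"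
      by (simp add: G_def Psi_laplace_extension_def sine_transform_def c_def algebra_simps diff_divide_distrib)
    finally show ?thesis
      unfolding sine_transform_eq_D_product[OF mu] \<kappa>_def .
  qed
  \<comment> \<open>With weights \<open>exp c\<close> and \<open>exp (- c)\<close> the transforms at
    \<open>- w\<close> cancel, and those at \<open>w\<close> collect the factor
    \<open>sin (pi * \<mu>)\<close>.\<close>
  have trig: "sin (of_real pi * \<mu>) * Psi_laplace 1 \<nu> \<mu> w = exp c * (\<kappa> * D_product (- \<nu>) (\<mu> - \<nu> - 1) (\<i> * w))
      + exp (- c) * (\<kappa> * D_product (- \<nu>) (\<mu> - \<nu> - 1) (- (\<i> * w)))" for w
  proof -
    have cc: "exp c * exp c = exp (\<i> * (of_real pi * \<mu>))" "exp (- c) * exp (- c) = exp (- (\<i> * (of_real pi * \<mu>)))" "exp c * exp (- c) = 1"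
      by (simp_all add: c_def mult_ac flip: exp_add)
    have e: "- (\<i> * (\<i> * w)) = w" "\<i> * (\<i> * w) = - w" "- (\<i> * - (\<i> * w)) = - w" "\<i> * - (\<i> * w) = w"
      by (simp_all flip: mult.assoc)
    have "exp c * sine_transform \<nu> \<mu> (\<i> * w) + exp (- c) * sine_transform \<nu> \<mu> (- (\<i> * w)) =
        (exp c * exp c - exp (- c) * exp (- c)) / (2 * \<i>) * Psi_laplace 1 \<nu> \<mu> w"
      unfolding sine_transform_def c_def[symmetric] e by (simp add: field_simps)
    also have "\<dots> = sin (of_real pi * \<mu>) * Psi_laplace 1 \<nu> \<mu> w"
      unfolding cc sin_exp_eq ..
    finally show ?thesis unfolding sine_transform_eq_D_product[OF mu] \<kappa>_def by simp
  qed
  have kap: "of_real (sqrt 2) / of_real (sqrt pi) * \<kappa> = 1" "2 / of_real (sqrt (2 * pi)) * \<kappa> = 1"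
  proof -
    have "sqrt 2 / sqrt pi * (sqrt (2 * pi) / 2) = 1"
      by (simp add: real_sqrt_mult)
    then have "complex_of_real (sqrt 2 / sqrt pi * (sqrt (2 * pi) / 2)) = of_real 1" by (simp only:)
    then show "of_real (sqrt 2) / of_real (sqrt pi) * \<kappa> = 1" by (simp add: \<kappa>_def)
  qed (simp add: \<kappa>_def)
  have ec: "exp (of_real pi * \<i> / 2 * \<mu>) = exp c" "exp (- (of_real pi * \<i> / 2 * \<mu>)) = exp (- c)"
    by (simp_all add: c_def mult_ac)
  show ?thesis
  proof (intro conjI allI impI)
    fix z
    show "laplace_integrand a \<nu> \<mu> z integrable_on {0..}" if "0 < Re a \<or> 0 < Re z"
      by (rule integrable_on_atLeast_0[OF lap_int[OF that]])
    show "sine_integrand a \<nu> \<mu> z integrable_on {0..}" if "0 < Re a"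
      using sine_int[of "- (\<i> * z)" "\<i> * z"] that
      by (intro integrable_on_atLeast_0) (simp add: sine_integrand_eq[abs_def] c_def)
    show "of_real (sqrt 2) * a powr (\<mu> / 2) * sin (of_real pi * \<mu>) / of_real (sqrt pi) * Psi_hat a \<nu> \<mu> z =
          exp (of_real pi * \<i> / 2 * \<mu>) * parabolic_D (- \<nu>) (\<i> * z / csqrt a) * parabolic_D (\<mu> - \<nu> - 1) (- (\<i> * z / csqrt a)) +
          exp (- (of_real pi * \<i> / 2 * \<mu>)) * parabolic_D (- \<nu>) (- (\<i> * z / csqrt a)) * parabolic_D (\<mu> - \<nu> - 1) (\<i> * z / csqrt a)"
      if "laplace_integrand a \<nu> \<mu> z integrable_on {0..}"
    proof -
      have "of_real (sqrt 2) * a powr (\<mu> / 2) * sin (of_real pi * \<mu>) / of_real (sqrt pi) * Psi_hat a \<nu> \<mu> z =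
         of_real (sqrt 2) / of_real (sqrt pi) * (a powr (\<mu> / 2) * a powr (- \<mu> / 2)) * (sin (of_real pi * \<mu>) * Psi_laplace 1 \<nu> \<mu> (z / csqrt a))"
        unfolding hat[OF that] Psi_laplace_extension_def by simp
      also have "\<dots> = of_real (sqrt 2) / of_real (sqrt pi) * \<kappa> *
          (exp c * D_product (- \<nu>) (\<mu> - \<nu> - 1) (\<i> * (z / csqrt a)) + exp (- c) * D_product (- \<nu>) (\<mu> - \<nu> - 1) (- (\<i> * (z / csqrt a))))"
        unfolding cancel trig by (simp add: algebra_simps)
      finally show ?thesis unfolding kap ec D_product_def by simp
    qed
    show "parabolic_D (- \<nu>) (z / csqrt a) * parabolic_D (\<mu> - \<nu> - 1) (- (z / csqrt a)) =
          2 * a powr (\<mu> / 2) / of_real (sqrt (2 * pi)) * integral {0..} (sine_integrand a \<nu> \<mu> z)"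
      if "sine_integrand a \<nu> \<mu> z integrable_on {0..}"
    proof -
      have "2 * a powr (\<mu> / 2) / of_real (sqrt (2 * pi)) * integral {0..} (sine_integrand a \<nu> \<mu> z) =
        (a powr (\<mu> / 2) * a powr (- \<mu> / 2)) * (2 / of_real (sqrt (2 * pi)) * \<kappa>) * D_product (- \<nu>) (\<mu> - \<nu> - 1) (z / csqrt a)"
        unfolding sine[OF that] by simp
      then show ?thesis unfolding cancel kap D_product_def by simp
    qed
  qed
qed

end
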